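(* Let $\tilde B$ be an extended exchange matrix of full rank and of finite type, with principal part $B$ an exchange matrix of type $D$. Then $\operatorname{Trop}_{>0}X(\tilde B)/L$ is combinatorially isomorphic to the complete fan $\mathcal{N}(B)$, where $L$ is the lineality space of $\operatorname{Trop}_{>0}X(\tilde B)$.
   Context: Cluster set-up. $D$ is a connected finite type Dynkin diagram with vertex set $\{1,\dots,n\}$ and Cartan matrix $(a_{ij})$. Fix an orientation of the underlying tree of $D$, with edges written $i\to j$; the associated exchange matrix $B$ (of type $D$) has $B_{ij}=-a_{ij}$ if $i\to j$, $B_{ij}=a_{ij}$ if $j\to i$, and $B_{ij}=0$ otherwise. An extended exchange matrix $\tilde B$ is an $(n+m)\times n$ integer matrix with top block $B$; it has full rank if its rank is $n$. The cluster algebra $\mathcal{A}(\tilde B)$ is the $\mathbb{C}$-algebra generated by the mutable cluster variables $x_\gamma$ ($\gamma\in\Pi$, a finite index set), the frozen variables $x_{n+1},\dots,x_{n+m}$ and their inverses; the exchange relation at a seed with matrix $(b_{ij})$ is $x_kx_k'=\prod_{b_{ik}>0}x_i^{b_{ik}}+\prod_{b_{ik}<0}x_i^{-b_{ik}}$. $X(\tilde B)=\operatorname{Spec}\mathcal{A}(\tilde B)$, embedded in $\mathbb{C}^{|\Pi|+m}$ by the coordinates $x_\gamma$ ($\gamma\in\Pi$) and $x_{n+1},\dots,x_{n+m}$. Positive tropicalization. $\mathcal{R}=\bigcup_{n\ge1}\mathbb{R}((t^{1/n}))$ is the field of real Puiseux series, $\mathrm{val}(x(t))=r$ if the lowest term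 of $x(t)$ is $\alpha t^r$ with $\alpha\in\mathbb{R}^\times$, and $\mathcal{R}_{>0}$ is the set of nonzero series whose lowest coefficient is positive. $X(\tilde B)(\mathcal{R}_{>0})$ is the set of $\mathcal{R}$-points all of whose coordinates $x_\gamma,x_{n+1},\dots,x_{n+m}$ lie in $\mathcal{R}_{>0}$. $\operatorname{Trop}_{>0}X(\tilde B)\subset\mathbb{R}^{|\Pi|+m}$ is the closure of the set of coordinatewise valuations of points in $X(\tilde B)(\mathcal{R}_{>0})$. Projection to the coordinates $x_1,\dots,x_{n+m}$ of the initial extended cluster identifies it with a complete polyhedral fan in $\mathbb{R}^{n+m}$, whose maximal cones are the maximal common domains of linearity of the tropicalizations (replacing $+,\times,\div$ by $\min,+,-$) of all cluster variables expressed in the initial cluster. The lineality space $L$ is the largest linear subspace contained in all cones of the fan. A combinatorial isomorphism of fans is an inclusion-preserving bijection between their sets of cones. Cluster fan. In the principal coefficient cluster algebra of $B$ (extended matrix with top half $B$ and bottom half the identity, frozen variables $y_1,\dots,y_n$), with $\deg x_i=e_i$, $\deg y_i=-Be_i$, each cluster variable is homogeneous and its degree in $\mathbb{Z}^n$ is its $\mathbf{g}$-vector. $\mathcal{N}(B)$ is the complete fan in $\mathbb{R}^n$ whose cones are spanned by the $\mathbf{g}$-vectors of sets of cluster variables contained in a common cluster. *)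

theory Defs
  imports
    "HOL-Analysis.Analysis"
    "HOL-Library.Poly_Mapping"
    "HOL-Library.Function_Algebras"
    "HOL-Computational_Algebra.Fraction_Field"
    "HOL-Computational_Algebra.Formal_Laurent_Series"
begin

unbundle no Formal_Power_Series.fps_syntax

section \<open>Puiseux series\<close>

lemma fls_compose_power_compose:
  assumes "d > 0" "e > 0"
  shows "fls_compose_power (fls_compose_power f d) e = fls_compose_power f (d * e)"
proof (rule fls_eqI)
  fix n :: int
  have "int d * int e dvd n \<longleftrightarrow> int e dvd n \<and> int d dvd n div int e"
    using assms by (metis dvd_div_iff_mult dvd_mult_right mult.commute of_nat_0_less_iff not_less_iff_gr_or_eq)
  then show "fls_nth (fls_compose_power (fls_compose_power f d) e) n = fls_nth (fls_compose_power f (d * e)) n"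
    using assms by (auto simp: fls_nth_compose_power zdiv_zmult2_eq mult.commute)
qed

lemma fls_compose_power_inject:
  assumes "d > 0" "fls_compose_power f d = fls_compose_power g d"
  shows "f = g"
proof (rule fls_eqI)
  fix n :: int
  have "fls_nth (fls_compose_power f d) (int d * n) = fls_nth (fls_compose_power g d) (int d * n)"
    using assms by simp
  then show "fls_nth f n = fls_nth g n" using assms(1) by (simp add: fls_nth_compose_power)
qed

text \<open>The pair \<open>(k, f)\<close> stands for \<open>f (t\<^bsup>1/(k+1)\<^esup>)\<close>; two pairs are
  identified if they agree after substituting a common root of \<open>t\<close>.\<close>

definition puiseux_rel :: "nat \<times> 'a::zero fls \<Rightarrow> nat \<times> 'a fls \<Rightarrow> bool" where
  "puiseux_rel x y \<longleftrightarrow>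
     fls_compose_power (snd x) (Suc (fst y)) = fls_compose_power (snd y) (Suc (fst x))"

lemma equivp_puiseux_rel: "equivp (puiseux_rel :: nat \<times> 'a::zero fls \<Rightarrow> nat \<times> 'a fls \<Rightarrow> bool)"
proof (rule equivpI)
  show "reflp (puiseux_rel :: nat \<times> 'a fls \<Rightarrow> _)" by (simp add: reflp_def puiseux_rel_def)
  show "symp (puiseux_rel :: nat \<times> 'a fls \<Rightarrow> _)" by (simp add: symp_def puiseux_rel_def)
  show "transp (puiseux_rel :: nat \<times> 'a fls \<Rightarrow> _)"
  proof (rule transpI)
    fix x y z :: "nat \<times> 'a fls"
    assume xy: "puiseux_rel x y" and yz: "puiseux_rel y z"
    let ?k = "Suc (fst x)" and ?l = "Suc (fst y)" and ?m = "Suc (fst z)"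
    have "fls_compose_power (fls_compose_power (snd x) ?m) ?l
        = fls_compose_power (fls_compose_power (snd x) ?l) ?m"
      by (simp only: fls_compose_power_compose mult.commute zero_less_Suc)
    also have "\<dots> = fls_compose_power (fls_compose_power (snd y) ?k) ?m"
      using xy by (simp add: puiseux_rel_def)
    also have "\<dots> = fls_compose_power (fls_compose_power (snd y) ?m) ?k"
      by (simp only: fls_compose_power_compose mult.commute zero_less_Suc)
    also have "\<dots> = fls_compose_power (fls_compose_power (snd z) ?l) ?k"
      using yz by (simp add: puiseux_rel_def)
    also have "\<dots> = fls_compose_power (fls_compose_power (snd z) ?k) ?l"
      by (simp only: fls_compose_power_compose mult.commute zero_less_Suc)
    finally show "puiseux_rel x z"
      unfolding puiseux_rel_def using fls_compose_power_inject[of ?l] by blast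
  qed
qed

quotient_type (overloaded) 'a puiseux = "nat \<times> 'a::zero fls" / puiseux_rel
  by (rule equivp_puiseux_rel)

definition puiseux_of :: "nat \<Rightarrow> 'a::zero fls \<Rightarrow> 'a puiseux" where
  "puiseux_of d f = abs_puiseux (d - 1, f)"

definition puiseux_den :: "'a::zero puiseux \<Rightarrow> nat" where
  "puiseux_den x = Suc (fst (rep_puiseux x))"

definition puiseux_series :: "'a::zero puiseux \<Rightarrow> 'a fls" where
  "puiseux_series x = snd (rep_puiseux x)"

lemma puiseux_den_pos [simp]: "puiseux_den x > 0"
  by (simp add: puiseux_den_def)

lemma puiseux_of_eq_iff:
  assumes "d > 0" "e > 0"
  shows "puiseux_of d f = puiseux_of e g \<longleftrightarrow> fls_compose_power f e = fls_compose_power g d"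
  using assms by (simp add: puiseux_of_def puiseux.abs_eq_iff puiseux_rel_def)

lemma puiseux_of_den_series [simp]: "puiseux_of (puiseux_den x) (puiseux_series x) = x"
  using Quotient_abs_rep[OF Quotient_puiseux]
  by (simp add: puiseux_of_def puiseux_den_def puiseux_series_def)

lemma puiseux_series_compose:
  assumes "d > 0"
  shows "fls_compose_power (puiseux_series (puiseux_of d f)) d
       = fls_compose_power f (puiseux_den (puiseux_of d f))"
  using assms puiseux_of_den_series[of "puiseux_of d f"]
  by (metis puiseux_of_eq_iff puiseux_den_pos)

lemma puiseux_of_compose_power:
  "d > 0 \<Longrightarrow> e > 0 \<Longrightarrow> puiseux_of (d * e) (fls_compose_power f e) = puiseux_of d f"
  by (simp add: puiseux_of_eq_iff fls_compose_power_compose mult.commute)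

lemma puiseux_common_denominator:
  obtains d f g h where "d > 0" "x = puiseux_of d f" "y = puiseux_of d g" "z = puiseux_of d h"
proof -
  let ?a = "puiseux_den x" and ?b = "puiseux_den y" and ?c = "puiseux_den z"
  have "x = puiseux_of (?a * ?b * ?c) (fls_compose_power (puiseux_series x) (?b * ?c))"
    "y = puiseux_of (?a * ?b * ?c) (fls_compose_power (puiseux_series y) (?a * ?c))"
    "z = puiseux_of (?a * ?b * ?c) (fls_compose_power (puiseux_series z) (?a * ?b))"
    using puiseux_of_compose_power[of ?a "?b * ?c" "puiseux_series x"]
      puiseux_of_compose_power[of ?b "?a * ?c" "puiseux_series y"]
      puiseux_of_compose_power[of ?c "?a * ?b" "puiseux_series z"]
    by (simp_all add: mult_ac)
  then show thesis using that[of "?a * ?b * ?c"] by simp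
qed

instantiation puiseux :: (idom) comm_ring_1
begin

definition zero_puiseux :: "'a puiseux" where "0 = puiseux_of 1 0"

definition one_puiseux :: "'a puiseux" where "1 = puiseux_of 1 1"

definition uminus_puiseux :: "'a puiseux \<Rightarrow> 'a puiseux" where
  "- x = puiseux_of (puiseux_den x) (- puiseux_series x)"

definition plus_puiseux :: "'a puiseux \<Rightarrow> 'a puiseux \<Rightarrow> 'a puiseux" where
  "x + y = puiseux_of (puiseux_den x * puiseux_den y)
     (fls_compose_power (puiseux_series x) (puiseux_den y)
      + fls_compose_power (puiseux_series y) (puiseux_den x))"

definition times_puiseux :: "'a puiseux \<Rightarrow> 'a puiseux \<Rightarrow> 'a puiseux" where
  "x * y = puiseux_of (puiseux_den x * puiseux_den y)
     (fls_compose_power (puiseux_series x) (puiseux_den y)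
      * fls_compose_power (puiseux_series y) (puiseux_den x))"

definition minus_puiseux :: "'a puiseux \<Rightarrow> 'a puiseux \<Rightarrow> 'a puiseux" where
  "minus_puiseux x y = x + - y"

lemma puiseux_of_0: "d > 0 \<Longrightarrow> puiseux_of d 0 = (0 :: 'a puiseux)"
  by (simp add: zero_puiseux_def puiseux_of_eq_iff)

lemma puiseux_of_1: "d > 0 \<Longrightarrow> puiseux_of d 1 = (1 :: 'a puiseux)"
  by (simp add: one_puiseux_def puiseux_of_eq_iff)

lemma puiseux_of_uminus: "d > 0 \<Longrightarrow> puiseux_of d (- f) = - (puiseux_of d f :: 'a puiseux)"
  by (simp add: uminus_puiseux_def puiseux_of_eq_iff puiseux_series_compose)

lemma puiseux_of_add:
  assumes "d > 0"
  shows "puiseux_of d (f + g) = (puiseux_of d f + puiseux_of d g :: 'a puiseux)"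
proof -
  let ?x = "puiseux_of d f" and ?y = "puiseux_of d g"
  let ?a = "puiseux_den ?x" and ?b = "puiseux_den ?y"
  have "fls_compose_power (fls_compose_power (puiseux_series ?x) ?b) d = fls_compose_power f (?a * ?b)"
    "fls_compose_power (fls_compose_power (puiseux_series ?y) ?a) d = fls_compose_power g (?a * ?b)"
    using assms puiseux_series_compose[OF assms, of f] puiseux_series_compose[OF assms, of g]
    by (metis fls_compose_power_compose mult.commute puiseux_den_pos)+
  then show ?thesis
    using assms by (simp add: plus_puiseux_def puiseux_of_eq_iff)
qed

lemma puiseux_of_mult:
  assumes "d > 0"
  shows "puiseux_of d (f * g) = (puiseux_of d f * puiseux_of d g :: 'a puiseux)"
proof -
  let ?x = "puiseux_of d f" and ?y = "puiseux_of d g"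
  let ?a = "puiseux_den ?x" and ?b = "puiseux_den ?y"
  have "fls_compose_power (fls_compose_power (puiseux_series ?x) ?b) d = fls_compose_power f (?a * ?b)"
    "fls_compose_power (fls_compose_power (puiseux_series ?y) ?a) d = fls_compose_power g (?a * ?b)"
    using assms puiseux_series_compose[OF assms, of f] puiseux_series_compose[OF assms, of g]
    by (metis fls_compose_power_compose mult.commute puiseux_den_pos)+
  then show ?thesis
    using assms by (simp add: times_puiseux_def puiseux_of_eq_iff)
qed

instance
proof
  fix x y z :: "'a puiseux"
  obtain d f g h where d: "d > 0" and
    xyz: "x = puiseux_of d f" "y = puiseux_of d g" "z = puiseux_of d h"
    by (rule puiseux_common_denominator)
  note [simp] = puiseux_of_0[OF d, symmetric] puiseux_of_1[OF d, symmetric]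
    puiseux_of_add[OF d, symmetric] puiseux_of_mult[OF d, symmetric]
    puiseux_of_uminus[OF d, symmetric] minus_puiseux_def
  show "x * y * z = x * (y * z)" "x * y = y * x" "1 * x = x" "x + y + z = x + (y + z)"
    "x + y = y + x" "0 + x = x" "- x + x = 0" "x - y = x + - y" "(x + y) * z = x * z + y * z"
    by (simp_all add: xyz algebra_simps)
  show "(0 :: 'a puiseux) \<noteq> 1"
    unfolding zero_puiseux_def one_puiseux_def by (subst puiseux_of_eq_iff) simp_all
qed

end

instantiation puiseux :: (field) field
begin

definition inverse_puiseux :: "'a puiseux \<Rightarrow> 'a puiseux" where
  "inverse x = puiseux_of (puiseux_den x) (inverse (puiseux_series x))"

definition divide_puiseux :: "'a puiseux \<Rightarrow> 'a puiseux \<Rightarrow> 'a puiseux" where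
  "x div y = x * inverse y" for x y :: "'a puiseux"

instance
proof
  fix x y :: "'a puiseux"
  show "inverse x * x = 1" if "x \<noteq> 0"
  proof -
    let ?d = "puiseux_den x" and ?f = "puiseux_series x"
    have "?f \<noteq> 0" using that puiseux_of_0[of ?d] by (metis puiseux_den_pos puiseux_of_den_series)
    then have "puiseux_of ?d (inverse ?f * ?f) = 1" by (simp add: puiseux_of_1)
    then show ?thesis
      unfolding inverse_puiseux_def puiseux_of_mult[OF puiseux_den_pos] by simp
  qed
  show "x div y = x * inverse y" by (simp add: divide_puiseux_def)
  show "inverse (0 :: 'a puiseux) = 0"
  proof -
    have "puiseux_series (0 :: 'a puiseux) = 0"
      using puiseux_series_compose[of 1 "0 :: 'a fls"]
        fls_compose_power_inject[of 1 "puiseux_series (puiseux_of 1 0)" "0 :: 'a fls"]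
      by (simp add: zero_puiseux_def)
    then show ?thesis by (simp add: inverse_puiseux_def puiseux_of_0)
  qed
qed

end

definition puiseux_const :: "'a::zero \<Rightarrow> 'a puiseux" where
  "puiseux_const c = puiseux_of 1 (fls_const c)"

definition puiseux_val :: "'a::zero puiseux \<Rightarrow> real" where
  "puiseux_val x = real_of_int (fls_subdegree (puiseux_series x)) / real (puiseux_den x)"

definition puiseux_lead :: "'a::zero puiseux \<Rightarrow> 'a" where
  "puiseux_lead x = fls_nth (puiseux_series x) (fls_subdegree (puiseux_series x))"

text \<open>The field of real Puiseux series, inside the complex ones. As the cluster algebra is a
  \<open>\<complex>\<close>-algebra, real points are its complex Puiseux points with real coordinates.\<close>

definition real_puiseux :: "complex puiseux set" where
  "real_puiseux = {x. \<forall>k. fls_nth (puiseux_series x) k \<in> \<real>}"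

definition pos_puiseux :: "complex puiseux set" where
  "pos_puiseux = {x \<in> real_puiseux. x \<noteq> 0 \<and> Re (puiseux_lead x) > 0}"

lemma fls_subdegree_compose_power:
  assumes "d > 0" shows "fls_subdegree (fls_compose_power f d) = int d * fls_subdegree f"
proof (cases "f = 0")
  case False
  then show ?thesis
    using assms
    by (intro fls_subdegree_eqI)
       (auto simp: fls_nth_compose_power elim!: dvdE intro!: fls_eq0_below_subdegree)
qed simp

lemma puiseux_val_of:
  assumes "d > 0" shows "puiseux_val (puiseux_of d f) = real_of_int (fls_subdegree f) / real d"
proof -
  let ?x = "puiseux_of d f"
  have "int d * fls_subdegree (puiseux_series ?x) = int (puiseux_den ?x) * fls_subdegree f"
    using arg_cong[OF puiseux_series_compose[OF assms, of f], of fls_subdegree] assms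
    by (simp add: fls_subdegree_compose_power)
  then have "real d * real_of_int (fls_subdegree (puiseux_series ?x))
      = real (puiseux_den ?x) * real_of_int (fls_subdegree f)"
    by (metis of_int_mult of_int_of_nat_eq)
  then show ?thesis using assms by (simp add: puiseux_val_def field_simps)
qed

lemma puiseux_lead_of:
  assumes "d > 0" shows "puiseux_lead (puiseux_of d f) = fls_nth f (fls_subdegree f)"
proof -
  have lead: "fls_nth (fls_compose_power h e) (fls_subdegree (fls_compose_power h e))
      = fls_nth h (fls_subdegree h)" if "e > 0" for h :: "'a fls" and e
    using that by (simp add: fls_subdegree_compose_power fls_nth_compose_power)
  show ?thesis
    unfolding puiseux_lead_def using lead puiseux_series_compose[OF assms, of f] assms
    by (metis puiseux_den_pos)
qed

lemma puiseux_of_real_iff: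
  assumes "d > 0" shows "puiseux_of d f \<in> real_puiseux \<longleftrightarrow> (\<forall>k. fls_nth f k \<in> \<real>)"
proof -
  have real: "(\<forall>k. fls_nth (fls_compose_power h e) k \<in> \<real>) \<longleftrightarrow> (\<forall>k. fls_nth h k \<in> \<real>)"
    if "e > 0" for h :: "complex fls" and e
  proof
    assume *: "\<forall>k. fls_nth (fls_compose_power h e) k \<in> \<real>"
    show "\<forall>k. fls_nth h k \<in> \<real>"
    proof
      fix k
      show "fls_nth h k \<in> \<real>"
        using *[rule_format, of "int e * k"] that by (simp add: fls_nth_compose_power)
    qed
  qed (use that in \<open>simp add: fls_nth_compose_power\<close>)
  show ?thesis
    unfolding real_puiseux_def mem_Collect_eq
    using real puiseux_series_compose[OF assms, of f] assms by (metis puiseux_den_pos)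
qed


section \<open>Cluster algebras of geometric type\<close>

instantiation sum :: (linorder, linorder) linorder
begin

fun less_eq_sum :: "'a + 'b \<Rightarrow> 'a + 'b \<Rightarrow> bool" where
  "Inl x \<le> Inl y \<longleftrightarrow> x \<le> y"
| "Inl x \<le> Inr y \<longleftrightarrow> True"
| "Inr x \<le> Inl y \<longleftrightarrow> False"
| "Inr x \<le> Inr y \<longleftrightarrow> x \<le> y"

definition less_sum :: "'a + 'b \<Rightarrow> 'a + 'b \<Rightarrow> bool" where
  "x < y \<longleftrightarrow> x \<le> y \<and> \<not> y \<le> x" for x y :: "'a + 'b"

instance
proof
  fix x y z :: "'a + 'b"
  show "x < y \<longleftrightarrow> x \<le> y \<and> \<not> y \<le> x" by (fact less_sum_def)
  show "x \<le> x" by (cases x) auto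
  show "x \<le> y \<Longrightarrow> y \<le> z \<Longrightarrow> x \<le> z" by (cases x; cases y; cases z) auto
  show "x \<le> y \<Longrightarrow> y \<le> x \<Longrightarrow> x = y" by (cases x; cases y) auto
  show "x \<le> y \<or> y \<le> x" by (cases x; cases y) auto
qed

end

text \<open>The field of rational functions \<open>\<complex>(x\<^sub>v : v)\<close>. The library proves that polynomials form an integral
  domain only for linearly ordered variables; the order plays no other role.\<close>

type_synonym 'v rat_fun = "(('v \<Rightarrow>\<^sub>0 nat) \<Rightarrow>\<^sub>0 complex) fract"

definition rf_const :: "complex \<Rightarrow> 'v::linorder rat_fun" where
  "rf_const c = Fract (Poly_Mapping.single 0 c) 1"

definition rf_var :: "'v::linorder \<Rightarrow> 'v rat_fun" where
  "rf_var v = Fract (Poly_Mapping.single (Poly_Mapping.single v 1) 1) 1"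

type_synonym ('n, 'v) int_matrix = "int^'n^'v"

text \<open>An extended exchange matrix has its columns indexed by \<open>'n\<close> and its rows by \<open>'v\<close>. The
  injection \<open>\<iota>\<close> sends a column index to the corresponding row of the top block, so the mutable
  indices are \<open>range \<iota>\<close> and the frozen ones are those outside \<open>range \<iota>\<close> (possibly none).\<close>

definition principal_part :: "('n \<Rightarrow> 'v) \<Rightarrow> int^'n^'v \<Rightarrow> int^'n^'n" where
  "principal_part \<iota> Bt = (\<chi> i j. Bt $ \<iota> i $ j)"

definition full_rank :: "int^'n^'v \<Rightarrow> bool" where
  "full_rank Bt \<longleftrightarrow> rank (\<chi> i j. real_of_int (Bt $ i $ j)) = CARD('n)"

type_synonym ('n, 'v) seed = "('v \<Rightarrow> 'v rat_fun) \<times> ('n, 'v) int_matrix"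

definition mutate_matrix :: "('n \<Rightarrow> 'v) \<Rightarrow> 'n \<Rightarrow> int^'n^'v \<Rightarrow> int^'n^'v" where
  "mutate_matrix \<iota> k b = (\<chi> i j.
     if i = \<iota> k \<or> j = k then - b $ i $ j
     else b $ i $ j + sgn (b $ i $ k) * max 0 (b $ i $ k * b $ \<iota> k $ j))"

definition exchange :: "('n::finite \<Rightarrow> 'v) \<Rightarrow> 'n \<Rightarrow> ('n, 'v::{finite,linorder}) seed \<Rightarrow> 'v rat_fun" where
  "exchange \<iota> k s =
     ((\<Prod>i | snd s $ i $ k > 0. fst s i ^ nat (snd s $ i $ k))
      + (\<Prod>i | snd s $ i $ k < 0. fst s i ^ nat (- (snd s $ i $ k)))) / fst s (\<iota> k)"

definition mutate :: "('n::finite \<Rightarrow> 'v) \<Rightarrow> 'n \<Rightarrow> ('n, 'v::{finite,linorder}) seed \<Rightarrow> ('n, 'v) seed" where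
  "mutate \<iota> k s = ((fst s)(\<iota> k := exchange \<iota> k s), mutate_matrix \<iota> k (snd s))"

inductive_set seeds ::
  "('n::finite \<Rightarrow> 'v::{finite,linorder}) \<Rightarrow> ('n, 'v) int_matrix \<Rightarrow> ('n, 'v) seed set"
  for \<iota> :: "'n::finite \<Rightarrow> 'v::{finite,linorder}" and Bt :: "('n, 'v) int_matrix"
where
  initial: "(rf_var, Bt) \<in> seeds \<iota> Bt"
| mutation: "s \<in> seeds \<iota> Bt \<Longrightarrow> mutate \<iota> k s \<in> seeds \<iota> Bt"

definition cluster :: "('n::finite \<Rightarrow> 'v) \<Rightarrow> ('n, 'v::{finite,linorder}) seed \<Rightarrow> 'v rat_fun set" where
  "cluster \<iota> s = fst s ` range \<iota>"

definition cluster_vars :: "('n::finite \<Rightarrow> 'v::{finite,linorder}) \<Rightarrow> ('n, 'v) int_matrix \<Rightarrow> 'v rat_fun set" where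
  "cluster_vars \<iota> Bt = (\<Union>s\<in>seeds \<iota> Bt. cluster \<iota> s)"

definition frozen_vars :: "('n \<Rightarrow> 'v::{finite,linorder}) \<Rightarrow> 'v rat_fun set" where
  "frozen_vars \<iota> = rf_var ` (- range \<iota>)"

definition cluster_finite_type :: "('n::finite \<Rightarrow> 'v::{finite,linorder}) \<Rightarrow> ('n, 'v) int_matrix \<Rightarrow> bool" where
  "cluster_finite_type \<iota> Bt \<longleftrightarrow> finite (cluster_vars \<iota> Bt)"

inductive_set cluster_algebra ::
  "('n::finite \<Rightarrow> 'v::{finite,linorder}) \<Rightarrow> ('n, 'v) int_matrix \<Rightarrow> 'v rat_fun set"
  for \<iota> :: "'n::finite \<Rightarrow> 'v::{finite,linorder}" and Bt :: "('n, 'v) int_matrix"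
where
  const: "rf_const c \<in> cluster_algebra \<iota> Bt"
| cluster: "f \<in> cluster_vars \<iota> Bt \<Longrightarrow> f \<in> cluster_algebra \<iota> Bt"
| frozen: "f \<in> frozen_vars \<iota> \<Longrightarrow> f \<in> cluster_algebra \<iota> Bt"
| frozen_inverse: "f \<in> frozen_vars \<iota> \<Longrightarrow> inverse f \<in> cluster_algebra \<iota> Bt"
| add: "f \<in> cluster_algebra \<iota> Bt \<Longrightarrow> g \<in> cluster_algebra \<iota> Bt \<Longrightarrow> f + g \<in> cluster_algebra \<iota> Bt"
| mult: "f \<in> cluster_algebra \<iota> Bt \<Longrightarrow> g \<in> cluster_algebra \<iota> Bt \<Longrightarrow> f * g \<in> cluster_algebra \<iota> Bt"


section \<open>Exchange matrices of Dynkin type\<close>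

text \<open>Cartan matrices of connected finite type Dynkin diagrams: indecomposable, and
  symmetrizable with positive definite symmetrization.\<close>

definition connected_dynkin :: "int^'n^'n \<Rightarrow> bool" where
  "connected_dynkin A \<longleftrightarrow>
     (\<forall>i. A $ i $ i = 2) \<and>
     (\<forall>i j. i \<noteq> j \<longrightarrow> A $ i $ j \<le> 0) \<and>
     (\<exists>d :: 'n \<Rightarrow> int. (\<forall>i. d i > 0) \<and>
        (\<forall>i j. d i * A $ i $ j = d j * A $ j $ i) \<and>
        (\<forall>x :: real^'n. x \<noteq> 0 \<longrightarrow>
           (\<Sum>i\<in>UNIV. \<Sum>j\<in>UNIV. real_of_int (d i * A $ i $ j) * x $ i * x $ j) > 0)) \<and>
     (\<forall>i j. (\<lambda>k l. A $ k $ l \<noteq> 0)\<^sup>*\<^sup>* i j)"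

definition dynkin_orientation :: "int^'n^'n \<Rightarrow> ('n \<Rightarrow> 'n \<Rightarrow> bool) \<Rightarrow> bool" where
  "dynkin_orientation A arrow \<longleftrightarrow>
     (\<forall>i j. arrow i j \<or> arrow j i \<longleftrightarrow> i \<noteq> j \<and> A $ i $ j \<noteq> 0) \<and>
     (\<forall>i j. \<not> (arrow i j \<and> arrow j i))"

definition exchange_matrix :: "int^'n^'n \<Rightarrow> ('n \<Rightarrow> 'n \<Rightarrow> bool) \<Rightarrow> int^'n^'n" where
  "exchange_matrix A arrow =
     (\<chi> i j. if arrow i j then - A $ i $ j else if arrow j i then A $ i $ j else 0)"


section \<open>Positive tropicalization\<close>

text \<open>\<open>\<phi>\<close> restricts to a homomorphism of \<open>\<complex>\<close>-algebras from the cluster algebra to complex Puiseux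
  series, i.e. to a point of its spectrum over that field.\<close>

definition spec_point ::
  "('n::finite \<Rightarrow> 'v::{finite,linorder}) \<Rightarrow> ('n, 'v) int_matrix \<Rightarrow> ('v rat_fun \<Rightarrow> complex puiseux) \<Rightarrow> bool" where
  "spec_point \<iota> Bt \<phi> \<longleftrightarrow>
     (\<forall>c. \<phi> (rf_const c) = puiseux_const c) \<and>
     (\<forall>f\<in>cluster_algebra \<iota> Bt. \<forall>g\<in>cluster_algebra \<iota> Bt.
        \<phi> (f + g) = \<phi> f + \<phi> g \<and> \<phi> (f * g) = \<phi> f * \<phi> g)"

definition coordinates :: "('n::finite \<Rightarrow> 'v::{finite,linorder}) \<Rightarrow> ('n, 'v) int_matrix \<Rightarrow> 'v rat_fun set" where
  "coordinates \<iota> Bt = cluster_vars \<iota> Bt \<union> frozen_vars \<iota>"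

text \<open>The coordinate space of the ambient affine space consists of the real functions
  on the ambient field that vanish off \<open>coordinates \<iota> Bt\<close>. Function spaces carry the product
  topology.\<close>

definition Trop_pos ::
  "('n::finite \<Rightarrow> 'v::{finite,linorder}) \<Rightarrow> ('n, 'v) int_matrix \<Rightarrow> ('v rat_fun \<Rightarrow> real) set" where
  "Trop_pos \<iota> Bt = closure
     {(\<lambda>f. if f \<in> coordinates \<iota> Bt then puiseux_val (\<phi> f) else 0) | \<phi>.
        spec_point \<iota> Bt \<phi> \<and> (\<forall>f\<in>coordinates \<iota> Bt. \<phi> f \<in> pos_puiseux)}"

datatype 'v sf_expr =
    SF_Var 'v
  | SF_One
  | SF_Add "'v sf_expr" "'v sf_expr"
  | SF_Mult "'v sf_expr" "'v sf_expr"
  | SF_Div "'v sf_expr" "'v sf_expr"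

primrec sf_eval :: "'v::linorder sf_expr \<Rightarrow> 'v rat_fun" where
  "sf_eval (SF_Var v) = rf_var v"
| "sf_eval SF_One = 1"
| "sf_eval (SF_Add p q) = sf_eval p + sf_eval q"
| "sf_eval (SF_Mult p q) = sf_eval p * sf_eval q"
| "sf_eval (SF_Div p q) = sf_eval p / sf_eval q"

primrec sf_trop :: "'v sf_expr \<Rightarrow> real^'v \<Rightarrow> real" where
  "sf_trop (SF_Var v) w = w $ v"
| "sf_trop SF_One w = 0"
| "sf_trop (SF_Add p q) w = min (sf_trop p w) (sf_trop q w)"
| "sf_trop (SF_Mult p q) w = sf_trop p w + sf_trop q w"
| "sf_trop (SF_Div p q) w = sf_trop p w - sf_trop q w"

text \<open>The tropicalization does not depend on the chosen subtraction-free expression.\<close>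

definition tropicalization :: "'v::{finite,linorder} rat_fun \<Rightarrow> (real, 'v) vec \<Rightarrow> real" where
  "tropicalization f = (THE g. \<exists>e. sf_eval e = f \<and> sf_trop e = g)"

text \<open>A common domain of linearity: a convex cone on which every tropicalized cluster variable
  agrees with a linear functional (the tropicalized frozen variables are linear anyway).\<close>

definition linearity_cone ::
  "('n::finite \<Rightarrow> 'v::{finite,linorder}) \<Rightarrow> ('n, 'v) int_matrix \<Rightarrow> (real, 'v) vec set \<Rightarrow> bool" where
  "linearity_cone \<iota> Bt C \<longleftrightarrow> convex_cone C \<and>
     (\<forall>f\<in>cluster_vars \<iota> Bt. \<exists>l. linear l \<and> (\<forall>w\<in>C. tropicalization f w = l w))"

text \<open>The fan in the space of the initial extended cluster: all faces of the maximal linearity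
  cones. The library counts the empty set as a face, but it is not a cone of a fan.\<close>

definition linearity_fan ::
  "('n::finite \<Rightarrow> 'v::{finite,linorder}) \<Rightarrow> ('n, 'v) int_matrix \<Rightarrow> (real, 'v) vec set set" where
  "linearity_fan \<iota> Bt = {F. F \<noteq> {} \<and>
     (\<exists>C. linearity_cone \<iota> Bt C \<and> (\<forall>C'. linearity_cone \<iota> Bt C' \<and> C \<subseteq> C' \<longrightarrow> C' = C) \<and> F face_of C)}"

definition initial_projection :: "('v::{finite,linorder} rat_fun \<Rightarrow> real) \<Rightarrow> (real, 'v) vec" where
  "initial_projection w = (\<chi> v. w (rf_var v))"

text \<open>The cones of the positive tropicalization are the parts of it lying over the cones of
  the fan above.\<close>

definition Trop_pos_fan ::
  "('n::finite \<Rightarrow> 'v::{finite,linorder}) \<Rightarrow> ('n, 'v) int_matrix \<Rightarrow> ('v rat_fun \<Rightarrow> real) set set" where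
  "Trop_pos_fan \<iota> Bt =
     (\<lambda>C. {w \<in> Trop_pos \<iota> Bt. initial_projection w \<in> C}) ` linearity_fan \<iota> Bt"


section \<open>Fans\<close>

instantiation "fun" :: (type, real_vector) real_vector
begin

definition scaleR_fun :: "real \<Rightarrow> ('a \<Rightarrow> 'b) \<Rightarrow> 'a \<Rightarrow> 'b" where
  "scaleR_fun c f = (\<lambda>x. c *\<^sub>R f x)"

instance
proof
  fix a b :: real and x y :: "'a \<Rightarrow> 'b"
  show "a *\<^sub>R (x + y) = a *\<^sub>R x + a *\<^sub>R y" "(a + b) *\<^sub>R x = a *\<^sub>R x + b *\<^sub>R x"
    "a *\<^sub>R b *\<^sub>R x = (a * b) *\<^sub>R x" "1 *\<^sub>R x = x"
    by (auto simp only: scaleR_fun_def plus_fun_def scaleR_add_right scaleR_add_left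
        scaleR_scaleR scaleR_one)
qed

end

definition lineality_space :: "'a::real_vector set set \<Rightarrow> 'a set" where
  "lineality_space \<F> = (GREATEST L. subspace L \<and> (\<forall>C\<in>\<F>. L \<subseteq> C))"

text \<open>Points of the quotient space are the cosets \<open>w + L\<close>.\<close>

definition quotient_fan :: "'a::real_vector set set \<Rightarrow> 'a set \<Rightarrow> 'a set set set" where
  "quotient_fan \<F> L = (\<lambda>C. (\<lambda>w. (+) w ` L) ` C) ` \<F>"

text \<open>Inclusion is preserved in both directions: an isomorphism of face posets.\<close>

definition combinatorially_isomorphic :: "'a set set \<Rightarrow> 'b set set \<Rightarrow> bool" where
  "combinatorially_isomorphic \<F> \<G> \<longleftrightarrow>
     (\<exists>\<psi>. bij_betw \<psi> \<F> \<G> \<and> (\<forall>C\<in>\<F>. \<forall>D\<in>\<F>. C \<subseteq> D \<longleftrightarrow> \<psi> C \<subseteq> \<psi> D))"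


section \<open>The cluster fan\<close>

text \<open>Principal coefficients: \<open>Inl i\<close> indexes \<open>x\<^sub>i\<close> and \<open>Inr j\<close> indexes \<open>y\<^sub>j\<close>.\<close>

definition principal_ext :: "int^'n^'n \<Rightarrow> int^'n^('n + 'n)" where
  "principal_ext B =
     (\<chi> v j. case v of Inl i \<Rightarrow> B $ i $ j | Inr i \<Rightarrow> if i = j then 1 else 0)"

definition var_degree :: "int^'n^'n \<Rightarrow> 'n + 'n \<Rightarrow> int^'n" where
  "var_degree B v = (case v of Inl i \<Rightarrow> axis i 1 | Inr j \<Rightarrow> - (B *v axis j 1))"

definition homogeneous_poly ::
  "int^'n^'n \<Rightarrow> (('n + 'n \<Rightarrow>\<^sub>0 nat) \<Rightarrow>\<^sub>0 complex) \<Rightarrow> int^'n \<Rightarrow> bool" where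
  "homogeneous_poly B p d \<longleftrightarrow> (\<forall>a\<in>Poly_Mapping.keys p.
     (\<Sum>v\<in>UNIV. int (Poly_Mapping.lookup a v) *s var_degree B v) = d)"

text \<open>A rational function is homogeneous of degree \<open>d\<close> if it is a quotient of homogeneous
  polynomials whose degrees differ by \<open>d\<close>.\<close>

definition has_degree ::
  "('n::{finite,linorder}, 'n) int_matrix \<Rightarrow> ('n + 'n) rat_fun \<Rightarrow> (int, 'n) vec \<Rightarrow> bool" where
  "has_degree B f d \<longleftrightarrow> (\<exists>p q a b. q \<noteq> 0 \<and> f = Fract p q \<and>
     homogeneous_poly B p a \<and> homogeneous_poly B q b \<and> d = a - b)"

definition g_vector :: "('n::{finite,linorder}, 'n) int_matrix \<Rightarrow> ('n + 'n) rat_fun \<Rightarrow> (real, 'n) vec" where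
  "g_vector B f = (\<chi> i. real_of_int ((THE d. has_degree B f d) $ i))"

text \<open>The empty \<open>S\<close> gives the cone \<open>{0}\<close>.\<close>

definition cluster_fan :: "('n::{finite,linorder}, 'n) int_matrix \<Rightarrow> (real, 'n) vec set set" where
  "cluster_fan B = {convex_cone hull (g_vector B ` S) | S.
     \<exists>s\<in>seeds Inl (principal_ext B). S \<subseteq> cluster Inl s}"

end

theory Submission
  imports Defs
begin

text \<open>
  Tropical mutation of points of \<open>\<real>\<^sup>n\<^sup>+\<^sup>m\<close> preserves a skew form \<open>\<Phi>\<close> except when the mutated tropical y-variables of the two
  arguments have opposite signs, and then \<open>\<Phi>\<close> jumps in a definite direction. Following \<open>w\<close> by mutating only at
  positive y-variables therefore makes \<open>\<Phi>(u, w)\<close> grow; in finite type this terminates, and periodicity of the rank 2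
  subsystems together with Newman's lemma shows that the value at the end depends on \<open>u\<close> and \<open>w\<close> only. So \<open>\<Phi>(u, w)\<close> is maximal
  at a seed \<open>s\<close> at which all y-variables of \<open>w\<close> are nonpositive.

  This yields sign coherence: two points with nonpositive y-variables at one seed never have y-variables of opposite
  signs at another one. Hence the maximal domains of linearity are exactly the cones \<open>C\<^sub>s\<close> of points with nonpositive
  y-variables at \<open>s\<close>. It also yields the duality \<open>\<Phi>\<^sub>0(u, w) = \<Phi>\<^sub>s(u, w)\<close> for \<open>w\<close> in \<open>C\<^sub>s\<close> and \<open>u\<close> with nonnegative initial
  y-variables. On the cone of these \<open>u\<close> the tropical coordinates at \<open>s\<close> are linear in \<open>u\<close>, with the
  g-vectors of \<open>s\<close> as coefficients; comparing coefficients in the duality expands the linear map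
  \<open>w \<mapsto> - D\<^sup>-\<^sup>1 B\<^sup>T w\<close> (with \<open>B\<close> the extended exchange matrix and \<open>D\<close> its symmetrizer) in the g-vectors of \<open>s\<close>, with
  the coefficients \<open>- y\<^sub>k(w) / d\<^sub>k\<close>. So this map sends each face of \<open>C\<^sub>s\<close> onto a cone of g-vectors, and its kernel
  is the lineality space.
\<close>

section \<open>Tropical mutation\<close>

text \<open>Finite type enters as finiteness of the set of cluster variables: finitely many labelled
  clusters give finitely many tropical coordinate maps, which bounds the values of
  \<open>Phi\<close> and stops the mutations. No classification is consulted; even the six rank 2
  types come out of termination.

  Two obstacles shape the proof. A vanishing y-variable gives its mutation no direction, so a flow
  cannot be compared with one that starts across that wall. Hence independence of the starting seed
  is proved for generic \<open>w\<close>, and maximality is then extended by openness and density.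

  The g-vectors live in the principal coefficient algebra, whose ambient field differs from that of
  \<open>Bt\<close>. The bridge is full rank: there is a point with any prescribed initial
  y-variables, and for a unit vector its y-variables evolve exactly like a frozen row of the
  principal coefficient matrix. So the sign coherence of c-vectors is a case of the sign coherence
  of points, and degrees can be compared with tropical coordinates seed by seed.\<close>

text \<open>\<open>b\<close> is a skew-symmetrizable square matrix, \<open>p\<close> a point given by tropical x-coordinates, \<open>yv b p\<close> its tropical
  y-variables, \<open>a\<close> an extra column. The suffix \<open>m\<close> denotes one mutation (of the matrix, of \<open>p\<close>, of the column, of the
  y-variables in \<open>mm\<close>, \<open>xm\<close>, \<open>cm\<close>, \<open>ym\<close>), and the suffix \<open>w\<close> mutation along a word.\<close>

definition mm :: "'v \<Rightarrow> ('v \<Rightarrow> 'v \<Rightarrow> real) \<Rightarrow> 'v \<Rightarrow> 'v \<Rightarrow> real" where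
  "mm k b = (\<lambda>i j. if i = k \<or> j = k then - b i j else b i j + sgn (b i k) * max 0 (b i k * b k j))"

definition xm :: "'v::finite \<Rightarrow> ('v \<Rightarrow> 'v \<Rightarrow> real) \<Rightarrow> ('v \<Rightarrow> real) \<Rightarrow> 'v \<Rightarrow> real" where
  "xm k b p = p(k := - p k + min (\<Sum>i\<in>UNIV. max 0 (b i k) * p i) (\<Sum>i\<in>UNIV. max 0 (- b i k) * p i))"

definition yv :: "('v::finite \<Rightarrow> 'v \<Rightarrow> real) \<Rightarrow> ('v \<Rightarrow> real) \<Rightarrow> 'v \<Rightarrow> real" where
  "yv b p l = (\<Sum>i\<in>UNIV. b i l * p i)"

text \<open>The two linear pieces of \<open>xm\<close>, for \<open>e = 1\<close> and \<open>e = -1\<close>.\<close>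

definition xl :: "real \<Rightarrow> 'v::finite \<Rightarrow> ('v \<Rightarrow> 'v \<Rightarrow> real) \<Rightarrow> ('v \<Rightarrow> real) \<Rightarrow> 'v \<Rightarrow> real" where
  "xl e k b p = p(k := - p k + (\<Sum>i\<in>UNIV. max 0 (- (e * b i k)) * p i))"

definition skew :: "('v \<Rightarrow> real) \<Rightarrow> ('v \<Rightarrow> 'v \<Rightarrow> real) \<Rightarrow> bool" where
  "skew d b \<longleftrightarrow> (\<forall>i j. d i * b i j = - (d j * b j i))"

text \<open>\<open>Phi\<close> is preserved by both linear pieces of \<open>xm\<close>, hence it can change under mutation at \<open>k\<close> only if the
  \<open>k\<close>-th y-variables of the two points have opposite signs.\<close>

definition Phi :: "('v::finite \<Rightarrow> real) \<Rightarrow> ('v \<Rightarrow> 'v \<Rightarrow> real) \<Rightarrow> ('v \<Rightarrow> real) \<Rightarrow> ('v \<Rightarrow> real) \<Rightarrow> real" where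
  "Phi d b p q = (\<Sum>l\<in>UNIV. p l * yv b q l / d l)"

text \<open>The correction term of matrix mutation can be written with either sign \<open>e\<close>.
  Taking the same \<open>e\<close> as in the linear piece \<open>xl e\<close> makes the terms match
  in \<open>pair_cm_xl\<close>.\<close>

lemma pos_part_formula:
  fixes a c :: real
  assumes "e = 1 \<or> e = - 1"
  shows "sgn a * max 0 (a * c) = a * max 0 (e * c) + max 0 (- (e * a)) * c"
  using assms
  by (cases "a > 0"; cases "a = 0"; cases "c \<ge> 0")
     (auto simp: max_def mult_le_0_iff zero_le_mult_iff sgn_if)

lemma max_diff: "max 0 x - max 0 (- x) = (x::real)"
  by (simp add: max_def)

lemma yv_pos_parts:
  "yv b p k = (\<Sum>i\<in>UNIV. max 0 (b i k) * p i) - (\<Sum>i\<in>UNIV. max 0 (- b i k) * p i)"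
proof -
  have "yv b p k = (\<Sum>i\<in>UNIV. (max 0 (b i k) - max 0 (- b i k)) * p i)"
    unfolding yv_def by (simp only: max_diff)
  then show ?thesis by (simp add: left_diff_distrib sum_subtractf)
qed

lemma xm_eq_xl:
  assumes "e = 1 \<and> yv b p k \<ge> 0 \<or> e = - 1 \<and> yv b p k \<le> 0"
  shows "xm k b p = xl e k b p"
  using assms yv_pos_parts[of b p k] by (auto simp: xm_def xl_def min_def)

lemma xl_diff: "xl (- 1) k b p = (xl 1 k b p)(k := xl 1 k b p k + yv b p k)"
  using yv_pos_parts[of b p k] by (auto simp: xl_def)

lemma skew_diag:
  assumes "skew d b" "d k > 0" shows "b k k = 0"
  using assms unfolding skew_def by (smt (verit) mult_eq_0_iff)

lemma skew_sgn:
  assumes "skew d b" "\<And>i. d i > 0"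
  shows "b j i = - (d i / d j) * b i j"
  using assms(1)[unfolded skew_def, rule_format, of i j] assms(2)[of j] by (simp add: field_simps)

text \<open>With \<open>e = 1\<close> for both entries, the two summands of the correction at
  \<open>(i, j)\<close> become, up to sign and after scaling by \<open>d\<close>, the two summands
  at \<open>(j, i)\<close> in reverse order.\<close>

lemma skew_mm:
  assumes "skew d b" "\<And>i. d i > 0"
  shows "skew d (mm k b)"
  unfolding skew_def
proof (intro allI)
  fix i j
  have s: "d i * b i j = - (d j * b j i)" "d i * b i k = - (d k * b k i)" "d k * b k j = - (d j * b j k)"
    using assms(1) unfolding skew_def by blast+
  have pos: "d l * max 0 x = max 0 (d l * x)" for l x
    using assms(2)[of l] by (auto simp: max_def mult_le_0_iff zero_le_mult_iff)
  have "d i * (b i k * max 0 (b k j) + max 0 (- b i k) * b k j)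
      = (d i * b i k) * max 0 (b k j) + (d i * max 0 (- b i k)) * b k j"
    by (simp only: distrib_left mult.assoc)
  also have "d i * max 0 (- b i k) = max 0 (d k * b k i)"
    unfolding pos using s(2) by simp
  also have "(d i * b i k) * max 0 (b k j) = - (b k i * (d k * max 0 (b k j)))"
    unfolding s(2) by (simp only: mult_minus_left mult_minus_right mult_ac)
  also have "d k * max 0 (b k j) = d j * max 0 (- b j k)"
    unfolding pos s(3) by simp
  also have "max 0 (d k * b k i) * b k j = max 0 (b k i) * (d k * b k j)"
    unfolding pos[symmetric] by (simp only: mult_ac)
  also have "d k * b k j = - (d j * b j k)" by (fact s(3))
  also have "- (b k i * (d j * max 0 (- b j k))) + max 0 (b k i) * - (d j * b j k)
      = - (d j * (b j k * max 0 (b k i) + max 0 (- b j k) * b k i))"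
    by (simp only: distrib_left mult_minus_right minus_add_distrib mult_ac add.commute)
  finally have "d i * (sgn (b i k) * max 0 (b i k * b k j)) = - (d j * (sgn (b j k) * max 0 (b j k * b k i)))"
    using pos_part_formula[of 1 "b i k" "b k j"] pos_part_formula[of 1 "b j k" "b k i"] by simp
  then show "d i * mm k b i j = - (d j * mm k b j i)"
    using s by (simp add: mm_def distrib_left)
qed

lemma mm_mm:
  assumes "b k k = 0"
  shows "mm k (mm k b) = b"
  by (intro ext) (auto simp: mm_def sgn_minus)

lemma xm_mm:
  assumes "b k k = 0"
  shows "xm k (mm k b) (xm k b p) = p"
proof -
  have *: "(\<Sum>i\<in>UNIV. max 0 (mm k b i k) * (p(k := z)) i) = (\<Sum>i\<in>UNIV. max 0 (- b i k) * p i)"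
    "(\<Sum>i\<in>UNIV. max 0 (- mm k b i k) * (p(k := z)) i) = (\<Sum>i\<in>UNIV. max 0 (b i k) * p i)" for z
    using assms by (auto intro!: sum.cong simp: mm_def)
  show ?thesis
    unfolding xm_def * by (simp add: min.commute)
qed

lemma sum_upd:
  fixes f g :: "'v::finite \<Rightarrow> real"
  shows "(\<Sum>i\<in>UNIV. f i * (p(k := z)) i) = (\<Sum>i\<in>UNIV. f i * p i) + f k * (z - p k)"
proof -
  have "(\<Sum>i\<in>UNIV. f i * (p(k := z)) i) = (\<Sum>i\<in>UNIV. f i * p i + (if i = k then f k * (z - p k) else 0))"
    by (rule sum.cong) (auto simp: algebra_simps)
  then show ?thesis by (simp add: sum.distrib)
qed

lemma yv_upd: "yv b (p(k := z)) l = yv b p l + b k l * (z - p k)"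
  unfolding yv_def by (rule sum_upd)

text \<open>A column vector mutates like a column of the matrix that is never mutated.\<close>

definition cm :: "'v \<Rightarrow> ('v \<Rightarrow> 'v \<Rightarrow> real) \<Rightarrow> ('v \<Rightarrow> real) \<Rightarrow> 'v \<Rightarrow> real" where
  "cm k b a = (\<lambda>i. if i = k then - a k else a i + sgn (b i k) * max 0 (b i k * a k))"

definition pair :: "('v::finite \<Rightarrow> real) \<Rightarrow> ('v \<Rightarrow> real) \<Rightarrow> real" where
  "pair a p = (\<Sum>i\<in>UNIV. a i * p i)"

text \<open>A pairing behaves like the y-variable of one extra direction in which no mutation takes
  place. Columns of \<open>b\<close> in the place of \<open>a\<close> give the mutation of
  y-variables; a column that ends as a unit vector reads off a coordinate of the mutated
  point.\<close>

lemma pair_cm_xl: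
  assumes "b k k = 0" "e = 1 \<or> e = - 1"
  shows "pair (cm k b a) (xl e k b p) = pair a p + max 0 (e * a k) * yv b p k"
proof -
  define s where "s = (\<Sum>i\<in>UNIV. max 0 (- (e * b i k)) * p i)"
  have "pair (cm k b a) (xl e k b p) = pair (cm k b a) p - a k * (- p k + s - p k)"
    unfolding pair_def xl_def sum_upd s_def by (simp add: cm_def)
  also have "pair (cm k b a) p = (\<Sum>i\<in>UNIV. a i * p i + max 0 (e * a k) * (b i k * p i)
      + a k * (max 0 (- (e * b i k)) * p i) + (if i = k then - 2 * a k * p k else 0))"
    unfolding pair_def
  proof (intro sum.cong refl)
    fix i
    show "cm k b a i * p i = a i * p i + max 0 (e * a k) * (b i k * p i)
      + a k * (max 0 (- (e * b i k)) * p i) + (if i = k then - 2 * a k * p k else 0)"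
    proof (cases "i = k")
      case False
      then show ?thesis
        unfolding cm_def using pos_part_formula[OF assms(2), of "b i k" "a k"]
        by (simp add: distrib_right)
    qed (simp add: cm_def assms(1))
  qed
  also have "\<dots> = pair a p + max 0 (e * a k) * yv b p k + a k * s - 2 * a k * p k"
    by (simp add: sum.distrib pair_def yv_def s_def sum_distrib_left)
  finally show ?thesis by (simp add: algebra_simps)
qed

lemma yv_pair: "yv b p l = pair (\<lambda>i. b i l) p"
  by (simp add: yv_def pair_def)

lemma mm_cm: "l \<noteq> k \<Longrightarrow> (\<lambda>i. mm k b i l) = cm k b (\<lambda>i. b i l)"
  by (auto simp: mm_def cm_def)

lemma yv_mm_xl:
  assumes "b k k = 0" "e = 1 \<or> e = - 1"
  shows "yv (mm k b) (xl e k b p) l =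
    (if l = k then - yv b p k else yv b p l + max 0 (e * b k l) * yv b p k)"
proof (cases "l = k")
  case True
  have "yv (mm k b) (xl e k b p) k = yv (mm k b) p k"
    unfolding xl_def yv_upd using assms(1) by (simp add: mm_def)
  also have "\<dots> = - yv b p k" by (simp add: yv_def mm_def sum_negf)
  finally show ?thesis using True by simp
next
  case False
  then show ?thesis
    using pair_cm_xl[where b=b and k=k, OF assms] by (simp add: yv_pair mm_cm)
qed

lemma pair_cm_xm:
  assumes "b k k = 0"
  shows "pair (cm k b a) (xm k b p) = pair a p + max 0 (a k) * yv b p k - a k * min 0 (yv b p k)"
proof (cases "yv b p k \<ge> 0")
  case True
  then show ?thesis using xm_eq_xl[of 1 b p k] pair_cm_xl[where b=b and k=k and e=1, OF assms] by simp
next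
  case False
  have "max 0 (- a k) = max 0 (a k) - a k" by (simp add: max_def)
  then have "max 0 (- a k) * yv b p k = max 0 (a k) * yv b p k - a k * yv b p k"
    by (simp only: left_diff_distrib)
  then show ?thesis
    using False xm_eq_xl[of "-1" b p k] pair_cm_xl[where b=b and k=k and e="-1" and a=a and p=p, OF assms]
    by simp
qed

lemma yv_mm_xm:
  assumes "b k k = 0"
  shows "yv (mm k b) (xm k b p) l =
    (if l = k then - yv b p k else yv b p l + max 0 (b k l) * yv b p k - b k l * min 0 (yv b p k))"
proof (cases "l = k")
  case True
  then show ?thesis
    using yv_mm_xl[where b=b and k=k and e=1 and p=p and l=k, OF assms]
      yv_mm_xl[where b=b and k=k and e="-1" and p=p and l=k, OF assms]
      xm_eq_xl[of 1 b p k] xm_eq_xl[of "-1" b p k]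
    by (cases "yv b p k \<ge> 0") auto
next
  case False
  then show ?thesis using pair_cm_xm[where b=b and k=k, OF assms] by (simp add: yv_pair mm_cm)
qed

lemma Phi_upd_left: "Phi d b (p(k := z)) q = Phi d b p q + (z - p k) * yv b q k / d k"
proof -
  have "Phi d b (p(k := z)) q = (\<Sum>l\<in>UNIV. (yv b q l / d l) * (p(k := z)) l)"
    unfolding Phi_def by (rule sum.cong) auto
  then show ?thesis unfolding sum_upd by (simp add: Phi_def mult.commute)
qed

lemma Phi_skew:
  assumes "skew d b" "\<And>i. d i > 0"
  shows "Phi d b q p = - Phi d b p q"
proof -
  have "Phi d b q p = (\<Sum>l\<in>UNIV. \<Sum>i\<in>UNIV. q l * b i l * p i / d l)"
    by (simp add: Phi_def yv_def sum_distrib_left sum_divide_distrib mult.assoc)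
  also have "\<dots> = (\<Sum>i\<in>UNIV. \<Sum>l\<in>UNIV. q l * b i l * p i / d l)" by (rule sum.swap)
  also have "\<dots> = (\<Sum>i\<in>UNIV. \<Sum>l\<in>UNIV. - (p i * b l i * q l / d i))"
  proof (intro sum.cong refl)
    fix i l
    show "q l * b i l * p i / d l = - (p i * b l i * q l / d i)"
      using skew_sgn[OF assms, of l i] assms(2)[of i] assms(2)[of l] by simp
  qed
  also have "\<dots> = - Phi d b p q"
    by (simp add: Phi_def yv_def sum_distrib_left sum_divide_distrib mult.assoc sum_negf)
  finally show ?thesis .
qed

text \<open>The new \<open>k\<close>-th coordinate of \<open>p\<close> and the new y-variables of
  \<open>q\<close> change \<open>Phi\<close> by opposite amounts, since skew-symmetrizability turns
  \<open>max 0 (e * b k l) / d l\<close> into \<open>max 0 (- (e * b l k)) / d k\<close>.\<close>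

lemma Phi_xl:
  assumes "skew d b" "\<And>i. d i > 0" "e = 1 \<or> e = - 1"
  shows "Phi d (mm k b) (xl e k b p) (xl e k b q) = Phi d b p q"
proof -
  have b0: "b k k = 0" using skew_diag[OF assms(1)] assms(2) by simp
  define s where "s = (\<Sum>i\<in>UNIV. max 0 (- (e * b i k)) * p i)"
  let ?q = "xl e k b q"
  have y: "yv (mm k b) ?q k = - yv b q k" using yv_mm_xl[where b=b and k=k, OF b0 assms(3)] by simp
  have "Phi d (mm k b) (xl e k b p) ?q = Phi d (mm k b) p ?q - (- p k + s - p k) * yv b q k / d k"
    unfolding xl_def[of e k b p] Phi_upd_left y s_def by simp
  also have "Phi d (mm k b) p ?q = (\<Sum>l\<in>UNIV. p l * yv b q l / d l
     + max 0 (- (e * b l k)) * p l * yv b q k / d k + (if l = k then - 2 * p k * yv b q k / d k else 0))"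
    unfolding Phi_def
  proof (intro sum.cong refl)
    fix l
    show "p l * yv (mm k b) ?q l / d l = p l * yv b q l / d l
       + max 0 (- (e * b l k)) * p l * yv b q k / d k + (if l = k then - 2 * p k * yv b q k / d k else 0)"
    proof (cases "l = k")
      case True
      then show ?thesis using y b0 by simp
    next
      case False
      have "max 0 (e * b k l) = max 0 ((d l / d k) * (- (e * b l k)))"
        using skew_sgn[OF assms(1,2), of k l] by (simp add: mult.left_commute)
      also have "\<dots> = (d l / d k) * max 0 (- (e * b l k))"
        using assms(2)[of l] assms(2)[of k] by (subst max_mult_distrib_left) auto
      finally have "max 0 (e * b k l) / d l = max 0 (- (e * b l k)) / d k"
        using assms(2)[of l] by simp
      then have "p l * (max 0 (e * b k l) * yv b q k) / d l = max 0 (- (e * b l k)) * p l * yv b q k / d k"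
        by (metis (no_types, opaque_lifting) mult.commute mult.left_commute times_divide_eq_right)
      then show ?thesis
        using False yv_mm_xl[where b=b and k=k and p=q and l=l, OF b0 assms(3)] by (simp add: distrib_left add_divide_distrib)
    qed
  qed
  also have "\<dots> = Phi d b p q + s * yv b q k / d k - 2 * p k * yv b q k / d k"
    by (simp add: sum.distrib Phi_def s_def sum_distrib_right sum_divide_distrib)
  finally show ?thesis by (simp add: left_diff_distrib diff_divide_distrib)
qed

text \<open>For y-variables of the same weak sign \<open>Phi_xl\<close> applies to both points at
  once. For opposite signs the points are moved by different linear pieces; these differ in the
  coordinate \<open>k\<close> alone, by \<open>yv b p k\<close>, and linearity of \<open>Phi\<close>
  in its left argument yields the jump.\<close>

lemma Phi_xm:
  assumes "skew d b" "\<And>i. d i > 0"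
  shows "Phi d (mm k b) (xm k b p) (xm k b q) = Phi d b p q
    + (max 0 (yv b q k) * max 0 (- yv b p k) - max 0 (- yv b q k) * max 0 (yv b p k)) / d k"
proof -
  have b0: "b k k = 0" using skew_diag[OF assms(1)] assms(2) by simp
  have mixed: "Phi d (mm k b) (xm k b p) (xm k b q) = Phi d b p q - yv b p k * yv b q k / d k"
    if "yv b p k < 0" "yv b q k > 0" for p q
  proof -
    have "xm k b p = xl (- 1) k b p" using that xm_eq_xl[of "-1" b p k] by auto
    then have p: "xm k b p = (xl 1 k b p)(k := xl 1 k b p k + yv b p k)" using xl_diff by metis
    have q: "xm k b q = xl 1 k b q" using that xm_eq_xl[of "1" b q k] by auto
    show ?thesis
      unfolding p q Phi_upd_left using yv_mm_xl[where b=b and k=k and e=1 and p=q and l=k, OF b0] Phi_xl[OF assms, of 1] by simp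
  qed
  note sk = Phi_skew[OF skew_mm[OF assms, of k] assms(2)] Phi_skew[OF assms]
  consider "yv b p k \<ge> 0" "yv b q k \<ge> 0" | "yv b p k \<le> 0" "yv b q k \<le> 0"
    | "yv b p k < 0" "yv b q k > 0" | "yv b q k < 0" "yv b p k > 0" by linarith
  then show ?thesis
  proof cases
    case 1
    then show ?thesis using xm_eq_xl[of 1 b p k] xm_eq_xl[of 1 b q k] Phi_xl[OF assms, of 1] by simp
  next
    case 2
    then show ?thesis using xm_eq_xl[of "-1" b p k] xm_eq_xl[of "-1" b q k] Phi_xl[OF assms, of "-1"] by simp
  next
    case 3
    then show ?thesis using mixed[OF 3] by simp
  next
    case 4
    then show ?thesis
      using mixed[OF 4] sk(1)[of "xm k b p" "xm k b q"] sk(2)[of p q] by (simp add: mult.commute)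
  qed
qed

section \<open>Periodicity in rank 2\<close>

text \<open>The increment of a pairing in \<open>pair_cm_xm\<close>; it vanishes when
  \<open>a\<close> and \<open>y\<close> have opposite signs.\<close>

definition sign_mult :: "real \<Rightarrow> real \<Rightarrow> real" where
  "sign_mult a y = max 0 a * y - a * min 0 y"

lemma sign_mult:
  "0 \<le> a \<Longrightarrow> 0 \<le> y \<Longrightarrow> sign_mult a y = a * y"
  "a \<le> 0 \<Longrightarrow> y \<le> 0 \<Longrightarrow> sign_mult a y = - (a * y)"
  "a \<le> 0 \<Longrightarrow> 0 \<le> y \<Longrightarrow> sign_mult a y = 0"
  "0 \<le> a \<Longrightarrow> y \<le> 0 \<Longrightarrow> sign_mult a y = 0"
  by (auto simp: sign_mult_def max_def min_def)

text \<open>\<open>a\<close> and \<open>y\<close> run through the two mutation paths of a rank 2 exchange graph. Each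
  recursion is linear on the cones that its table lists, so the claim is a bilinear identity on each pair of cones.\<close>

lemma rank2_sum_11:
  fixes a1 a2 a3 a7 a8 y1 y2 y3 y7 y8 :: real
  assumes a: "a2 = a7 - max 0 (- a1)" "a3 = - a1 - max 0 (- a2)" "a8 = a1 + max 0 (a7)"
    and y: "y2 = y7 + max 0 (y1)" "y3 = - y1 + max 0 (y2)" "y8 = y1 - max 0 (- y7)"
  shows "sign_mult a1 y1 + sign_mult a2 y2 + sign_mult a3 y3 = sign_mult a7 y7 + sign_mult a8 y8"
proof -
  have "a1 \<le> 0 \<and> a2 \<le> 0 \<and> a3 \<le> 0 \<and> a7 \<le> 0 \<and> a8 \<le> 0
        \<and> a2 - a1 - a7 = 0 \<and> a3 - a7 = 0 \<and> a8 - a1 = 0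
    \<or> a1 \<le> 0 \<and> a2 \<le> 0 \<and> a3 \<ge> 0 \<and> a7 \<ge> 0 \<and> a8 \<le> 0
        \<and> a2 - a1 - a7 = 0 \<and> a3 - a7 = 0 \<and> a8 - a1 - a7 = 0
    \<or> a1 \<le> 0 \<and> a2 \<ge> 0 \<and> a3 \<ge> 0 \<and> a7 \<ge> 0 \<and> a8 \<ge> 0
        \<and> a2 - a1 - a7 = 0 \<and> a3 + a1 = 0 \<and> a8 - a1 - a7 = 0
    \<or> a1 \<ge> 0 \<and> a2 \<le> 0 \<and> a3 \<le> 0 \<and> a7 \<le> 0 \<and> a8 \<ge> 0
        \<and> a2 - a7 = 0 \<and> a3 + a1 - a7 = 0 \<and> a8 - a1 = 0
    \<or> a1 \<ge> 0 \<and> a2 \<ge> 0 \<and> a3 \<le> 0 \<and> a7 \<ge> 0 \<and> a8 \<ge> 0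
        \<and> a2 - a7 = 0 \<and> a3 + a1 = 0 \<and> a8 - a1 - a7 = 0"
    using a by (smt (verit))
  moreover have "y1 \<le> 0 \<and> y2 \<le> 0 \<and> y3 \<ge> 0 \<and> y7 \<le> 0 \<and> y8 \<le> 0
        \<and> y2 - y7 = 0 \<and> y3 + y1 = 0 \<and> y8 - y1 - y7 = 0
    \<or> y1 \<le> 0 \<and> y2 \<ge> 0 \<and> y3 \<ge> 0 \<and> y7 \<ge> 0 \<and> y8 \<le> 0
        \<and> y2 - y7 = 0 \<and> y3 + y1 - y7 = 0 \<and> y8 - y1 = 0
    \<or> y1 \<ge> 0 \<and> y2 \<le> 0 \<and> y3 \<le> 0 \<and> y7 \<le> 0 \<and> y8 \<le> 0
        \<and> y2 - y1 - y7 = 0 \<and> y3 + y1 = 0 \<and> y8 - y1 - y7 = 0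
    \<or> y1 \<ge> 0 \<and> y2 \<ge> 0 \<and> y3 \<le> 0 \<and> y7 \<le> 0 \<and> y8 \<ge> 0
        \<and> y2 - y1 - y7 = 0 \<and> y3 - y7 = 0 \<and> y8 - y1 - y7 = 0
    \<or> y1 \<ge> 0 \<and> y2 \<ge> 0 \<and> y3 \<ge> 0 \<and> y7 \<ge> 0 \<and> y8 \<ge> 0
        \<and> y2 - y1 - y7 = 0 \<and> y3 - y7 = 0 \<and> y8 - y1 = 0"
    using y by (smt (verit))
  ultimately show ?thesis
    apply (elim disjE; elim conjE; simp only: sign_mult add_0_left)
    apply ((thin_tac "_ \<le> _")+, algebra)+
    done
qed

text \<open>The indices 1, 2, ... follow the path that starts in direction \<open>j\<close>, the
  indices 7 and 8 the path that starts in direction \<open>k\<close>. The lengths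
  \<open>3 + 2\<close>, \<open>4 + 2\<close> and \<open>6 + 2\<close> split the pentagon, hexagon
  and octagon of types A2, B2 and G2.\<close>

lemma rank2_sum_12:
  fixes a1 a2 a3 a4 a7 a8 y1 y2 y3 y4 y7 y8 :: real
  assumes a: "a2 = a7 - 2 * max 0 (- a1)" "a3 = - a1 - max 0 (- a2)" "a4 = - a2 - 2 * max 0 (- a3)" "a8 = a1 + max 0 (a7)"
    and y: "y2 = y7 + max 0 (y1)" "y3 = - y1 + 2 * max 0 (y2)" "y4 = - y2 + max 0 (y3)" "y8 = y1 - 2 * max 0 (- y7)"
  shows "sign_mult a1 y1 + sign_mult a2 y2 + sign_mult a3 y3 + sign_mult a4 y4 = sign_mult a7 y7 + sign_mult a8 y8"
proof -
  have "a1 \<le> 0 \<and> a2 \<le> 0 \<and> a3 \<le> 0 \<and> a4 \<le> 0 \<and> a7 \<le> 0 \<and> a8 \<le> 0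
        \<and> a2 - 2 * a1 - a7 = 0 \<and> a3 - a1 - a7 = 0 \<and> a4 - a7 = 0 \<and> a8 - a1 = 0
    \<or> a1 \<le> 0 \<and> a2 \<le> 0 \<and> a3 \<le> 0 \<and> a4 \<ge> 0 \<and> a7 \<ge> 0 \<and> a8 \<le> 0
        \<and> a2 - 2 * a1 - a7 = 0 \<and> a3 - a1 - a7 = 0 \<and> a4 - a7 = 0 \<and> a8 - a1 - a7 = 0
    \<or> a1 \<le> 0 \<and> a2 \<le> 0 \<and> a3 \<ge> 0 \<and> a4 \<ge> 0 \<and> a7 \<ge> 0 \<and> a8 \<ge> 0
        \<and> a2 - 2 * a1 - a7 = 0 \<and> a3 - a1 - a7 = 0 \<and> a4 + 2 * a1 + a7 = 0 \<and> a8 - a1 - a7 = 0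
    \<or> a1 \<le> 0 \<and> a2 \<ge> 0 \<and> a3 \<ge> 0 \<and> a4 \<le> 0 \<and> a7 \<ge> 0 \<and> a8 \<ge> 0
        \<and> a2 - 2 * a1 - a7 = 0 \<and> a3 + a1 = 0 \<and> a4 + 2 * a1 + a7 = 0 \<and> a8 - a1 - a7 = 0
    \<or> a1 \<ge> 0 \<and> a2 \<le> 0 \<and> a3 \<le> 0 \<and> a4 \<le> 0 \<and> a7 \<le> 0 \<and> a8 \<ge> 0
        \<and> a2 - a7 = 0 \<and> a3 + a1 - a7 = 0 \<and> a4 + 2 * a1 - a7 = 0 \<and> a8 - a1 = 0
    \<or> a1 \<ge> 0 \<and> a2 \<ge> 0 \<and> a3 \<le> 0 \<and> a4 \<le> 0 \<and> a7 \<ge> 0 \<and> a8 \<ge> 0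
        \<and> a2 - a7 = 0 \<and> a3 + a1 = 0 \<and> a4 + 2 * a1 + a7 = 0 \<and> a8 - a1 - a7 = 0"
    using a by (smt (verit))
  moreover have "y1 \<le> 0 \<and> y2 \<le> 0 \<and> y3 \<ge> 0 \<and> y4 \<ge> 0 \<and> y7 \<le> 0 \<and> y8 \<le> 0
        \<and> y2 - y7 = 0 \<and> y3 + y1 = 0 \<and> y4 + y1 + y7 = 0 \<and> y8 - y1 - 2 * y7 = 0
    \<or> y1 \<le> 0 \<and> y2 \<ge> 0 \<and> y3 \<ge> 0 \<and> y4 \<ge> 0 \<and> y7 \<ge> 0 \<and> y8 \<le> 0
        \<and> y2 - y7 = 0 \<and> y3 + y1 - 2 * y7 = 0 \<and> y4 + y1 - y7 = 0 \<and> y8 - y1 = 0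
    \<or> y1 \<ge> 0 \<and> y2 \<le> 0 \<and> y3 \<le> 0 \<and> y4 \<ge> 0 \<and> y7 \<le> 0 \<and> y8 \<le> 0
        \<and> y2 - y1 - y7 = 0 \<and> y3 + y1 = 0 \<and> y4 + y1 + y7 = 0 \<and> y8 - y1 - 2 * y7 = 0
    \<or> y1 \<ge> 0 \<and> y2 \<ge> 0 \<and> y3 \<le> 0 \<and> y4 \<le> 0 \<and> y7 \<le> 0 \<and> y8 \<le> 0
        \<and> y2 - y1 - y7 = 0 \<and> y3 - y1 - 2 * y7 = 0 \<and> y4 + y1 + y7 = 0 \<and> y8 - y1 - 2 * y7 = 0
    \<or> y1 \<ge> 0 \<and> y2 \<ge> 0 \<and> y3 \<ge> 0 \<and> y4 \<le> 0 \<and> y7 \<le> 0 \<and> y8 \<ge> 0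
        \<and> y2 - y1 - y7 = 0 \<and> y3 - y1 - 2 * y7 = 0 \<and> y4 - y7 = 0 \<and> y8 - y1 - 2 * y7 = 0
    \<or> y1 \<ge> 0 \<and> y2 \<ge> 0 \<and> y3 \<ge> 0 \<and> y4 \<ge> 0 \<and> y7 \<ge> 0 \<and> y8 \<ge> 0
        \<and> y2 - y1 - y7 = 0 \<and> y3 - y1 - 2 * y7 = 0 \<and> y4 - y7 = 0 \<and> y8 - y1 = 0"
    using y by (smt (verit))
  ultimately show ?thesis
    apply (elim disjE; elim conjE; simp only: sign_mult add_0_left)
    \<comment> \<open>The signs have selected the values of \<open>sign_mult\<close>; the bilinear
      identity that remains follows from the linear equations by ideal membership.\<close>
    apply ((thin_tac "_ \<le> _")+, algebra)+
    done
qed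

lemma rank2_sum_13:
  fixes a1 a2 a3 a4 a5 a6 a7 a8 y1 y2 y3 y4 y5 y6 y7 y8 :: real
  assumes a: "a2 = a7 - 3 * max 0 (- a1)" "a3 = - a1 - max 0 (- a2)" "a4 = - a2 - 3 * max 0 (- a3)" "a5 = - a3 - max 0 (- a4)" "a6 = - a4 - 3 * max 0 (- a5)" "a8 = a1 + max 0 (a7)"
    and y: "y2 = y7 + max 0 (y1)" "y3 = - y1 + 3 * max 0 (y2)" "y4 = - y2 + max 0 (y3)" "y5 = - y3 + 3 * max 0 (y4)" "y6 = - y4 + max 0 (y5)" "y8 = y1 - 3 * max 0 (- y7)"
  shows "sign_mult a1 y1 + sign_mult a2 y2 + sign_mult a3 y3 + sign_mult a4 y4 + sign_mult a5 y5 + sign_mult a6 y6 = sign_mult a7 y7 + sign_mult a8 y8"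
proof -
  have "a1 \<le> 0 \<and> a2 \<le> 0 \<and> a3 \<le> 0 \<and> a4 \<le> 0 \<and> a5 \<le> 0 \<and> a6 \<le> 0 \<and> a7 \<le> 0 \<and> a8 \<le> 0
        \<and> a2 - 3 * a1 - a7 = 0 \<and> a3 - 2 * a1 - a7 = 0 \<and> a4 - 3 * a1 - 2 * a7 = 0 \<and> a5 - a1 - a7 = 0 \<and> a6 - a7 = 0 \<and> a8 - a1 = 0
    \<or> a1 \<le> 0 \<and> a2 \<le> 0 \<and> a3 \<le> 0 \<and> a4 \<le> 0 \<and> a5 \<le> 0 \<and> a6 \<ge> 0 \<and> a7 \<ge> 0 \<and> a8 \<le> 0
        \<and> a2 - 3 * a1 - a7 = 0 \<and> a3 - 2 * a1 - a7 = 0 \<and> a4 - 3 * a1 - 2 * a7 = 0 \<and> a5 - a1 - a7 = 0 \<and> a6 - a7 = 0 \<and> a8 - a1 - a7 = 0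
    \<or> a1 \<le> 0 \<and> a2 \<le> 0 \<and> a3 \<le> 0 \<and> a4 \<le> 0 \<and> a5 \<ge> 0 \<and> a6 \<ge> 0 \<and> a7 \<ge> 0 \<and> a8 \<ge> 0
        \<and> a2 - 3 * a1 - a7 = 0 \<and> a3 - 2 * a1 - a7 = 0 \<and> a4 - 3 * a1 - 2 * a7 = 0 \<and> a5 - a1 - a7 = 0 \<and> a6 + 3 * a1 + 2 * a7 = 0 \<and> a8 - a1 - a7 = 0
    \<or> a1 \<le> 0 \<and> a2 \<le> 0 \<and> a3 \<le> 0 \<and> a4 \<ge> 0 \<and> a5 \<ge> 0 \<and> a6 \<le> 0 \<and> a7 \<ge> 0 \<and> a8 \<ge> 0
        \<and> a2 - 3 * a1 - a7 = 0 \<and> a3 - 2 * a1 - a7 = 0 \<and> a4 - 3 * a1 - 2 * a7 = 0 \<and> a5 + 2 * a1 + a7 = 0 \<and> a6 + 3 * a1 + 2 * a7 = 0 \<and> a8 - a1 - a7 = 0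
    \<or> a1 \<le> 0 \<and> a2 \<le> 0 \<and> a3 \<ge> 0 \<and> a4 \<ge> 0 \<and> a5 \<le> 0 \<and> a6 \<le> 0 \<and> a7 \<ge> 0 \<and> a8 \<ge> 0
        \<and> a2 - 3 * a1 - a7 = 0 \<and> a3 - 2 * a1 - a7 = 0 \<and> a4 + 3 * a1 + a7 = 0 \<and> a5 + 2 * a1 + a7 = 0 \<and> a6 + 3 * a1 + 2 * a7 = 0 \<and> a8 - a1 - a7 = 0
    \<or> a1 \<le> 0 \<and> a2 \<ge> 0 \<and> a3 \<ge> 0 \<and> a4 \<le> 0 \<and> a5 \<le> 0 \<and> a6 \<le> 0 \<and> a7 \<ge> 0 \<and> a8 \<ge> 0
        \<and> a2 - 3 * a1 - a7 = 0 \<and> a3 + a1 = 0 \<and> a4 + 3 * a1 + a7 = 0 \<and> a5 + 2 * a1 + a7 = 0 \<and> a6 + 3 * a1 + 2 * a7 = 0 \<and> a8 - a1 - a7 = 0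
    \<or> a1 \<ge> 0 \<and> a2 \<le> 0 \<and> a3 \<le> 0 \<and> a4 \<le> 0 \<and> a5 \<le> 0 \<and> a6 \<le> 0 \<and> a7 \<le> 0 \<and> a8 \<ge> 0
        \<and> a2 - a7 = 0 \<and> a3 + a1 - a7 = 0 \<and> a4 + 3 * a1 - 2 * a7 = 0 \<and> a5 + 2 * a1 - a7 = 0 \<and> a6 + 3 * a1 - a7 = 0 \<and> a8 - a1 = 0
    \<or> a1 \<ge> 0 \<and> a2 \<ge> 0 \<and> a3 \<le> 0 \<and> a4 \<le> 0 \<and> a5 \<le> 0 \<and> a6 \<le> 0 \<and> a7 \<ge> 0 \<and> a8 \<ge> 0
        \<and> a2 - a7 = 0 \<and> a3 + a1 = 0 \<and> a4 + 3 * a1 + a7 = 0 \<and> a5 + 2 * a1 + a7 = 0 \<and> a6 + 3 * a1 + 2 * a7 = 0 \<and> a8 - a1 - a7 = 0"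
    using a by (smt (verit))
  moreover have "y1 \<le> 0 \<and> y2 \<le> 0 \<and> y3 \<ge> 0 \<and> y4 \<ge> 0 \<and> y5 \<ge> 0 \<and> y6 \<ge> 0 \<and> y7 \<le> 0 \<and> y8 \<le> 0
        \<and> y2 - y7 = 0 \<and> y3 + y1 = 0 \<and> y4 + y1 + y7 = 0 \<and> y5 + 2 * y1 + 3 * y7 = 0 \<and> y6 + y1 + 2 * y7 = 0 \<and> y8 - y1 - 3 * y7 = 0
    \<or> y1 \<le> 0 \<and> y2 \<ge> 0 \<and> y3 \<ge> 0 \<and> y4 \<ge> 0 \<and> y5 \<ge> 0 \<and> y6 \<ge> 0 \<and> y7 \<ge> 0 \<and> y8 \<le> 0
        \<and> y2 - y7 = 0 \<and> y3 + y1 - 3 * y7 = 0 \<and> y4 + y1 - 2 * y7 = 0 \<and> y5 + 2 * y1 - 3 * y7 = 0 \<and> y6 + y1 - y7 = 0 \<and> y8 - y1 = 0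
    \<or> y1 \<ge> 0 \<and> y2 \<le> 0 \<and> y3 \<le> 0 \<and> y4 \<ge> 0 \<and> y5 \<ge> 0 \<and> y6 \<ge> 0 \<and> y7 \<le> 0 \<and> y8 \<le> 0
        \<and> y2 - y1 - y7 = 0 \<and> y3 + y1 = 0 \<and> y4 + y1 + y7 = 0 \<and> y5 + 2 * y1 + 3 * y7 = 0 \<and> y6 + y1 + 2 * y7 = 0 \<and> y8 - y1 - 3 * y7 = 0
    \<or> y1 \<ge> 0 \<and> y2 \<ge> 0 \<and> y3 \<le> 0 \<and> y4 \<le> 0 \<and> y5 \<ge> 0 \<and> y6 \<ge> 0 \<and> y7 \<le> 0 \<and> y8 \<le> 0
        \<and> y2 - y1 - y7 = 0 \<and> y3 - 2 * y1 - 3 * y7 = 0 \<and> y4 + y1 + y7 = 0 \<and> y5 + 2 * y1 + 3 * y7 = 0 \<and> y6 + y1 + 2 * y7 = 0 \<and> y8 - y1 - 3 * y7 = 0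
    \<or> y1 \<ge> 0 \<and> y2 \<ge> 0 \<and> y3 \<ge> 0 \<and> y4 \<le> 0 \<and> y5 \<le> 0 \<and> y6 \<ge> 0 \<and> y7 \<le> 0 \<and> y8 \<le> 0
        \<and> y2 - y1 - y7 = 0 \<and> y3 - 2 * y1 - 3 * y7 = 0 \<and> y4 - y1 - 2 * y7 = 0 \<and> y5 + 2 * y1 + 3 * y7 = 0 \<and> y6 + y1 + 2 * y7 = 0 \<and> y8 - y1 - 3 * y7 = 0
    \<or> y1 \<ge> 0 \<and> y2 \<ge> 0 \<and> y3 \<ge> 0 \<and> y4 \<ge> 0 \<and> y5 \<le> 0 \<and> y6 \<le> 0 \<and> y7 \<le> 0 \<and> y8 \<le> 0
        \<and> y2 - y1 - y7 = 0 \<and> y3 - 2 * y1 - 3 * y7 = 0 \<and> y4 - y1 - 2 * y7 = 0 \<and> y5 - y1 - 3 * y7 = 0 \<and> y6 + y1 + 2 * y7 = 0 \<and> y8 - y1 - 3 * y7 = 0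
    \<or> y1 \<ge> 0 \<and> y2 \<ge> 0 \<and> y3 \<ge> 0 \<and> y4 \<ge> 0 \<and> y5 \<ge> 0 \<and> y6 \<le> 0 \<and> y7 \<le> 0 \<and> y8 \<ge> 0
        \<and> y2 - y1 - y7 = 0 \<and> y3 - 2 * y1 - 3 * y7 = 0 \<and> y4 - y1 - 2 * y7 = 0 \<and> y5 - y1 - 3 * y7 = 0 \<and> y6 - y7 = 0 \<and> y8 - y1 - 3 * y7 = 0
    \<or> y1 \<ge> 0 \<and> y2 \<ge> 0 \<and> y3 \<ge> 0 \<and> y4 \<ge> 0 \<and> y5 \<ge> 0 \<and> y6 \<ge> 0 \<and> y7 \<ge> 0 \<and> y8 \<ge> 0
        \<and> y2 - y1 - y7 = 0 \<and> y3 - 2 * y1 - 3 * y7 = 0 \<and> y4 - y1 - 2 * y7 = 0 \<and> y5 - y1 - 3 * y7 = 0 \<and> y6 - y7 = 0 \<and> y8 - y1 = 0"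
    using y by (smt (verit))
  ultimately show ?thesis
    apply (elim disjE; elim conjE; simp only: sign_mult add_0_left)
    apply ((thin_tac "_ \<le> _")+, algebra)+
    done
qed

text \<open>The rank 2 dynamics in the directions \<open>j\<close> and \<open>k\<close> closes up on the scalars
  \<open>(b\<^sub>j\<^sub>k, b\<^sub>k\<^sub>j, a\<^sub>j, a\<^sub>k, Y\<^sub>j, Y\<^sub>k, w)\<close>, where \<open>w\<close> is an entry outside the rows and columns \<open>j\<close>, \<open>k\<close> or a pairing.\<close>

type_synonym sc = "real \<times> real \<times> real \<times> real \<times> real \<times> real \<times> real"

fun sc_swap :: "sc \<Rightarrow> sc" where
  "sc_swap (B, C, \<alpha>, \<gamma>, u, v, w) = (C, B, \<gamma>, \<alpha>, v, u, w)"

fun sc_j :: "sc \<Rightarrow> sc" where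
  "sc_j (B, C, \<alpha>, \<gamma>, u, v, w) = (- B, - C, - \<alpha>, \<gamma> + sgn C * max 0 (C * \<alpha>), - u,
     v + max 0 B * u - B * min 0 u, w + max 0 \<alpha> * u - \<alpha> * min 0 u)"

definition sc_k :: "sc \<Rightarrow> sc" where
  "sc_k s = sc_swap (sc_j (sc_swap s))"

lemma sgn_pos_part:
  fixes b x :: real
  assumes "b \<ge> 0"
  shows "sgn b * max 0 (b * x) = b * max 0 x" "sgn (- b) * max 0 (- b * x) = - (b * max 0 (- x))"
  using assms by (auto simp: sgn_if max_def mult_le_0_iff zero_le_mult_iff)

lemma sc_j_pos:
  assumes "b \<ge> 0" "c \<ge> 0"
  shows "sc_j (b, - c, \<alpha>, \<gamma>, u, v, w)
    = (- b, c, - \<alpha>, \<gamma> - c * max 0 (- \<alpha>), - u, v + b * max 0 u, w + sign_mult \<alpha> u)"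
proof -
  have "max 0 b * u - b * min 0 u = b * max 0 u" using assms by (simp add: max_def min_def)
  then show ?thesis
    using sgn_pos_part(2)[OF assms(2), of \<alpha>] by (simp add: sign_mult_def)
qed

lemma sc_j_neg:
  assumes "b \<ge> 0" "c \<ge> 0"
  shows "sc_j (- b, c, \<alpha>, \<gamma>, u, v, w)
    = (b, - c, - \<alpha>, \<gamma> + c * max 0 \<alpha>, - u, v - b * max 0 (- u), w + sign_mult \<alpha> u)"
proof -
  have "max 0 (- b) * u - (- b) * min 0 u = - (b * max 0 (- u))"
    using assms by (simp add: max_def min_def)
  then show ?thesis
    using sgn_pos_part(1)[OF assms(2), of \<alpha>] by (simp add: sign_mult_def)
qed

lemma sc_k_pos:
  assumes "b \<ge> 0" "c \<ge> 0"
  shows "sc_k (- b, c, \<alpha>, \<gamma>, u, v, w)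
    = (b, - c, \<alpha> - b * max 0 (- \<gamma>), - \<gamma>, u + c * max 0 v, - v, w + sign_mult \<gamma> v)"
  using sc_j_pos[OF assms(2,1)] by (simp add: sc_k_def del: sc_j.simps)

lemma sc_k_neg:
  assumes "b \<ge> 0" "c \<ge> 0"
  shows "sc_k (b, - c, \<alpha>, \<gamma>, u, v, w)
    = (- b, c, \<alpha> + b * max 0 \<gamma>, - \<gamma>, u - c * max 0 (- v), - v, w + sign_mult \<gamma> v)"
  using sc_j_neg[OF assms(2,1)] by (simp add: sc_k_def del: sc_j.simps)

text \<open>Replacing \<open>(b\<^sub>j\<^sub>k, b\<^sub>k\<^sub>j)\<close> by \<open>(r b\<^sub>j\<^sub>k, b\<^sub>k\<^sub>j / r)\<close> only rescales, which reduces the types \<open>(2, - 1)\<close> and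
  \<open>(3, - 1)\<close> to \<open>(1, - 2)\<close> and \<open>(1, - 3)\<close>.\<close>

fun sc_scale :: "real \<Rightarrow> sc \<Rightarrow> sc" where
  "sc_scale r (B, C, \<alpha>, \<gamma>, u, v, w) = (r * B, C / r, \<alpha>, \<gamma> / r, u, r * v, w)"

lemma sc_j_scale:
  assumes "r > 0"
  shows "sc_j (sc_scale r s) = sc_scale r (sc_j s)"
proof (cases s)
  case (fields B C \<alpha> \<gamma> u v w)
  have m: "max 0 (r * B) = r * max 0 B" "max 0 (C * \<alpha> / r) = max 0 (C * \<alpha>) / r"
    using assms by (auto simp: max_def mult_le_0_iff zero_le_mult_iff divide_le_0_iff zero_le_divide_iff)
  have "sgn (C / r) = sgn C" using assms by (simp add: sgn_divide)
  then show ?thesis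
    using m assms by (simp add: fields) (simp add: field_simps)
qed

lemma sc_k_scale:
  assumes "r > 0"
  shows "sc_k (sc_scale r s) = sc_scale r (sc_k s)"
proof (cases s)
  case (fields B C \<alpha> \<gamma> u v w)
  have m: "max 0 (x / r) = max 0 x / r" "min 0 (r * x) = r * min 0 x" for x
    using assms by (auto simp: max_def min_def divide_le_0_iff zero_le_divide_iff mult_le_0_iff zero_le_mult_iff)
  have "sgn (r * B) = sgn B" using assms by (simp add: sgn_if zero_less_mult_iff)
  then show ?thesis
    using m assms by (simp add: fields sc_k_def)
qed

declare sc_j.simps [simp del]

text \<open>Going round the pentagon of type A2 exchanges the labels of the two vertices, which is
  why \<open>sc_swap\<close> appears here and not for the other types.\<close>

lemma rank2_11:
  "sc_j (sc_k (sc_j (1, - 1, \<alpha>, \<gamma>, u, v, w)))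
   = sc_swap (sc_j (sc_k (1, - 1, \<alpha>, \<gamma>, u, v, w)))"
proof -
  define a1 where "a1 = \<alpha>"
  define y1 where "y1 = u"
  define a7 where "a7 = \<gamma>"
  define y7 where "y7 = v"
  define a2 where "a2 = a7 - max 0 (- a1)"
  define y2 where "y2 = y7 + max 0 (y1)"
  define a3 where "a3 = - a1 - max 0 (- a2)"
  define y3 where "y3 = - y1 + max 0 (y2)"
  define a4 where "a4 = - a2 - max 0 (- a3)"
  define y4 where "y4 = - y2 + max 0 (y3)"
  define a8 where "a8 = a1 + max 0 (a7)"
  define y8 where "y8 = y1 - max 0 (- y7)"
  define w1 where "w1 = w + sign_mult a1 y1"
  define w2 where "w2 = w1 + sign_mult a2 y2"
  define w3 where "w3 = w2 + sign_mult a3 y3"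
  note ws = w1_def w2_def w3_def
  note a = a1_def a7_def a2_def a3_def a4_def a8_def
  note y = y1_def y7_def y2_def y3_def y4_def y8_def
  note s = sc_j_pos[of 1 1, simplified] sc_k_pos[of 1 1, simplified] sc_j_neg[of 1 1, simplified] sc_k_neg[of 1 1, simplified]
  have s1: "sc_j (1, - 1, \<alpha>, \<gamma>, u, v, w)
      = (- 1, 1, - a1, a2, - y1, y2, w1)"
    by (simp only: s a y ws)
  have s2: "sc_k (- 1, 1, - a1, a2, - y1, y2, w1)
      = (1, - 1, a3, - a2, y3, - y2, w2)"
    by (simp only: s a y ws)
  have s3: "sc_j (1, - 1, a3, - a2, y3, - y2, w2)
      = (- 1, 1, - a3, a4, - y3, y4, w3)"
    by (simp only: s a y ws)
  have t1: "sc_k (1, - 1, \<alpha>, \<gamma>, u, v, w) = (- 1, 1, a8, - a7, y8, - y7, w + sign_mult a7 y7)"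
    by (simp only: s a y ws)
  have t2: "sc_j (- 1, 1, a8, - a7, y8, - y7, w + sign_mult a7 y7)
      = (1, - 1, - a8, - a7 + max 0 (a8), - y8, - y7 - max 0 (- y8), w + sign_mult a7 y7 + sign_mult a8 y8)"
    by (simp only: s)
  have e: "- a3 = - a7 + max 0 (a8)" "a4 = - a8"
    using a2_def a3_def a4_def a8_def by (smt (verit))+
  have f: "- y3 = - y7 - max 0 (- y8)" "y4 = - y8"
    using y2_def y3_def y4_def y8_def by (smt (verit))+
  show ?thesis
    unfolding s1 s2 s3 t1 t2 sc_swap.simps e f
    using rank2_sum_11[OF a2_def a3_def a8_def y2_def y3_def y8_def] by (simp add: ws)
qed

lemma rank2_12:
  "sc_k (sc_j (sc_k (sc_j (1, - 2, \<alpha>, \<gamma>, u, v, w))))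
   = sc_j (sc_k (1, - 2, \<alpha>, \<gamma>, u, v, w))"
proof -
  define a1 where "a1 = \<alpha>"
  define y1 where "y1 = u"
  define a7 where "a7 = \<gamma>"
  define y7 where "y7 = v"
  define a2 where "a2 = a7 - 2 * max 0 (- a1)"
  define y2 where "y2 = y7 + max 0 (y1)"
  define a3 where "a3 = - a1 - max 0 (- a2)"
  define y3 where "y3 = - y1 + 2 * max 0 (y2)"
  define a4 where "a4 = - a2 - 2 * max 0 (- a3)"
  define y4 where "y4 = - y2 + max 0 (y3)"
  define a5 where "a5 = - a3 - max 0 (- a4)"
  define y5 where "y5 = - y3 + 2 * max 0 (y4)"
  define a8 where "a8 = a1 + max 0 (a7)"
  define y8 where "y8 = y1 - 2 * max 0 (- y7)"
  define w1 where "w1 = w + sign_mult a1 y1"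
  define w2 where "w2 = w1 + sign_mult a2 y2"
  define w3 where "w3 = w2 + sign_mult a3 y3"
  define w4 where "w4 = w3 + sign_mult a4 y4"
  note ws = w1_def w2_def w3_def w4_def
  note a = a1_def a7_def a2_def a3_def a4_def a5_def a8_def
  note y = y1_def y7_def y2_def y3_def y4_def y5_def y8_def
  note s = sc_j_pos[of 1 2, simplified] sc_k_pos[of 1 2, simplified] sc_j_neg[of 1 2, simplified] sc_k_neg[of 1 2, simplified]
  have s1: "sc_j (1, - 2, \<alpha>, \<gamma>, u, v, w)
      = (- 1, 2, - a1, a2, - y1, y2, w1)"
    by (simp only: s a y ws)
  have s2: "sc_k (- 1, 2, - a1, a2, - y1, y2, w1)
      = (1, - 2, a3, - a2, y3, - y2, w2)"
    by (simp only: s a y ws)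
  have s3: "sc_j (1, - 2, a3, - a2, y3, - y2, w2)
      = (- 1, 2, - a3, a4, - y3, y4, w3)"
    by (simp only: s a y ws)
  have s4: "sc_k (- 1, 2, - a3, a4, - y3, y4, w3)
      = (1, - 2, a5, - a4, y5, - y4, w4)"
    by (simp only: s a y ws)
  have t1: "sc_k (1, - 2, \<alpha>, \<gamma>, u, v, w) = (- 1, 2, a8, - a7, y8, - y7, w + sign_mult a7 y7)"
    by (simp only: s a y ws)
  have t2: "sc_j (- 1, 2, a8, - a7, y8, - y7, w + sign_mult a7 y7)
      = (1, - 2, - a8, - a7 + 2 * max 0 (a8), - y8, - y7 - max 0 (- y8), w + sign_mult a7 y7 + sign_mult a8 y8)"
    by (simp only: s)
  have e: "a5 = - a8" "- a4 = - a7 + 2 * max 0 (a8)"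
    using a2_def a3_def a4_def a5_def a8_def by (smt (verit))+
  have f: "y5 = - y8" "- y4 = - y7 - max 0 (- y8)"
    using y2_def y3_def y4_def y5_def y8_def by (smt (verit))+
  show ?thesis
    unfolding s1 s2 s3 s4 t1 t2 sc_swap.simps e f
    using rank2_sum_12[OF a2_def a3_def a4_def a8_def y2_def y3_def y4_def y8_def] by (simp add: ws)
qed

lemma rank2_13:
  "sc_k (sc_j (sc_k (sc_j (sc_k (sc_j (1, - 3, \<alpha>, \<gamma>, u, v, w))))))
   = sc_j (sc_k (1, - 3, \<alpha>, \<gamma>, u, v, w))"
proof -
  define a1 where "a1 = \<alpha>"
  define y1 where "y1 = u"
  define a7 where "a7 = \<gamma>"
  define y7 where "y7 = v"
  define a2 where "a2 = a7 - 3 * max 0 (- a1)"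
  define y2 where "y2 = y7 + max 0 (y1)"
  define a3 where "a3 = - a1 - max 0 (- a2)"
  define y3 where "y3 = - y1 + 3 * max 0 (y2)"
  define a4 where "a4 = - a2 - 3 * max 0 (- a3)"
  define y4 where "y4 = - y2 + max 0 (y3)"
  define a5 where "a5 = - a3 - max 0 (- a4)"
  define y5 where "y5 = - y3 + 3 * max 0 (y4)"
  define a6 where "a6 = - a4 - 3 * max 0 (- a5)"
  define y6 where "y6 = - y4 + max 0 (y5)"
  define a9 where "a9 = - a5 - max 0 (- a6)"
  define y9 where "y9 = - y5 + 3 * max 0 (y6)"
  define a8 where "a8 = a1 + max 0 (a7)"
  define y8 where "y8 = y1 - 3 * max 0 (- y7)"
  define w1 where "w1 = w + sign_mult a1 y1"
  define w2 where "w2 = w1 + sign_mult a2 y2"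
  define w3 where "w3 = w2 + sign_mult a3 y3"
  define w4 where "w4 = w3 + sign_mult a4 y4"
  define w5 where "w5 = w4 + sign_mult a5 y5"
  define w6 where "w6 = w5 + sign_mult a6 y6"
  note ws = w1_def w2_def w3_def w4_def w5_def w6_def
  note a = a1_def a7_def a2_def a3_def a4_def a5_def a6_def a9_def a8_def
  note y = y1_def y7_def y2_def y3_def y4_def y5_def y6_def y9_def y8_def
  note s = sc_j_pos[of 1 3, simplified] sc_k_pos[of 1 3, simplified] sc_j_neg[of 1 3, simplified] sc_k_neg[of 1 3, simplified]
  have s1: "sc_j (1, - 3, \<alpha>, \<gamma>, u, v, w)
      = (- 1, 3, - a1, a2, - y1, y2, w1)"
    by (simp only: s a y ws)
  have s2: "sc_k (- 1, 3, - a1, a2, - y1, y2, w1)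
      = (1, - 3, a3, - a2, y3, - y2, w2)"
    by (simp only: s a y ws)
  have s3: "sc_j (1, - 3, a3, - a2, y3, - y2, w2)
      = (- 1, 3, - a3, a4, - y3, y4, w3)"
    by (simp only: s a y ws)
  have s4: "sc_k (- 1, 3, - a3, a4, - y3, y4, w3)
      = (1, - 3, a5, - a4, y5, - y4, w4)"
    by (simp only: s a y ws)
  have s5: "sc_j (1, - 3, a5, - a4, y5, - y4, w4)
      = (- 1, 3, - a5, a6, - y5, y6, w5)"
    by (simp only: s a y ws)
  have s6: "sc_k (- 1, 3, - a5, a6, - y5, y6, w5)
      = (1, - 3, a9, - a6, y9, - y6, w6)"
    by (simp only: s a y ws)
  have t1: "sc_k (1, - 3, \<alpha>, \<gamma>, u, v, w) = (- 1, 3, a8, - a7, y8, - y7, w + sign_mult a7 y7)"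
    by (simp only: s a y ws)
  have t2: "sc_j (- 1, 3, a8, - a7, y8, - y7, w + sign_mult a7 y7)
      = (1, - 3, - a8, - a7 + 3 * max 0 (a8), - y8, - y7 - max 0 (- y8), w + sign_mult a7 y7 + sign_mult a8 y8)"
    by (simp only: s)
  have e: "a9 = - a8" "- a6 = - a7 + 3 * max 0 (a8)"
    using a2_def a3_def a4_def a5_def a6_def a9_def a8_def by (smt (verit))+
  have f: "y9 = - y8" "- y6 = - y7 - max 0 (- y8)"
    using y2_def y3_def y4_def y5_def y6_def y9_def y8_def by (smt (verit))+
  show ?thesis
    unfolding s1 s2 s3 s4 s5 s6 t1 t2 sc_swap.simps e f
    using rank2_sum_13[OF a2_def a3_def a4_def a5_def a6_def a8_def y2_def y3_def y4_def y5_def y6_def y8_def] by (simp add: ws)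
qed

lemma rank2_21:
  "sc_k (sc_j (sc_k (sc_j (2, - 1, \<alpha>, \<gamma>, u, v, w))))
   = sc_j (sc_k (2, - 1, \<alpha>, \<gamma>, u, v, w))"
proof -
  have "(2, - 1, \<alpha>, \<gamma>, u, v, w) = sc_scale 2 (1, - 2, \<alpha>, 2 * \<gamma>, u, v / 2, w)" by simp
  then show ?thesis by (simp only: sc_j_scale sc_k_scale zero_less_numeral rank2_12)
qed

lemma rank2_31:
  "sc_k (sc_j (sc_k (sc_j (sc_k (sc_j (3, - 1, \<alpha>, \<gamma>, u, v, w))))))
   = sc_j (sc_k (3, - 1, \<alpha>, \<gamma>, u, v, w))"
proof -
  have "(3, - 1, \<alpha>, \<gamma>, u, v, w) = sc_scale 3 (1, - 3, \<alpha>, 3 * \<gamma>, u, v / 3, w)" by simp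
  then show ?thesis by (simp only: sc_j_scale sc_k_scale zero_less_numeral rank2_13)
qed

section \<open>Mutation along words of directions\<close>

definition ym :: "'v \<Rightarrow> ('v \<Rightarrow> 'v \<Rightarrow> real) \<Rightarrow> ('v \<Rightarrow> real) \<Rightarrow> 'v \<Rightarrow> real" where
  "ym k b Y = (\<lambda>l. if l = k then - Y k else Y l + max 0 (b k l) * Y k - b k l * min 0 (Y k))"

fun bw :: "('v \<Rightarrow> 'v \<Rightarrow> real) \<Rightarrow> 'v list \<Rightarrow> 'v \<Rightarrow> 'v \<Rightarrow> real" where
  "bw b [] = b"
| "bw b (k # ks) = bw (mm k b) ks"

fun xw :: "('v::finite \<Rightarrow> 'v \<Rightarrow> real) \<Rightarrow> ('v \<Rightarrow> real) \<Rightarrow> 'v list \<Rightarrow> 'v \<Rightarrow> real" where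
  "xw b p [] = p"
| "xw b p (k # ks) = xw (mm k b) (xm k b p) ks"

fun cw :: "('v \<Rightarrow> 'v \<Rightarrow> real) \<Rightarrow> ('v \<Rightarrow> real) \<Rightarrow> 'v list \<Rightarrow> 'v \<Rightarrow> real" where
  "cw b a [] = a"
| "cw b a (k # ks) = cw (mm k b) (cm k b a) ks"

fun yw :: "('v \<Rightarrow> 'v \<Rightarrow> real) \<Rightarrow> ('v \<Rightarrow> real) \<Rightarrow> 'v list \<Rightarrow> 'v \<Rightarrow> real" where
  "yw b Y [] = Y"
| "yw b Y (k # ks) = yw (mm k b) (ym k b Y) ks"

text \<open>The same scalar recursion governs the matrix entries off the mutated rows and columns and the pairing of a
  column with a point.\<close>

fun ww :: "('v \<Rightarrow> 'v \<Rightarrow> real) \<Rightarrow> ('v \<Rightarrow> real) \<Rightarrow> ('v \<Rightarrow> real) \<Rightarrow> real \<Rightarrow> 'v list \<Rightarrow> real" where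
  "ww b a Y w [] = w"
| "ww b a Y w (k # ks) = ww (mm k b) (cm k b a) (ym k b Y) (w + max 0 (a k) * Y k - a k * min 0 (Y k)) ks"

fun flow :: "('v \<Rightarrow> 'v \<Rightarrow> real) \<Rightarrow> ('v \<Rightarrow> real) \<Rightarrow> 'v list \<Rightarrow> bool" where
  "flow b Y [] \<longleftrightarrow> True"
| "flow b Y (k # ks) \<longleftrightarrow> Y k > 0 \<and> flow (mm k b) (ym k b Y) ks"

lemma skew_bw:
  assumes "skew d b" "\<And>i. d i > 0"
  shows "skew d (bw b ks)"
  using assms(1) by (induction ks arbitrary: b) (auto intro: skew_mm assms(2))

lemma bw_append: "bw b (ks @ ls) = bw (bw b ks) ls"
  by (induction ks arbitrary: b) auto

lemma xw_append: "xw b p (ks @ ls) = xw (bw b ks) (xw b p ks) ls"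
  by (induction ks arbitrary: b p) auto

lemma yv_mm: "b k k = 0 \<Longrightarrow> yv (mm k b) (xm k b p) = ym k b (yv b p)"
  by (rule ext) (simp add: yv_mm_xm ym_def)

lemma yv_bw:
  assumes "skew d b" "\<And>i. d i > 0"
  shows "yv (bw b ks) (xw b p ks) = yw b (yv b p) ks"
  using assms(1)
proof (induction ks arbitrary: b p)
  case (Cons k ks)
  then show ?case
    using skew_diag[OF Cons.prems] skew_mm[OF Cons.prems] assms(2) by (simp add: yv_mm)
qed simp

text \<open>The sign rule for matrix entries and the rule for y-variables are the same function of
  two reals, written differently. A row with unmutated index is thus a vector of tropical
  coefficients.\<close>

lemma mm_row: "i \<noteq> k \<Longrightarrow> mm k b i = ym k b (b i)"
proof (rule ext)
  fix l assume "i \<noteq> k"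
  have "sgn x * max 0 (x * c) = max 0 c * x - c * min 0 x" for x c :: real
    by (cases "x > 0"; cases "x = 0"; cases "c \<ge> 0")
       (auto simp: max_def min_def sgn_if mult_le_0_iff zero_le_mult_iff)
  then show "mm k b i l = ym k b (b i) l"
    using \<open>i \<noteq> k\<close> by (simp add: mm_def ym_def)
qed

lemma cm_row: "i \<noteq> k \<Longrightarrow> cm k b a i = a i + max 0 (a k) * b i k - a k * min 0 (b i k)"
proof -
  assume "i \<noteq> k"
  have "sgn x * max 0 (x * c) = max 0 c * x - c * min 0 x" for x c :: real
    by (cases "x > 0"; cases "x = 0"; cases "c \<ge> 0")
       (auto simp: max_def min_def sgn_if mult_le_0_iff zero_le_mult_iff)
  then show ?thesis using \<open>i \<noteq> k\<close> by (simp add: cm_def)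
qed

lemma bw_row: "i \<notin> set ks \<Longrightarrow> bw b ks i = yw b (b i) ks"
  by (induction ks arbitrary: b) (auto simp: mm_row)

lemma bw_col:
  assumes "l \<notin> set ks"
  shows "bw b ks i l = cw b (\<lambda>i. b i l) ks i"
  using assms
proof (induction ks arbitrary: b)
  case Nil
  show ?case by (simp only: bw.simps cw.simps)
next
  case (Cons k ks)
  have l: "l \<noteq> k" "l \<notin> set ks" using Cons.prems by auto
  have "bw b (k # ks) i l = cw (mm k b) (\<lambda>i. mm k b i l) ks i"
    using Cons.IH[OF l(2), of "mm k b"] by (simp only: bw.simps)
  also have "\<dots> = cw b (\<lambda>i. b i l) (k # ks) i"
    by (simp only: mm_cm[OF l(1)] cw.simps)
  finally show ?case .
qed

lemma cw_row:
  assumes "i \<notin> set ks"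
  shows "cw b a ks i = ww b a (b i) (a i) ks"
  using assms
proof (induction ks arbitrary: b a)
  case Nil
  show ?case by (simp only: ww.simps cw.simps)
next
  case (Cons k ks)
  have *: "i \<noteq> k" "i \<notin> set ks" using Cons.prems by auto
  show ?case
    using Cons.IH[OF *(2), of "mm k b" "cm k b a"]
    by (simp only: ww.simps cw.simps mm_row[OF *(1)] cm_row[OF *(1)])
qed

lemma pair_cw:
  assumes "skew d b" "\<And>i. d i > 0"
  shows "pair (cw b a ks) (xw b p ks) = ww b a (yv b p) (pair a p) ks"
  using assms(1)
proof (induction ks arbitrary: b a p)
  case (Cons k ks)
  then show ?case
    using skew_diag[OF Cons.prems] skew_mm[OF Cons.prems] assms(2) by (simp add: yv_mm pair_cm_xm)
qed simp

lemma cm_mm: "b k k = 0 \<Longrightarrow> cm k (mm k b) (cm k b a) = a"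
  by (intro ext) (auto simp: mm_def cm_def sgn_minus)

text \<open>Column mutation is invertible, so a column can be chosen at the start for what it
  becomes at the end; \<open>rank2_state\<close> lets it end as a unit vector.\<close>

lemma cw_rev:
  assumes "skew d b" "\<And>i. d i > 0"
  shows "\<exists>a. cw b a ks = e"
  using assms(1)
proof (induction ks arbitrary: b)
  case (Cons k ks)
  obtain a where a: "cw (mm k b) a ks = e" using Cons.IH[OF skew_mm[OF Cons.prems assms(2)]] by blast
  have "mm k b k k = 0" using skew_diag[OF Cons.prems] assms(2) by (simp add: mm_def)
  then have "cm k b (cm k (mm k b) a) = a"
    using cm_mm[of "mm k b" k a] mm_mm[of b k] skew_diag[OF Cons.prems assms(2), of k] by simp
  then have "cw b (cm k (mm k b) a) (k # ks) = e" using a by (simp only: cw.simps)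
  then show ?case by blast
qed simp

section \<open>Reduction of rank 2 loops to scalars\<close>

definition scal :: "'v \<Rightarrow> 'v \<Rightarrow> ('v \<Rightarrow> 'v \<Rightarrow> real) \<Rightarrow> ('v \<Rightarrow> real) \<Rightarrow> ('v \<Rightarrow> real) \<Rightarrow> real \<Rightarrow> sc" where
  "scal j k b a Y w = (b j k, b k j, a j, a k, Y j, Y k, w)"

fun sc_word :: "'v \<Rightarrow> 'v list \<Rightarrow> sc \<Rightarrow> sc" where
  "sc_word j [] s = s"
| "sc_word j (i # ks) s = sc_word j ks (if i = j then sc_j s else sc_k s)"

fun sc_flow :: "'v \<Rightarrow> 'v list \<Rightarrow> sc \<Rightarrow> bool" where
  "sc_flow j [] s \<longleftrightarrow> True"
| "sc_flow j (i # ks) (B, C, \<alpha>, \<gamma>, u, v, w) \<longleftrightarrow> (if i = j then u > 0 else v > 0) \<and>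
     sc_flow j ks (if i = j then sc_j (B, C, \<alpha>, \<gamma>, u, v, w) else sc_k (B, C, \<alpha>, \<gamma>, u, v, w))"

lemma scal_step:
  assumes "j \<noteq> k" "i = j \<or> i = k"
  shows "scal j k (mm i b) (cm i b a) (ym i b Y) (w + max 0 (a i) * Y i - a i * min 0 (Y i))
    = (if i = j then sc_j (scal j k b a Y w) else sc_k (scal j k b a Y w))"
  using assms by (auto simp: scal_def sc_j.simps sc_k_def mm_def cm_def ym_def)

lemma scal_word:
  assumes "j \<noteq> k" "set ks \<subseteq> {j, k}"
  shows "scal j k (bw b ks) (cw b a ks) (yw b Y ks) (ww b a Y w ks) = sc_word j ks (scal j k b a Y w)"
  using assms(2)
proof (induction ks arbitrary: b a Y w)
  case (Cons i ks)
  then show ?case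
    using scal_step[OF assms(1), of i b a Y w]
    by (simp only: bw.simps cw.simps yw.simps ww.simps sc_word.simps) simp
qed simp

lemma flow_sc_flow:
  assumes "j \<noteq> k" "set ks \<subseteq> {j, k}"
  shows "flow b Y ks \<longleftrightarrow> sc_flow j ks (scal j k b a Y w)"
  using assms(2)
proof (induction ks arbitrary: b a Y w)
  case (Cons i ks)
  have i: "i = j \<or> i = k" "set ks \<subseteq> {j, k}" using Cons.prems by auto
  have "flow (mm i b) (ym i b Y) ks \<longleftrightarrow> sc_flow j ks (if i = j then sc_j (scal j k b a Y w) else sc_k (scal j k b a Y w))"
    unfolding scal_step[OF assms(1) i(1), of b a Y w, symmetric] by (rule Cons.IH[OF i(2)])
  then show ?case using i(1) assms(1) unfolding scal_def by (cases "i = j") simp_all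
qed simp

lemma scal_eq_iff:
  "scal j k b a Y w = scal j k b' a' Y' w' \<longleftrightarrow>
     b j k = b' j k \<and> b k j = b' k j \<and> a j = a' j \<and> a k = a' k \<and> Y j = Y' j \<and> Y k = Y' k \<and> w = w'"
  by (auto simp: scal_def)

text \<open>Equality of the scalar recursions carries over to the whole seed. A row outside
  \<open>{j, k}\<close> plays the part of \<open>Y\<close>, a column outside plays the part of
  \<open>a\<close>, an entry outside both plays the part of \<open>w\<close>; coordinates of a point
  are pairings with columns that end as unit vectors.\<close>

lemma rank2_state:
  fixes b :: "'v::finite \<Rightarrow> 'v \<Rightarrow> real"
  assumes jk: "j \<noteq> k" and sk: "skew d b" and d: "\<And>i. d i > 0"
    and A: "set A \<subseteq> {j, k}" and B: "set B \<subseteq> {j, k}"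
    and eq: "\<And>\<alpha> \<gamma> u v w. sc_word j A (b j k, b k j, \<alpha>, \<gamma>, u, v, w)
       = (if sw then sc_swap else id) (sc_word j B (b j k, b k j, \<alpha>, \<gamma>, u, v, w))"
    and \<pi>: "\<pi> = (if sw then id(j := k, k := j) else id)"
  shows "bw b A (\<pi> i) (\<pi> l) = bw b B i l" "xw b p A (\<pi> m) = xw b p B m"
proof -
  have \<pi>_simps: "\<pi> j = (if sw then k else j)" "\<pi> k = (if sw then j else k)"
    "\<And>i. i \<noteq> j \<Longrightarrow> i \<noteq> k \<Longrightarrow> \<pi> i = i" "\<And>i. \<pi> (\<pi> i) = i"
    using jk by (auto simp: \<pi>)
  have sc: "scal j k (bw b A) (cw b a A) (yw b Y A) (ww b a Y w A)
      = scal j k (\<lambda>i l. bw b B (\<pi> i) (\<pi> l)) (\<lambda>i. cw b a B (\<pi> i)) (\<lambda>l. yw b Y B (\<pi> l)) (ww b a Y w B)" for a Y w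
  proof -
    have "scal j k (bw b A) (cw b a A) (yw b Y A) (ww b a Y w A)
        = (if sw then sc_swap else id) (scal j k (bw b B) (cw b a B) (yw b Y B) (ww b a Y w B))"
      unfolding scal_word[OF jk A] scal_word[OF jk B] by (simp add: scal_def eq)
    then show ?thesis by (simp add: scal_def \<pi>_simps split: if_splits)
  qed
  note sc = sc[unfolded scal_eq_iff]
  have diag: "bw b ls r r = 0" for ls r
    using skew_diag[OF skew_bw[OF sk d] d] .
  have notin: "i \<notin> set A" "i \<notin> set B" if "i \<noteq> j" "i \<noteq> k" for i
    using that A B by auto
  have B1: "bw b A i l = bw b B (\<pi> i) (\<pi> l)" for i l
  proof (cases "i = j \<or> i = k")
    case i: True
    show ?thesis
    proof (cases "l = j \<or> l = k")
      case True
      \<comment> \<open>Only the matrix entries at \<open>(j, k)\<close> and \<open>(k, j)\<close>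
        are read off here, so column, y-variables and pairing may be arbitrary.\<close>
      then show ?thesis using i sc[of undefined undefined undefined] diag by (auto simp: \<pi>_simps)
    next
      case False
      then have l: "l \<noteq> j" "l \<noteq> k" by auto
      show ?thesis
        unfolding bw_col[OF notin(1)[OF l]] \<pi>_simps(3)[OF l] bw_col[OF notin(2)[OF l]]
        using i sc[of "\<lambda>i. b i l" undefined undefined] by auto
    qed
  next
    case False
    then have i: "i \<noteq> j" "i \<noteq> k" by auto
    show ?thesis
    proof (cases "l = j \<or> l = k")
      case True
      then show ?thesis
        unfolding bw_row[OF notin(1)[OF i]] \<pi>_simps(3)[OF i] bw_row[OF notin(2)[OF i]]
        using sc[of undefined "b i" undefined] by auto
    next
      case False
      then have l: "l \<noteq> j" "l \<noteq> k" by auto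
      show ?thesis
        unfolding \<pi>_simps(3)[OF i] \<pi>_simps(3)[OF l] bw_col[OF notin(1)[OF l]] bw_col[OF notin(2)[OF l]]
          cw_row[OF notin(1)[OF i]] cw_row[OF notin(2)[OF i]]
        using sc[of "\<lambda>i. b i l" "b i" "b i l"] by auto
    qed
  qed
  then show "bw b A (\<pi> i) (\<pi> l) = bw b B i l" using \<pi>_simps(4) by simp
  have C: "cw b a A i = cw b a B (\<pi> i)" for a i
  proof (cases "i = j \<or> i = k")
    case True
    then show ?thesis using sc[of a undefined undefined] by auto
  next
    case False
    then have i: "i \<noteq> j" "i \<noteq> k" by auto
    show ?thesis
      unfolding \<pi>_simps(3)[OF i] cw_row[OF notin(1)[OF i]] cw_row[OF notin(2)[OF i]]
      using sc[of a "b i" "a i"] by auto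
  qed
  obtain a where a: "cw b a B = (\<lambda>i. if i = m then 1 else 0)"
    using cw_rev[OF sk d] by blast
  have "pair (cw b a A) (xw b p A) = pair (cw b a B) (xw b p B)"
    unfolding pair_cw[OF sk d] using sc[of a "yv b p" "pair a p"] by auto
  moreover have "pair (cw b a B) (xw b p B) = xw b p B m"
    unfolding a pair_def by (simp add: if_distrib [of "\<lambda>x. x * _"] cong: if_cong)
  moreover have "pair (cw b a A) (xw b p A) = xw b p A (\<pi> m)"
  proof -
    have "(if \<pi> i = m then 1 else 0) * xw b p A i = (if i = \<pi> m then xw b p A i else 0)" for i
      using \<pi>_simps(4) by auto
    then show ?thesis
      unfolding pair_def C a by simp
  qed
  ultimately show "xw b p A (\<pi> m) = xw b p B m" by simp
qed

text \<open>With \<open>b j k \<ge> 0\<close> the path that begins with \<open>j\<close> is the long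
  one, unless the two mutations commute. If both y-variables are positive, each path mutates at
  positive y-variables throughout and so belongs to the flow of \<open>Y\<close>; this supplies the
  confluence diagrams.\<close>

lemma rank2_loop:
  fixes b :: "'v::finite \<Rightarrow> 'v \<Rightarrow> real"
  assumes jk: "j \<noteq> k" and sk: "skew d b" and d: "\<And>i. d i > 0"
    and bc: "(b j k, b k j) \<in> {(0, 0), (1, - 1), (1, - 2), (2, - 1), (1, - 3), (3, - 1)}"
  obtains A \<pi> where "set A \<subseteq> {j, k}"
    "\<And>i. \<pi> (\<pi> i) = i" "\<And>i. d (\<pi> i) = d i" "\<And>i. i \<notin> {j, k} \<Longrightarrow> \<pi> i = i" "\<pi> ` {j, k} = {j, k}"
    "\<And>i l. bw b (j # A) (\<pi> i) (\<pi> l) = bw b [k, j] i l"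
    "\<And>p i. xw b p (j # A) (\<pi> i) = xw b p [k, j] i"
    "\<And>Y. Y j > 0 \<Longrightarrow> Y k > 0 \<Longrightarrow> flow b Y (j # A) \<and> flow b Y [k, j]"
proof -
  note result = that
  have *: thesis
    if A: "set A \<subseteq> {j, k}"
      and sw: "sw \<longrightarrow> (b j k, b k j) = (1, - 1)"
      and eq: "\<And>\<alpha> \<gamma> u v w. sc_word j (j # A) (b j k, b k j, \<alpha>, \<gamma>, u, v, w)
       = (if sw then sc_swap else id) (sc_word j [k, j] (b j k, b k j, \<alpha>, \<gamma>, u, v, w))"
      and fl: "\<And>u v. u > 0 \<Longrightarrow> v > 0 \<Longrightarrow> sc_flow j (j # A) (b j k, b k j, 0, 0, u, v, 0)
         \<and> sc_flow j [k, j] (b j k, b k j, 0, 0, u, v, 0)"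
    for A sw
  proof -
    define \<pi> where "\<pi> = (if sw then id(j := k, k := j) else id)"
    have A': "set (j # A) \<subseteq> {j, k}" "set [k, j] \<subseteq> {j, k}" using A by auto
    note st = rank2_state[OF jk sk d A' eq \<pi>_def]
    \<comment> \<open>Labels are exchanged only in the symmetric type \<open>(1, - 1)\<close>, where
      the symmetrizer takes equal values at \<open>j\<close> and \<open>k\<close>. Hence \<pi>
      preserves \<open>d\<close>, and with it \<open>Phi\<close>.\<close>
    have dd: "d j = d k" if sw
      using sw that sk unfolding skew_def by (metis fst_conv minus_mult_right minus_minus mult.right_neutral snd_conv)
    have "flow b Y (j # A) \<and> flow b Y [k, j]" if "Y j > 0" "Y k > 0" for Y
      using fl[OF that]
      unfolding flow_sc_flow[OF jk A'(1), of b Y "\<lambda>_. 0" 0] flow_sc_flow[OF jk A'(2), of b Y "\<lambda>_. 0" 0]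
      by (simp only: scal_def)
    moreover have "d (\<pi> i) = d i" for i
      using dd by (auto simp: \<pi>_def)
    moreover have "\<pi> ` {j, k} = {j, k}" "\<And>i. \<pi> (\<pi> i) = i" "\<And>i. i \<notin> {j, k} \<Longrightarrow> \<pi> i = i"
      using jk by (auto simp: \<pi>_def)
    ultimately show thesis using result[OF A, of \<pi>] st by blast
  qed
  note s1 = sc_j_pos[of 1 1, simplified] sc_k_pos[of 1 1, simplified] sc_j_neg[of 1 1, simplified] sc_k_neg[of 1 1, simplified]
  note s2 = sc_j_pos[of 1 2, simplified] sc_k_pos[of 1 2, simplified] sc_j_neg[of 1 2, simplified] sc_k_neg[of 1 2, simplified]
  note s3 = sc_j_pos[of 2 1, simplified] sc_k_pos[of 2 1, simplified] sc_j_neg[of 2 1, simplified] sc_k_neg[of 2 1, simplified]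
  note s4 = sc_j_pos[of 1 3, simplified] sc_k_pos[of 1 3, simplified] sc_j_neg[of 1 3, simplified] sc_k_neg[of 1 3, simplified]
  note s5 = sc_j_pos[of 3 1, simplified] sc_k_pos[of 3 1, simplified] sc_j_neg[of 3 1, simplified] sc_k_neg[of 3 1, simplified]
  have m: "max 0 x = x" if "x > 0" for x :: real using that by simp
  have m': "max 0 (- x) = 0" if "x > 0" for x :: real using that by simp
  consider "b j k = 0" "b k j = 0" | "b j k = 1" "b k j = - 1" | "b j k = 1" "b k j = - 2"
    | "b j k = 2" "b k j = - 1" | "b j k = 1" "b k j = - 3" | "b j k = 3" "b k j = - 1"
    using bc by auto
  then show thesis
  proof cases
    case 1
    show thesis
      by (rule *[of "[k]" False]) (use jk 1 in \<open>auto simp: sc_k_def sc_j.simps\<close>)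
  next
    case 2
    note e = 2
    show thesis
    proof (rule *[of "[k, j]" True], goal_cases)
      case 3
      then show ?case using jk e by (simp add: rank2_11)
    next
      case 4
      then show ?case using jk e by (simp add: s1 m m')
    qed (use e in auto)
  next
    case 3
    note e = 3
    show thesis
    proof (rule *[of "[k, j, k]" False], goal_cases)
      case 3
      then show ?case using jk e by (simp add: rank2_12)
    next
      case 4
      then show ?case using jk e by (simp add: s2 m m')
    qed (use e in auto)
  next
    case 4
    note e = 4
    show thesis
    proof (rule *[of "[k, j, k]" False], goal_cases)
      case 3
      then show ?case using jk e by (simp add: rank2_21)
    next
      case 4
      then show ?case using jk e by (simp add: s3 m m')
    qed (use e in auto)
  next
    case 5
    note e = 5
    show thesis
    proof (rule *[of "[k, j, k, j, k]" False], goal_cases)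
      case 3
      then show ?case using jk e by (simp add: rank2_13)
    next
      case 4
      then show ?case using jk e by (simp add: s4 m m')
    qed (use e in auto)
  next
    case 6
    note e = 6
    show thesis
    proof (rule *[of "[k, j, k, j, k]" False], goal_cases)
      case 3
      then show ?case using jk e by (simp add: rank2_31)
    next
      case 4
      then show ?case using jk e by (simp add: s5 m m')
    qed (use e in auto)
  qed
qed

section \<open>Termination\<close>

lemma xw_fixed: "i \<notin> set ks \<Longrightarrow> xw b p ks i = p i"
  by (induction ks arbitrary: b p) (auto simp: xm_def)

lemma bw_rev:
  assumes "skew d b" "\<And>i. d i > 0"
  shows "bw (bw b ks) (rev ks) = b"
  using assms(1)
proof (induction ks arbitrary: b)
  case (Cons k ks)
  have "bw (bw (mm k b) ks) (rev ks) = mm k b"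
    by (rule Cons.IH[OF skew_mm[OF Cons.prems assms(2)]])
  then show ?case
    using mm_mm[of b k] skew_diag[OF Cons.prems assms(2), of k] by (simp add: bw_append)
qed simp

lemma xw_rev:
  assumes "skew d b" "\<And>i. d i > 0"
  shows "xw (bw b ks) (xw b p ks) (rev ks) = p"
  using assms(1)
proof (induction ks arbitrary: b p)
  case (Cons k ks)
  have *: "bw (bw (mm k b) ks) (rev ks) = mm k b"
    by (rule bw_rev[OF skew_mm[OF Cons.prems assms(2)] assms(2)])
  have "xw (bw (mm k b) ks) (xw (mm k b) (xm k b p) ks) (rev ks) = xm k b p"
    by (rule Cons.IH[OF skew_mm[OF Cons.prems assms(2)]])
  then show ?case
    using xm_mm[of b k p] skew_diag[OF Cons.prems assms(2), of k] * by (simp add: xw_append)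
qed simp

lemma xw_rev':
  assumes "skew d b" "\<And>i. d i > 0"
  shows "xw b (xw (bw b ks) z (rev ks)) ks = z"
  using xw_rev[OF skew_bw[OF assms] assms(2), of ks "rev ks" z] bw_rev[OF assms, of ks] by simp

lemma ym_mm:
  assumes "b k k = 0"
  shows "ym k (mm k b) (ym k b Y) = Y"
proof (rule ext)
  fix l
  have "max 0 x * y - x * min 0 y + (max 0 (- x) * - y - - x * min 0 (- y)) = 0" for x y :: real
    by (cases "x \<ge> 0"; cases "y \<ge> 0") (auto simp: max_def min_def)
  then show "ym k (mm k b) (ym k b Y) l = Y l"
    using assms by (auto simp: ym_def mm_def algebra_simps)
qed

text \<open>What full rank provides: the y-variables with index in \<open>K\<close> can be given
  arbitrary values. In this form it is visibly stable under mutation, which acts bijectively on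
  points and on y-variables.\<close>

definition surj_on_K where
  "surj_on_K K b \<longleftrightarrow> (\<forall>t. \<exists>p. \<forall>k\<in>K. yv b p k = t k)"

lemma surj_on_K_mm:
  assumes "surj_on_K K b" "k \<in> K" "b k k = 0"
  shows "surj_on_K K (mm k b)"
  unfolding surj_on_K_def
proof
  fix t
  obtain p where p: "\<forall>l\<in>K. yv b p l = ym k (mm k b) t l"
    using assms(1) unfolding surj_on_K_def by blast
  have "yv (mm k b) (xm k b p) l = t l" if "l \<in> K" for l
  proof -
    have "yv (mm k b) (xm k b p) l = ym k b (ym k (mm k b) t) l"
      using p that assms(2) yv_mm[of b k p, OF assms(3)] by (simp add: ym_def)
    also have "\<dots> = t l"
      using ym_mm[of "mm k b" k t] mm_mm[of b k] assms(3) by (simp add: mm_def)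
    finally show ?thesis .
  qed
  then show "\<exists>p. \<forall>l\<in>K. yv (mm k b) p l = t l" by blast
qed

lemma surj_on_K_bw:
  assumes "surj_on_K K b" "set ks \<subseteq> K" "skew d b" "\<And>i. d i > 0"
  shows "surj_on_K K (bw b ks)"
  using assms(1-3)
proof (induction ks arbitrary: b)
  case (Cons k ks)
  show ?case
    unfolding bw.simps
    using Cons.prems surj_on_K_mm[of K b k] skew_diag[OF Cons.prems(3) assms(4), of k]
      skew_mm[OF Cons.prems(3) assms(4)]
    by (intro Cons.IH) auto
qed simp

lemma sum_single: "(\<Sum>j\<in>UNIV. f j * (if j = i then c else 0)) = f i * (c::real)" for i :: "'v::finite"
  by (simp add: if_distrib[of "\<lambda>x. _ * x"] cong: if_cong)

locale trop_cluster =
  fixes d :: "'v::finite \<Rightarrow> real" and K :: "'v set" and b :: "'v \<Rightarrow> 'v \<Rightarrow> real"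
  assumes d_pos: "\<And>i. d i > 0"
    and sk: "skew d b"
    and int: "\<And>i k. i \<in> K \<Longrightarrow> k \<in> K \<Longrightarrow> b i k \<in> \<int>"
    and onto: "surj_on_K K b"
    and fin: "finite ((\<lambda>ks p. xw b p ks) ` {ks. set ks \<subseteq> K})"
begin

abbreviation "W \<equiv> {ks. set ks \<subseteq> K}"

abbreviation "X ks w \<equiv> xw b w ks"

abbreviation "M ks \<equiv> bw b ks"

abbreviation "Y ks w \<equiv> yv (M ks) (X ks w)"

abbreviation "F ks u w \<equiv> Phi d (M ks) (X ks u) (X ks w)"

lemma sk_M: "skew d (M ks)" using skew_bw[OF sk d_pos] .

lemma diag_M: "M ks k k = 0" using skew_diag[OF sk_M d_pos] .

lemma M_snoc: "M (ks @ [k]) = mm k (M ks)" by (simp add: bw_append)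

lemma X_snoc: "X (ks @ [k]) w = xm k (M ks) (X ks w)" by (simp add: xw_append)

lemma Y_snoc: "Y (ks @ [k]) w = ym k (M ks) (Y ks w)"
  by (simp add: M_snoc X_snoc yv_mm diag_M)

lemma F_snoc: "F (ks @ [k]) u w = F ks u w
    + (max 0 (Y ks w k) * max 0 (- Y ks u k) - max 0 (- Y ks w k) * max 0 (Y ks u k)) / d k"
  unfolding M_snoc X_snoc by (rule Phi_xm[OF sk_M d_pos])

lemma X_onto: "\<exists>p. X ks p = z"
  using xw_rev'[OF sk d_pos] by blast

lemma Y_onto: "set ks \<subseteq> K \<Longrightarrow> \<exists>p. \<forall>k\<in>K. Y ks p k = t k"
  using surj_on_K_bw[OF onto _ sk d_pos, of ks] X_onto unfolding surj_on_K_def by metis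

text \<open>Any seed can serve as the initial one: the coordinate maps relative to it are old ones
  composed with the inverse of the path to it, so they are again finitely many.\<close>

lemma base_change:
  assumes "set ks \<subseteq> K"
  shows "trop_cluster d K (M ks)"
proof
  show "skew d (M ks)" "\<And>i. d i > 0" "surj_on_K K (M ks)"
    using sk_M d_pos surj_on_K_bw[OF onto assms sk d_pos] by auto
  show "M ks i k \<in> \<int>" if "i \<in> K" "k \<in> K" for i k
    using int assms that
  proof (induction ks arbitrary: b i k)
    case (Cons l ks)
    have "mm l b i k \<in> \<int>" if "i \<in> K" "k \<in> K" for i k
    proof -
      have "sgn x \<in> \<int>" for x :: real by (simp add: sgn_if)
      then show ?thesis
        using Cons.prems that by (auto simp: mm_def max_def)
    qed
    then show ?case using Cons by simp
  qed simp
  have "(\<lambda>ls p. xw (M ks) p ls) ` W \<subseteq> (\<lambda>f p. f (xw (M ks) p (rev ks))) ` (\<lambda>ls p. X ls p) ` W"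
  proof
    fix g assume "g \<in> (\<lambda>ls p. xw (M ks) p ls) ` W"
    then obtain ls where ls: "set ls \<subseteq> K" and g: "g = (\<lambda>p. xw (M ks) p ls)" by auto
    have "g = (\<lambda>p. X (ks @ ls) (xw (M ks) p (rev ks)))"
      unfolding g xw_append xw_rev'[OF sk d_pos] ..
    then show "g \<in> (\<lambda>f p. f (xw (M ks) p (rev ks))) ` (\<lambda>ls p. X ls p) ` W"
      using ls assms by (intro image_eqI[of _ _ "\<lambda>p. X (ks @ ls) p"]) auto
  qed
  then show "finite ((\<lambda>ls p. xw (M ks) p ls) ` W)"
    using fin finite_subset by blast
qed

lemma int_M: "set ks \<subseteq> K \<Longrightarrow> i \<in> K \<Longrightarrow> k \<in> K \<Longrightarrow> M ks i k \<in> \<int>"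
  using trop_cluster.int[OF base_change] by blast

definition MK :: "'v list \<Rightarrow> 'v \<Rightarrow> 'v \<Rightarrow> real" where
  "MK ks = (\<lambda>i k. if k \<in> K then M ks i k else 0)"

text \<open>Coordinate maps determine the absolute values of matrix entries. The sign of
  \<open>- 1\<close> matters: at minus a unit vector the minimum in the exchange rule is minus the
  absolute value of \<open>M ks i k\<close>, at plus a unit vector it would be 0.\<close>

lemma abs_M: "\<exists>p. X ks p = (\<lambda>j. if j = i then - 1 else 0) \<and>
    \<bar>M ks i k\<bar> = - (X (ks @ [k]) p k + X ks p k)"
proof -
  obtain p where p: "X ks p = (\<lambda>j. if j = i then - 1 else 0)" using X_onto by blast
  have "X (ks @ [k]) p k + X ks p k = min (- max 0 (M ks i k)) (- max 0 (- M ks i k))"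
    unfolding X_snoc xm_def p sum_single by simp
  then show ?thesis using p by (intro exI[of _ p]) (auto simp: max_def min_def)
qed

lemma finite_MK: "finite (MK ` W)"
proof -
  define Fs where "Fs = (\<lambda>ks p. X ks p) ` W"
  define S where "S = (\<lambda>(f, g, i, k). - (g (SOME p. f p = (\<lambda>j. if j = i then - 1 else 0)) k
      + f (SOME p. f p = (\<lambda>j. if j = i then - 1 else 0)) k)) ` (Fs \<times> Fs \<times> UNIV \<times> UNIV)"
  have finS: "finite S" unfolding S_def using fin by (intro finite_imageI finite_cartesian_product) (auto simp: Fs_def)
  have inS: "\<bar>M ks i k\<bar> \<in> S" if "set ks \<subseteq> K" "k \<in> K" for ks i k
  proof -
    obtain p where p: "X ks p = (\<lambda>j. if j = i then - 1 else 0)" "\<bar>M ks i k\<bar> = - (X (ks @ [k]) p k + X ks p k)"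
      using abs_M by blast
    \<comment> \<open>Coordinate maps are injective, so the chosen point is \<open>p\<close>, and
      the value in \<open>S\<close> is a function of the two maps and the two indices.\<close>
    have "(SOME p. X ks p = (\<lambda>j. if j = i then - 1 else 0)) = p"
    proof (rule some_equality)
      fix q assume "X ks q = (\<lambda>j. if j = i then - 1 else 0)"
      then show "q = p" using p(1) xw_rev[OF sk d_pos, of ks p] xw_rev[OF sk d_pos, of ks q] by simp
    qed (rule p(1))
    then show ?thesis
      unfolding S_def using that p(2)
      by (intro image_eqI[of _ _ "((\<lambda>p. X ks p), (\<lambda>p. X (ks @ [k]) p), i, k)"]) (auto simp: Fs_def)
  qed
  define T where "T = insert 0 (S \<union> uminus ` S)"
  have "finite T" using finS by (simp add: T_def)
  have inT: "MK ks i k \<in> T" if "set ks \<subseteq> K" for ks i k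
  proof -
    have "x \<in> T" if "\<bar>x\<bar> \<in> S" for x :: real
    proof (cases "x \<ge> 0")
      case False
      then have "x = - \<bar>x\<bar>" by simp
      then show ?thesis using that unfolding T_def by blast
    qed (use that in \<open>auto simp: T_def\<close>)
    then show ?thesis using inS[OF that] by (auto simp: MK_def T_def)
  qed
  have "MK ` W \<subseteq> PiE UNIV (\<lambda>_. PiE UNIV (\<lambda>_. T))"
    using inT by (auto simp: PiE_UNIV_domain)
  moreover have "finite (PiE (UNIV :: 'v set) (\<lambda>_. PiE (UNIV :: 'v set) (\<lambda>_. T)))"
    using \<open>finite T\<close> by (intro finite_PiE) auto
  ultimately show ?thesis using finite_subset by blast
qed

definition dat :: "'v list \<Rightarrow> ('v \<Rightarrow> 'v \<Rightarrow> real) \<times> (('v \<Rightarrow> real) \<Rightarrow> 'v \<Rightarrow> real)" where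
  "dat ks = (MK ks, \<lambda>p. X ks p)"

lemma finite_dat: "finite (dat ` W)"
proof -
  have "dat ` W \<subseteq> MK ` W \<times> (\<lambda>ks p. X ks p) ` W" by (auto simp: dat_def)
  then show ?thesis using finite_subset finite_MK fin by blast
qed

lemma Y_dat: "k \<in> K \<Longrightarrow> Y ks w k = (\<Sum>i\<in>UNIV. fst (dat ks) i k * snd (dat ks) w i)"
  by (simp add: yv_def dat_def MK_def)

lemma isolated_iff:
  assumes "set ks \<subseteq> K" "k \<in> K"
  shows "(\<forall>i\<in>K. M ks i k = 0) \<longleftrightarrow> (\<forall>i\<in>K. b i k = 0)"
proof -
  have step: "\<forall>i\<in>K. mm l c i k = 0" if "\<forall>i\<in>K. c i k = 0" "l \<in> K" for c l
    using that by (auto simp: mm_def)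
  have dir: "\<forall>i\<in>K. bw c ks i k = 0" if "\<forall>i\<in>K. c i k = 0" "set ks \<subseteq> K" for c ks
    using that by (induction ks arbitrary: c) (auto simp: step)
  show ?thesis
    using dir[of b ks] dir[of "M ks" "rev ks"] bw_rev[OF sk d_pos, of ks] assms by auto
qed

text \<open>One test point is taken for each of the finitely many pairs of seed data and direction.
  Vanishing outside \<open>K\<close> persists under mutation in \<open>K\<close>, so
  \<open>Phi\<close> of a test point involves only data recorded by \<open>dat\<close>.\<close>

lemma finite_test_points:
  obtains U where "finite U" "\<And>u i. u \<in> U \<Longrightarrow> i \<notin> K \<Longrightarrow> u i = 0"
    "\<And>ks k. set ks \<subseteq> K \<Longrightarrow> k \<in> K \<Longrightarrow> \<exists>i\<in>K. M ks i k \<noteq> 0 \<Longrightarrow> \<exists>u\<in>U. Y ks u k < 0"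
proof -
  define P where "P D k u \<longleftrightarrow> (\<forall>i. i \<notin> K \<longrightarrow> u i = 0) \<and> (\<Sum>i\<in>UNIV. fst D i k * snd D u i) < 0"
    for D :: "('v \<Rightarrow> 'v \<Rightarrow> real) \<times> (('v \<Rightarrow> real) \<Rightarrow> 'v \<Rightarrow> real)" and k u
  define U where "U = {u. \<exists>D\<in>dat ` W. \<exists>k\<in>K. (\<exists>u'. P D k u') \<and> u = (SOME u. P D k u)}"
  have "U \<subseteq> (\<lambda>(D, k). SOME u. P D k u) ` (dat ` W \<times> K)" by (auto simp: U_def)
  then have "finite U" using finite_dat by (meson finite finite_SigmaI finite_imageI finite_subset)
  moreover have "u i = 0" if "u \<in> U" "i \<notin> K" for u i
  proof -
    from that(1) obtain D k where "\<exists>u'. P D k u'" "u = (SOME u. P D k u)" unfolding U_def by blast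
    then have "P D k u" using someI_ex by metis
    then show ?thesis using that(2) by (simp add: P_def)
  qed
  moreover have "\<exists>u\<in>U. Y ks u k < 0" if ks: "set ks \<subseteq> K" "k \<in> K" "\<exists>i\<in>K. M ks i k \<noteq> 0" for ks k
  proof -
    from ks(3) obtain i where i: "i \<in> K" "M ks i k \<noteq> 0" by blast
    \<comment> \<open>This choice makes the \<open>k\<close>-th y-variable at \<open>ks\<close>
      equal to minus the square of \<open>M ks i k\<close>.\<close>
    obtain u where u: "X ks u = (\<lambda>j. if j = i then - M ks i k else 0)" using X_onto by blast
    have "u j = 0" if "j \<notin> K" for j
    proof -
      have "j \<notin> set ks" "j \<noteq> i" using that ks(1) i(1) by auto
      then show ?thesis using xw_fixed[of j ks b u] u by simp
    qed
    moreover have "Y ks u k < 0"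
      unfolding yv_def u sum_single using i(2) by (simp add: mult_neg_pos not_less_iff_gr_or_eq flip: power2_eq_square)
    ultimately have "P (dat ks) k u" using Y_dat[OF ks(2)] by (simp add: P_def)
    then have *: "\<exists>u. P (dat ks) k u" by blast
    then have "P (dat ks) k (SOME u. P (dat ks) k u)" by (rule someI_ex)
    then have "Y ks (SOME u. P (dat ks) k u) k < 0" using Y_dat[OF ks(2)] by (simp add: P_def)
    moreover have "(SOME u. P (dat ks) k u) \<in> U" using * ks unfolding U_def by blast
    ultimately show ?thesis by blast
  qed
  ultimately show thesis using that by blast
qed

text \<open>The test points have no frozen coordinates, so the sum of their \<open>Phi\<close>-values depends on finitely many data. It grows
  at every mutation of a non-isolated vertex; the isolated ones are accounted for by the second sum.\<close>

lemma terminating: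
  obtains N :: "'v list \<Rightarrow> nat" where
    "\<And>ks k. set ks \<subseteq> K \<Longrightarrow> k \<in> K \<Longrightarrow> Y ks w k > 0 \<Longrightarrow> N (ks @ [k]) < N ks"
proof -
  obtain U where U: "finite U" "\<And>u i. u \<in> U \<Longrightarrow> i \<notin> K \<Longrightarrow> u i = 0"
    "\<And>ks k. set ks \<subseteq> K \<Longrightarrow> k \<in> K \<Longrightarrow> \<exists>i\<in>K. M ks i k \<noteq> 0 \<Longrightarrow> \<exists>u\<in>U. Y ks u k < 0"
    using finite_test_points by metis
  define I where "I = {k\<in>K. \<forall>i\<in>K. b i k = 0}"
  define V where "V ks = (\<Sum>u\<in>U. F ks u w) - (\<Sum>k\<in>I. Y ks w k)" for ks
  define G where "G D = (\<Sum>u\<in>U. \<Sum>l\<in>K. snd D u l * (\<Sum>i\<in>UNIV. fst D i l * snd D w i) / d l)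
      - (\<Sum>k\<in>I. \<Sum>i\<in>UNIV. fst D i k * snd D w i)"
    for D :: "('v \<Rightarrow> 'v \<Rightarrow> real) \<times> (('v \<Rightarrow> real) \<Rightarrow> 'v \<Rightarrow> real)"
  have VG: "V ks = G (dat ks)" if "set ks \<subseteq> K" for ks
  proof -
    have "F ks u w = (\<Sum>l\<in>K. snd (dat ks) u l * (\<Sum>i\<in>UNIV. fst (dat ks) i l * snd (dat ks) w i) / d l)"
      if "u \<in> U" for u
    proof -
      have "X ks u l = 0" if "l \<notin> K" for l
        using xw_fixed[of l ks b u] U(2)[OF \<open>u \<in> U\<close> that] that \<open>set ks \<subseteq> K\<close> by auto
      then have "F ks u w = (\<Sum>l\<in>K. X ks u l * Y ks w l / d l)"
        unfolding Phi_def by (intro sum.mono_neutral_right) auto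
      also have "\<dots> = (\<Sum>l\<in>K. snd (dat ks) u l * (\<Sum>i\<in>UNIV. fst (dat ks) i l * snd (dat ks) w i) / d l)"
        by (intro sum.cong refl) (simp add: Y_dat, simp add: dat_def)
      finally show ?thesis .
    qed
    moreover have "(\<Sum>k\<in>I. Y ks w k) = (\<Sum>k\<in>I. \<Sum>i\<in>UNIV. fst (dat ks) i k * snd (dat ks) w i)"
      by (intro sum.cong refl Y_dat) (auto simp: I_def)
    ultimately show ?thesis by (simp add: V_def G_def)
  qed
  have "V ` W \<subseteq> G ` dat ` W" using VG by auto
  then have finV: "finite (V ` W)" using finite_dat finite_subset by blast
  have inc: "V ks < V (ks @ [k])" if ks: "set ks \<subseteq> K" "k \<in> K" "Y ks w k > 0" for ks k
  proof -
    have Fd: "F (ks @ [k]) u w = F ks u w + Y ks w k * max 0 (- Y ks u k) / d k" for u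
      unfolding F_snoc using ks(3) by simp
    then have F1: "F ks u w \<le> F (ks @ [k]) u w" for u
      using ks(3) d_pos[of k] by simp
    have zero: "M ks k l = 0" if "l \<in> I" for l
      using isolated_iff[OF ks(1), of l] that ks(2) by (simp add: I_def)
    have Y1: "Y (ks @ [k]) w l = (if l = k then - Y ks w k else Y ks w l)" if "l \<in> I" for l
      unfolding Y_snoc ym_def using zero[OF that] by simp
    show ?thesis
    proof (cases "k \<in> I")
      case True
      have "(\<Sum>l\<in>I. Y (ks @ [k]) w l) < (\<Sum>l\<in>I. Y ks w l)"
        by (rule sum_strict_mono_ex1) (use True Y1 ks(3) in \<open>auto intro!: bexI[of _ k]\<close>)
      moreover have "(\<Sum>u\<in>U. F ks u w) \<le> (\<Sum>u\<in>U. F (ks @ [k]) u w)"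
        by (rule sum_mono) (rule F1)
      ultimately show ?thesis by (simp add: V_def)
    next
      case False
      have "(\<Sum>l\<in>I. Y (ks @ [k]) w l) = (\<Sum>l\<in>I. Y ks w l)"
        by (intro sum.cong refl) (use False Y1 in auto)
      moreover have "(\<Sum>u\<in>U. F ks u w) < (\<Sum>u\<in>U. F (ks @ [k]) u w)"
      proof (rule sum_strict_mono_ex1[OF U(1)])
        show "\<forall>u\<in>U. F ks u w \<le> F (ks @ [k]) u w" using F1 by blast
        have "\<not> (\<forall>i\<in>K. M ks i k = 0)"
          using isolated_iff[OF ks(1,2)] False ks(2) by (simp add: I_def)
        then obtain u where "u \<in> U" "Y ks u k < 0" using U(3)[OF ks(1,2)] by blast
        then show "\<exists>u\<in>U. F ks u w < F (ks @ [k]) u w"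
          using ks(3) d_pos[of k] Fd by (intro bexI[of _ u]) (auto simp: mult_pos_neg divide_neg_pos)
      qed
      ultimately show ?thesis by (simp add: V_def)
    qed
  qed
  \<comment> \<open>\<open>V\<close> takes finitely many values on words in \<open>K\<close> and
    increases, so the number of values above the current one decreases.\<close>
  define N where "N ks = card {v \<in> V ` W. V ks < v}" for ks
  have "N (ks @ [k]) < N ks" if ks: "set ks \<subseteq> K" "k \<in> K" "Y ks w k > 0" for ks k
    unfolding N_def
  proof (rule psubset_card_mono)
    show "finite {v \<in> V ` W. V ks < v}" using finV by simp
    have "V (ks @ [k]) \<in> {v \<in> V ` W. V ks < v}" using inc[OF ks] ks by auto
    then show "{v \<in> V ` W. V (ks @ [k]) < v} \<subset> {v \<in> V ` W. V ks < v}"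
      using inc[OF ks] by force
  qed
  then show thesis using that by blast
qed

end

section \<open>Sinks\<close>

definition relabels :: "('v \<Rightarrow> 'v) \<Rightarrow> ('v \<Rightarrow> 'v \<Rightarrow> real) \<Rightarrow> ('v \<Rightarrow> 'v \<Rightarrow> real) \<Rightarrow> bool" where
  "relabels \<pi> b b' \<longleftrightarrow> (\<forall>i l. b' (\<pi> i) (\<pi> l) = b i l)"

context
  fixes \<pi> :: "'v::finite \<Rightarrow> 'v"
  assumes invol: "\<And>i. \<pi> (\<pi> i) = i"
begin

lemma reindex_invol: "(\<Sum>i\<in>UNIV. f (\<pi> i)) = (\<Sum>i\<in>UNIV. f i)"
  by (rule sum.reindex_bij_witness[of _ \<pi> \<pi>]) (auto simp: invol)

lemma relabel_eq_iff: "\<pi> i = \<pi> l \<longleftrightarrow> i = l"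
  using invol by metis

lemma relabels_mm:
  assumes "relabels \<pi> b b'" shows "relabels \<pi> (mm k b) (mm (\<pi> k) b')"
  using assms by (simp add: relabels_def mm_def relabel_eq_iff)

lemma relabels_xm:
  assumes "relabels \<pi> b b'" "\<And>i. p' (\<pi> i) = p i"
  shows "xm (\<pi> k) b' p' (\<pi> i) = xm k b p i"
proof -
  have "(\<Sum>i\<in>UNIV. max 0 (b' i (\<pi> k)) * p' i) = (\<Sum>i\<in>UNIV. max 0 (b i k) * p i)"
    "(\<Sum>i\<in>UNIV. max 0 (- b' i (\<pi> k)) * p' i) = (\<Sum>i\<in>UNIV. max 0 (- b i k) * p i)"
    using assms
    by (subst reindex_invol[symmetric], simp add: relabels_def)+
  then show ?thesis
    using assms(2) by (simp add: xm_def relabel_eq_iff)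
qed

lemma relabels_yv:
  assumes "relabels \<pi> b b'" "\<And>i. p' (\<pi> i) = p i"
  shows "yv b' p' (\<pi> k) = yv b p k"
  unfolding yv_def
  by (subst reindex_invol[symmetric]) (use assms in \<open>simp add: relabels_def\<close>)

lemma relabels_Phi:
  assumes "relabels \<pi> b b'" "\<And>i. p' (\<pi> i) = p i" "\<And>i. q' (\<pi> i) = q i" "\<And>i. d (\<pi> i) = d i"
  shows "Phi d b' p' q' = Phi d b p q"
  unfolding Phi_def
  by (subst reindex_invol[symmetric]) (simp add: assms(2,4) relabels_yv[of b b' q' q, OF assms(1,3)])

lemma relabels_bw:
  assumes "relabels \<pi> b b'"
  shows "relabels \<pi> (bw b ks) (bw b' (map \<pi> ks))"
  using assms by (induction ks arbitrary: b b') (auto intro: relabels_mm)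

lemma relabels_xw:
  assumes "relabels \<pi> b b'" "\<And>i. p' (\<pi> i) = p i"
  shows "xw b' p' (map \<pi> ks) (\<pi> i) = xw b p ks i"
  using assms
proof (induction ks arbitrary: b b' p p')
  case (Cons k ks)
  show ?case
    unfolding list.map xw.simps
    by (rule Cons.IH[OF relabels_mm[OF Cons.prems(1)]]) (rule relabels_xm[of b b' p' p k, OF Cons.prems])
qed simp

lemma relabels_ym:
  assumes "relabels \<pi> b b'" "\<And>i. y' (\<pi> i) = y i"
  shows "ym (\<pi> k) b' y' (\<pi> i) = ym k b y i"
  using assms by (simp add: ym_def relabels_def relabel_eq_iff)

lemma relabels_flow:
  assumes "relabels \<pi> b b'" "\<And>i. y' (\<pi> i) = y i"
  shows "flow b' y' (map \<pi> ks) \<longleftrightarrow> flow b y ks"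
  using assms
proof (induction ks arbitrary: b b' y y')
  case (Cons k ks)
  have "flow (mm (\<pi> k) b') (ym (\<pi> k) b' y') (map \<pi> ks) \<longleftrightarrow> flow (mm k b) (ym k b y) ks"
    by (rule Cons.IH[OF relabels_mm[OF Cons.prems(1)]]) (rule relabels_ym[of b b' y' y k, OF Cons.prems])
  then show ?case using Cons.prems(2) by simp
qed simp

end

lemma flow_append: "flow b y (ks @ ls) \<longleftrightarrow> flow b y ks \<and> flow (bw b ks) (yw b y ks) ls"
  by (induction ks arbitrary: b y) auto

context trop_cluster
begin

text \<open>If the product were at most \<open>- 4\<close>, alternating mutations at
  \<open>j\<close> and \<open>k\<close>, begun with y-variables 1 and 0, would find a positive
  y-variable at every step, against \<open>terminating\<close>.\<close>

lemma rank2_bound: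
  assumes ks: "set ks \<subseteq> K" and jk: "j \<in> K" "k \<in> K" "j \<noteq> k" and pos: "M ks j k > 0"
  shows "M ks j k * M ks k j > - 4"
proof (rule ccontr)
  define B c where "B = M ks j k" and "c = - M ks k j"
  assume "\<not> M ks j k * M ks k j > - 4"
  then have Bc: "B * c \<ge> 4" by (simp add: B_def c_def)
  have B: "B > 0" using pos by (simp add: B_def)
  then have c: "c > 0" using Bc by (smt (verit) mult_nonneg_nonpos)
  have sBc: "sqrt B * sqrt c \<ge> 2"
    using Bc real_sqrt_le_mono[of 4 "B * c"] by (simp add: real_sqrt_mult)
  have sq: "sqrt B > 0" "sqrt c > 0" "sqrt B * sqrt B = B" "sqrt c * sqrt c = c" using B c by auto
  obtain w where w: "\<forall>l\<in>K. Y ks w l = (if l = j then 1 else 0)" using Y_onto[OF ks, of "\<lambda>l. if l = j then 1 else 0"] by blast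
  obtain N :: "'v list \<Rightarrow> nat" where
    N: "\<And>ks k. set ks \<subseteq> K \<Longrightarrow> k \<in> K \<Longrightarrow> Y ks w k > 0 \<Longrightarrow> N (ks @ [k]) < N ks"
    using terminating[of w] by metis
  \<comment> \<open>Scaled by \<open>sqrt B\<close> and \<open>sqrt c\<close>, the absolute values
    of the y-variables obey \<open>z' = r * z - z0\<close> with
    \<open>r = sqrt B * sqrt c \<ge> 2\<close>, where \<open>z0\<close> precedes \<open>z\<close>.
    The invariant says that this sequence does not decrease.\<close>
  define P where "P ls \<longleftrightarrow> set ls \<subseteq> K \<and> M ls j k = B \<and> M ls k j = - c \<and> Y ls w j > 0 \<and>
     sqrt B * Y ls w j \<ge> sqrt c * (- Y ls w k) \<and> Y ls w k \<le> 0" for ls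
  have P0: "P ks" using ks w jk sq by (auto simp: P_def B_def c_def)
  have step: "P (ls @ [j, k]) \<and> N (ls @ [j, k]) < N ls" if "P ls" for ls
  proof -
    define O' E where "O' = Y ls w j" and "E = - Y ls w k"
    have ls: "set ls \<subseteq> K" "M ls j k = B" "M ls k j = - c" "O' > 0" "sqrt B * O' \<ge> sqrt c * E" "E \<ge> 0"
      using that by (auto simp: P_def O'_def E_def)
    define E' where "E' = B * O' - E"
    have "sqrt c * E' = (sqrt B * sqrt c) * (sqrt B * O') - sqrt c * E"
      unfolding E'_def using sq by (metis (no_types, opaque_lifting) mult.commute mult.left_commute right_diff_distrib)
    moreover have "(sqrt B * sqrt c) * (sqrt B * O') \<ge> 2 * (sqrt B * O')"
      using sBc sq ls(4) by (intro mult_right_mono) auto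
    ultimately have E': "sqrt c * E' \<ge> sqrt B * O'" using ls(5) by linarith
    moreover have "sqrt B * O' > 0" using sq ls(4) by simp
    ultimately have E'pos: "E' > 0" using sq(2) by (smt (verit) mult_nonneg_nonpos)
    define O'' where "O'' = c * E' - O'"
    have "sqrt B * O'' = (sqrt B * sqrt c) * (sqrt c * E') - sqrt B * O'"
      unfolding O''_def using sq by (metis (no_types, opaque_lifting) mult.commute mult.left_commute right_diff_distrib)
    moreover have "(sqrt B * sqrt c) * (sqrt c * E') \<ge> 2 * (sqrt c * E')"
      using sBc sq E'pos by (intro mult_right_mono) auto
    ultimately have O'': "sqrt B * O'' \<ge> sqrt c * E'" using E' by linarith
    moreover have "sqrt c * E' > 0" using sq E'pos by simp
    ultimately have O''pos: "O'' > 0" using sq(1) by (smt (verit) mult_nonneg_nonpos)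
    have Y1: "Y (ls @ [j]) w k = E'" "Y (ls @ [j]) w j = - O'"
      unfolding Y_snoc ym_def using ls jk B by (auto simp: E'_def E_def O'_def)
    have M1: "M (ls @ [j]) k j = c" "M (ls @ [j]) j k = - B"
      unfolding M_snoc mm_def using ls by auto
    have Y2: "Y ((ls @ [j]) @ [k]) w k = - E'" "Y ((ls @ [j]) @ [k]) w j = O''"
      unfolding Y_snoc[of "ls @ [j]"] ym_def M1 Y1 using jk c E'pos by (auto simp: O''_def)
    have M2: "M ((ls @ [j]) @ [k]) k j = - c" "M ((ls @ [j]) @ [k]) j k = B"
      unfolding M_snoc[of "ls @ [j]"] mm_def M1 by auto
    have eq: "(ls @ [j]) @ [k] = ls @ [j, k]" by simp
    have "N (ls @ [j, k]) < N (ls @ [j])"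
      using N[of "ls @ [j]" k] ls(1) jk Y1(1) E'pos by simp
    also have "\<dots> < N ls" using N[of ls j] ls(1,4) jk by (simp add: O'_def)
    finally show ?thesis
      using Y2 M2 O'' O''pos E'pos ls(1) jk unfolding eq P_def by simp
  qed
  have "\<not> P ls" for ls
  proof (induction "N ls" arbitrary: ls rule: less_induct)
    case less
    then show ?case using step by blast
  qed
  then show False using P0 by blast
qed

lemma rank2_cases:
  assumes ks: "set ks \<subseteq> K" and jk: "j \<in> K" "k \<in> K" "j \<noteq> k" and pos: "M ks j k \<ge> 0"
  shows "(M ks j k, M ks k j) \<in> {(0, 0), (1, - 1), (1, - 2), (2, - 1), (1, - 3), (3, - 1)}"
proof (cases "M ks j k = 0")
  case True
  then show ?thesis using skew_sgn[OF sk_M d_pos, of ks k j] by simp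
next
  case False
  then have p: "M ks j k > 0" using pos by simp
  have n: "M ks k j < 0"
    unfolding skew_sgn[OF sk_M d_pos, of ks k j] using p d_pos[of j] d_pos[of k] by simp
  obtain x y where x: "M ks j k = of_int x" and y: "M ks k j = of_int y"
    using int_M[OF ks] jk by (metis Ints_cases)
  have "x * y > - 4" using rank2_bound[OF ks jk p] unfolding x y by (metis of_int_less_iff of_int_minus of_int_mult of_int_numeral)
  moreover have "x \<ge> 1" "y \<le> -1" using p n unfolding x y by auto
  moreover have "x \<le> 3"
  proof (rule ccontr)
    assume "\<not> x \<le> 3"
    then have "x * (- y) \<ge> 4 * 1" using \<open>y \<le> -1\<close> by (intro mult_mono) auto
    then show False using \<open>x * y > - 4\<close> by simp
  qed
  moreover have "- y \<le> 3"
  proof (rule ccontr)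
    assume "\<not> - y \<le> 3"
    then have "x * (- y) \<ge> 1 * 4" using \<open>x \<ge> 1\<close> by (intro mult_mono) auto
    then show False using \<open>x * y > - 4\<close> by simp
  qed
  ultimately have "x \<in> {1,2,3}" "y \<in> {-1,-2,-3}" "x * y > -4" by auto
  then show ?thesis unfolding x y by auto
qed

definition sink where "sink ks w \<longleftrightarrow> (\<forall>k\<in>K. Y ks w k \<le> 0)"

abbreviation "fl ks w ls \<equiv> set ls \<subseteq> K \<and> flow (M ks) (Y ks w) ls"

lemma Y_append: "Y (ks @ ls) w = yw (M ks) (Y ks w) ls"
  using yv_bw[OF sk_M d_pos, of ks ls "X ks w"] by (simp add: bw_append xw_append)

lemma fl_append: "fl ks w (ls @ ms) \<longleftrightarrow> fl ks w ls \<and> fl (ks @ ls) w ms"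
  using flow_append[of "M ks" "Y ks w" ls ms]
  unfolding Y_append[of ks ls w, symmetric] bw_append[of b ks ls, symmetric] by auto

lemma fl_Cons: "fl ks w (k # ls) \<longleftrightarrow> k \<in> K \<and> Y ks w k > 0 \<and> fl (ks @ [k]) w ls"
  using fl_append[of "[k]" ls ks w] by auto

lemma sink_exists:
  assumes "set ks \<subseteq> K"
  shows "\<exists>ls. fl ks w ls \<and> sink (ks @ ls) w"
proof -
  obtain N :: "'v list \<Rightarrow> nat" where
    N: "\<And>ks k. set ks \<subseteq> K \<Longrightarrow> k \<in> K \<Longrightarrow> Y ks w k > 0 \<Longrightarrow> N (ks @ [k]) < N ks"
    using terminating[of w] by metis
  show ?thesis using assms
  proof (induction "N ks" arbitrary: ks rule: less_induct)
    case less
    show ?case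
    proof (cases "sink ks w")
      case True
      then show ?thesis by (intro exI[of _ "[]"]) simp
    next
      case False
      then obtain k where k: "k \<in> K" "Y ks w k > 0" by (auto simp: sink_def not_le)
      obtain ls where "fl (ks @ [k]) w ls" "sink ((ks @ [k]) @ ls) w"
        using less.hyps[OF N[OF less.prems k]] less.prems k by auto
      then show ?thesis using k fl_Cons by (intro exI[of _ "k # ls"]) auto
    qed
  qed
qed

text \<open>Local confluence for Newman's lemma: the two mutation paths of the rank 2 subsystem meet in the same seed up to
  a relabelling of \<open>j\<close> and \<open>k\<close>.\<close>

lemma diamond:
  assumes ks: "set ks \<subseteq> K" and jk: "j \<in> K" "k \<in> K" "Y ks w j > 0" "Y ks w k > 0"
    and vj: "\<And>ls. fl (ks @ [j]) w ls \<Longrightarrow> sink (ks @ [j] @ ls) w \<Longrightarrow> F (ks @ [j] @ ls) u w = vj"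
    and vk: "\<And>ls. fl (ks @ [k]) w ls \<Longrightarrow> sink (ks @ [k] @ ls) w \<Longrightarrow> F (ks @ [k] @ ls) u w = vk"
    and pos: "M ks j k \<ge> 0"
  shows "vj = vk"
proof (cases "j = k")
  case True
  obtain ls where "fl (ks @ [j]) w ls" "sink ((ks @ [j]) @ ls) w"
    using sink_exists[of "ks @ [j]" w] ks jk by auto
  then show ?thesis using vj[of ls] vk[of ls] True by simp
next
  case False
  obtain A \<pi> where A: "set A \<subseteq> {j, k}"
    "\<And>i. \<pi> (\<pi> i) = i" "\<And>i. d (\<pi> i) = d i" "\<And>i. i \<notin> {j, k} \<Longrightarrow> \<pi> i = i" "\<pi> ` {j, k} = {j, k}"
    "\<And>i l. bw (M ks) (j # A) (\<pi> i) (\<pi> l) = bw (M ks) [k, j] i l"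
    "\<And>p i. xw (M ks) p (j # A) (\<pi> i) = xw (M ks) p [k, j] i"
    "\<And>Y. Y j > 0 \<Longrightarrow> Y k > 0 \<Longrightarrow> flow (M ks) Y (j # A) \<and> flow (M ks) Y [k, j]"
    using rank2_loop[OF False sk_M d_pos rank2_cases[OF ks jk(1,2) False pos]] by blast
  have \<pi>K: "\<pi> i \<in> K" if "i \<in> K" for i
  proof (cases "i \<in> {j, k}")
    case True
    then have "\<pi> i \<in> {j, k}" using A(5) by blast
    then show ?thesis using jk by auto
  qed (use A(4)[of i] that in auto)
  let ?a = "ks @ j # A" and ?c = "ks @ [k, j]"
  have flA: "fl ks w (j # A)" "fl ks w [k, j]" using A(1,8) jk by auto
  \<comment> \<open>The path through \<open>k\<close> is continued to a sink; its relabelled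
    continuation then serves for the path through \<open>j\<close>.\<close>
  obtain ms where ms: "fl ?c w ms" "sink (?c @ ms) w"
    using sink_exists[of ?c w] ks jk by auto
  have rel: "relabels \<pi> (M ?c) (M ?a)" "\<And>p i. X ?a p (\<pi> i) = X ?c p i"
    unfolding relabels_def bw_append[of b ks] xw_append[of b _ ks] using A(6) A(7) by metis+
  have relm: "relabels \<pi> (M (?c @ ms)) (M (?a @ map \<pi> ms))"
    using relabels_bw[of \<pi> "M ?c" "M ?a" ms, OF A(2) rel(1)] unfolding bw_append[of b ?a] bw_append[of b ?c] .
  have relx: "X (?a @ map \<pi> ms) p (\<pi> i) = X (?c @ ms) p i" for p i
    using relabels_xw[of \<pi> "M ?c" "M ?a" "X ?a p" "X ?c p" ms i, OF A(2) rel(1) rel(2)]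
    unfolding xw_append[of b p ?a] xw_append[of b p ?c] .
  have Yc: "Y ?a w (\<pi> i) = Y ?c w i" for i
    by (rule relabels_yv[of \<pi> "M ?c" "M ?a" "X ?a w" "X ?c w" i, OF A(2) rel(1) rel(2)])
  have "fl ?a w (map \<pi> ms)"
    using ms(1) relabels_flow[of \<pi> "M ?c" "M ?a" "Y ?a w" "Y ?c w" ms, OF A(2) rel(1) Yc] \<pi>K by auto
  moreover have Yms: "Y (?a @ map \<pi> ms) w (\<pi> i) = Y (?c @ ms) w i" for i
    by (rule relabels_yv[of \<pi> "M (?c @ ms)" "M (?a @ map \<pi> ms)" "X (?a @ map \<pi> ms) w" "X (?c @ ms) w" i,
          OF A(2) relm relx])
  have "sink (?a @ map \<pi> ms) w"
    unfolding sink_def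
  proof
    fix i assume "i \<in> K"
    then have "Y (?c @ ms) w (\<pi> i) \<le> 0" using ms(2) \<pi>K by (auto simp: sink_def)
    then show "Y (?a @ map \<pi> ms) w i \<le> 0" using Yms[of "\<pi> i"] A(2) by simp
  qed
  moreover have "F (?a @ map \<pi> ms) u w = F (?c @ ms) u w"
    by (rule relabels_Phi[of \<pi> "M (?c @ ms)" "M (?a @ map \<pi> ms)" "X (?a @ map \<pi> ms) u" "X (?c @ ms) u"
          "X (?a @ map \<pi> ms) w" "X (?c @ ms) w" d, OF A(2) relm relx relx A(3)])
  moreover have "F (?c @ ms) u w = vk"
    using vk[of "j # ms"] flA(2) ms fl_append[of "[k, j]" ms ks w] fl_Cons[of k "j # ms" ks w] by simp
  moreover have "F (?a @ map \<pi> ms) u w = vj" if "fl ?a w (map \<pi> ms)" "sink (?a @ map \<pi> ms) w"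
    using vj[of "A @ map \<pi> ms"] that flA(1) fl_append[of "j # A" "map \<pi> ms" ks w]
      fl_Cons[of j "A @ map \<pi> ms" ks w] by simp
  ultimately show ?thesis by simp
qed

text \<open>The confluence diagrams close only up to relabelling. So it is not the sink that is
  shown to be unique, but the value of \<open>Phi\<close> there, which does not see the
  relabelling.\<close>

lemma sink_value:
  assumes "set ks \<subseteq> K"
  shows "\<exists>v. \<forall>ls. fl ks w ls \<and> sink (ks @ ls) w \<longrightarrow> F (ks @ ls) u w = v"
proof -
  obtain N :: "'v list \<Rightarrow> nat" where
    N: "\<And>ks k. set ks \<subseteq> K \<Longrightarrow> k \<in> K \<Longrightarrow> Y ks w k > 0 \<Longrightarrow> N (ks @ [k]) < N ks"
    using terminating[of w] by metis
  show ?thesis using assms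
  proof (induction "N ks" arbitrary: ks rule: less_induct)
    case less
    have IH: "\<exists>v. \<forall>ls. fl (ks @ [k]) w ls \<and> sink (ks @ [k] @ ls) w \<longrightarrow> F (ks @ [k] @ ls) u w = v"
      if "k \<in> K" "Y ks w k > 0" for k
    proof -
      have "set (ks @ [k]) \<subseteq> K" using less.prems that by simp
      from less.hyps[OF N[OF less.prems that] this] show ?thesis unfolding append_assoc .
    qed
    show ?case
    proof (cases "sink ks w")
      case True
      have "ls = []" if ls: "fl ks w ls" for ls
      proof (cases ls)
        case (Cons k ms)
        then have "fl ks w (k # ms)" using ls by blast
        then have "k \<in> K" "Y ks w k > 0" unfolding fl_Cons by blast+
        then show ?thesis using True unfolding sink_def by force
      qed
      then have "F (ks @ ls) u w = F ks u w" if "fl ks w ls \<and> sink (ks @ ls) w" for ls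
        using that by (metis append_Nil2)
      then show ?thesis by (intro exI[of _ "F ks u w"] allI impI)
    next
      case False
      then obtain k where k: "k \<in> K" "Y ks w k > 0" by (auto simp: sink_def not_le)
      obtain vk where vk: "\<And>ls. fl (ks @ [k]) w ls \<Longrightarrow> sink (ks @ [k] @ ls) w \<Longrightarrow> F (ks @ [k] @ ls) u w = vk"
        using IH[OF k] by blast
      have all: "F (ks @ ls) u w = vk" if ls: "fl ks w ls" "sink (ks @ ls) w" for ls
      proof (cases ls)
        case Nil
        then have "sink ks w" using ls(2) by (simp only: append_Nil2)
        then show ?thesis using False by blast
      next
        case (Cons j ms)
        then have "fl ks w (j # ms)" using ls(1) by blast
        then have j: "j \<in> K" "Y ks w j > 0" "fl (ks @ [j]) w ms" unfolding fl_Cons by blast+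
        obtain vj where vj0: "\<forall>ls. fl (ks @ [j]) w ls \<and> sink (ks @ [j] @ ls) w \<longrightarrow> F (ks @ [j] @ ls) u w = vj"
          using IH[OF j(1,2)] by (rule exE)
        have vj: "F (ks @ [j] @ ls) u w = vj" if "fl (ks @ [j]) w ls" "sink (ks @ [j] @ ls) w" for ls
          by (rule vj0[rule_format, OF conjI[OF that]])
        have "vj = vk"
        proof (cases "M ks j k \<ge> 0")
          case True
          show ?thesis by (rule diamond[OF less.prems j(1) k(1) j(2) k(2) vj vk True])
        next
          case False
          then have pos: "M ks k j \<ge> 0"
            unfolding skew_sgn[OF sk_M d_pos, of ks k j] using False d_pos[of j] d_pos[of k] by (simp add: mult_nonneg_nonpos divide_nonpos_pos)
          show ?thesis by (rule diamond[OF less.prems k(1) j(1) k(2) j(2) vk vj pos, symmetric])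
        qed
        moreover have eq: "ks @ ls = ks @ [j] @ ms" using Cons by simp
        ultimately show ?thesis using vj[OF j(3)] ls(2) unfolding eq by blast
      qed
      show ?thesis by (intro exI[of _ vk] allI impI) (erule conjE, rule all)
    qed
  qed
qed

section \<open>Generic points: independence of the starting seed\<close>

definition generic where "generic w \<longleftrightarrow> (\<forall>ks k. set ks \<subseteq> K \<longrightarrow> k \<in> K \<longrightarrow> Y ks w k \<noteq> 0)"

lemma X_twice: "M (ks @ [k, k]) = M ks" "X (ks @ [k, k]) w = X ks w"
proof -
  have "M ((ks @ [k]) @ [k]) = M ks" unfolding M_snoc by (rule mm_mm[of "M ks" k, OF diag_M])
  then show "M (ks @ [k, k]) = M ks" by simp
  have "X ((ks @ [k]) @ [k]) w = X ks w"
    unfolding X_snoc M_snoc by (rule xm_mm[of "M ks" k, OF diag_M])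
  then show "X (ks @ [k, k]) w = X ks w" by simp
qed

text \<open>For generic \<open>w\<close> every mutation runs along the flow in one of its two
  directions, so moving the starting seed by one step never changes the value at the sinks.\<close>

lemma global_sink_value:
  assumes "generic w"
  shows "\<exists>v. \<forall>ks ls. set ks \<subseteq> K \<and> fl ks w ls \<and> sink (ks @ ls) w \<longrightarrow> F (ks @ ls) u w = v"
proof -
  obtain v where v: "\<And>ls. fl [] w ls \<Longrightarrow> sink ls w \<Longrightarrow> F ls u w = v"
    using sink_value[of "[]" w u] by auto
  have all: "F (ks @ ls) u w = v" if "set ks \<subseteq> K" "fl ks w ls" "sink (ks @ ls) w" for ks ls
    using that
  proof (induction ks arbitrary: ls rule: rev_induct)
    case Nil
    then show ?case using v by simp
  next
    case (snoc k ks)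
    have k: "k \<in> K" "set ks \<subseteq> K" using snoc.prems by auto
    then have "Y ks w k \<noteq> 0" using assms by (simp add: generic_def)
    then consider "Y ks w k > 0" | "Y ks w k < 0" by linarith
    then show ?case
    proof cases
      case 1
      have f: "fl ks w (k # ls)" unfolding fl_Cons using 1 k snoc.prems(2) by blast
      have eq: "(ks @ [k]) @ ls = ks @ k # ls" by simp
      show ?thesis unfolding eq by (rule snoc.IH[OF k(2) f snoc.prems(3)[unfolded eq]])
    next
      case 2
      \<comment> \<open>Here the last mutation runs against the flow. Mutating back at
        \<open>k\<close> is a flow step from the new seed to a copy of the old one, so a flow from
        the old seed extends to one from the new seed.\<close>
      have pos: "Y (ks @ [k]) w k > 0" using 2 unfolding Y_snoc ym_def by simp
      obtain ms where ms: "fl ks w ms" "sink (ks @ ms) w" using sink_exists[OF k(2)] by blast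
      have eq: "(ks @ [k]) @ k # ms = (ks @ [k, k]) @ ms" by simp
      have tw: "M ((ks @ [k, k]) @ ms) = M (ks @ ms)" "X ((ks @ [k, k]) @ ms) p = X (ks @ ms) p" for p
        unfolding bw_append[of _ "ks @ [k, k]"] xw_append[of _ _ "ks @ [k, k]"] X_twice
        unfolding bw_append xw_append by (rule refl)+
      have k2: "(ks @ [k]) @ [k] = ks @ [k, k]" by simp
      have f: "fl (ks @ [k]) w (k # ms)"
        unfolding fl_Cons k2 X_twice using ms(1) k(1) pos by blast
      have s: "sink ((ks @ [k]) @ k # ms) w"
        using ms(2) unfolding sink_def eq tw .
      have val: "F ((ks @ [k]) @ k # ms) u w = v"
        unfolding eq tw by (rule snoc.IH[OF k(2) ms])
      obtain v' where v': "\<forall>ls. fl (ks @ [k]) w ls \<and> sink ((ks @ [k]) @ ls) w \<longrightarrow> F ((ks @ [k]) @ ls) u w = v'"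
        using sink_value[OF snoc.prems(1), of w u] by (rule exE)
      have "F ((ks @ [k]) @ ls) u w = v'"
        by (rule v'[rule_format, OF conjI[OF snoc.prems(2,3)]])
      also have "v' = F ((ks @ [k]) @ k # ms) u w"
        by (rule v'[rule_format, OF conjI[OF f s], symmetric])
      also have "\<dots> = v" by (rule val)
      finally show ?thesis .
    qed
  qed
  show ?thesis
  proof (intro exI[of _ v] allI impI)
    fix ks ls assume "set ks \<subseteq> K \<and> fl ks w ls \<and> sink (ks @ ls) w"
    then show "F (ks @ ls) u w = v" using all by blast
  qed
qed

lemma F_mono: "fl ks w ls \<Longrightarrow> F ks u w \<le> F (ks @ ls) u w"
proof (induction ls arbitrary: ks)
  case (Cons k ls)
  then have k: "Y ks w k > 0" "fl (ks @ [k]) w ls" using fl_Cons by auto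
  have "F ks u w \<le> F (ks @ [k]) u w" unfolding F_snoc using k d_pos[of k] by simp
  also have "\<dots> \<le> F ((ks @ [k]) @ ls) u w" by (rule Cons.IH[OF k(2)])
  finally show ?case by simp
qed simp

lemma sink_max_generic:
  assumes "generic w" "set ks \<subseteq> K" "sink ks w" "set ls \<subseteq> K"
  shows "F ls u w \<le> F ks u w"
proof -
  obtain v where v: "\<And>ks ls. set ks \<subseteq> K \<Longrightarrow> fl ks w ls \<Longrightarrow> sink (ks @ ls) w \<Longrightarrow> F (ks @ ls) u w = v"
    using global_sink_value[OF assms(1)] by metis
  obtain ms where ms: "fl ls w ms" "sink (ls @ ms) w" using sink_exists[OF assms(4)] by blast
  have "F ls u w \<le> F (ls @ ms) u w" by (rule F_mono[OF ms(1)])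
  also have "\<dots> = F ks u w" using v[OF assms(4) ms] v[of ks "[]"] assms by simp
  finally show ?thesis .
qed

end

section \<open>Sign coherence and duality\<close>

lemma continuous_coord: "continuous_on UNIV (\<lambda>p :: 'v \<Rightarrow> real. p i)"
  by (rule continuous_on_product_coordinates)

lemma continuous_xm: "continuous_on UNIV (xm k b)"
proof (rule continuous_on_coordinatewise_then_product)
  fix i
  show "continuous_on UNIV (\<lambda>p. xm k b p i)"
    unfolding xm_def fun_upd_def
    by (cases "i = k") (auto intro!: continuous_intros continuous_coord)
qed

lemma continuous_xw: "continuous_on UNIV (\<lambda>p. xw b p ks)"
proof (induction ks arbitrary: b)
  case Nil
  then show ?case by (simp add: continuous_on_id)
next
  case (Cons k ks)
  then show ?case
    using continuous_on_compose2[OF Cons.IH continuous_xm, of k b "mm k b"] by simp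
qed

lemma continuous_xw_coord: "continuous_on UNIV (\<lambda>p. xw b p ks i)"
  using continuous_on_compose2[OF continuous_coord continuous_xw] by simp

context trop_cluster
begin

lemma continuous_Y: "continuous_on UNIV (\<lambda>w. Y ks w k)"
  unfolding yv_def by (intro continuous_intros continuous_xw_coord)

lemma continuous_F: "continuous_on UNIV (\<lambda>w. F ks u w)"
  unfolding Phi_def divide_inverse by (intro continuous_intros continuous_Y)

lemma continuous_line: "continuous_on UNIV (\<lambda>t :: real. (\<lambda>i. z i + t * z0 i) :: 'v \<Rightarrow> real)"
  by (rule continuous_on_coordinatewise_then_product) (intro continuous_intros)

lemma yv_line: "yv c (\<lambda>i. z i + t * z0 i) k = yv c z k + t * yv c z0 k"
  by (simp add: yv_def distrib_left sum.distrib sum_distrib_left mult_ac)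

text \<open>The displacement is linear in the chart of \<open>ks\<close>, where
  \<open>yv_line\<close> controls the y-variables, and not in the initial coordinates.\<close>

lemma perturb:
  assumes "open S" "w \<in> S"
  shows "\<exists>e>0. \<forall>t. 0 \<le> t \<longrightarrow> t < e \<longrightarrow> xw (M ks) (\<lambda>i. X ks w i + t * z0 i) (rev ks) \<in> S"
proof -
  define f where "f t = xw (M ks) (\<lambda>i. X ks w i + t * z0 i) (rev ks)" for t
  have "continuous_on UNIV f"
    unfolding f_def by (rule continuous_on_compose2[OF continuous_xw continuous_line]) auto
  then have "open (f -` S)" using assms(1) by (simp add: open_vimage)
  moreover have "f 0 = w" unfolding f_def using xw_rev[OF sk d_pos] by simp
  ultimately have "\<exists>e>0. \<forall>t. dist t 0 < e \<longrightarrow> t \<in> f -` S"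
    using assms(2) unfolding open_dist by blast
  then obtain e where "e > 0" "\<And>t. \<bar>t\<bar> < e \<Longrightarrow> f t \<in> S" by (auto simp: dist_real_def)
  then show ?thesis unfolding f_def by (intro exI[of _ e]) simp
qed

lemma Y_perturb: "Y ks (xw (M ks) z (rev ks)) k = yv (M ks) z k"
  using xw_rev'[OF sk d_pos] by simp

lemma nonzero_dense:
  assumes "open S" "S \<noteq> {}" "set ks \<subseteq> K" "k \<in> K"
  shows "\<exists>w\<in>S. Y ks w k \<noteq> 0"
proof -
  from assms(2) obtain w where w: "w \<in> S" by blast
  show ?thesis
  proof (cases "Y ks w k = 0")
    case False
    then show ?thesis using w by blast
  next
    case True
    obtain p where p: "\<forall>k\<in>K. Y ks p k = 1" using Y_onto[OF assms(3), of "\<lambda>_. 1"] by blast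
    obtain e where e: "e > 0" "\<forall>t. 0 \<le> t \<longrightarrow> t < e \<longrightarrow> xw (M ks) (\<lambda>i. X ks w i + t * X ks p i) (rev ks) \<in> S"
      using perturb[OF assms(1) w, of ks "X ks p"] by blast
    have "Y ks (xw (M ks) (\<lambda>i. X ks w i + (e/2) * X ks p i) (rev ks)) k = e / 2"
      unfolding Y_perturb yv_line using True p assms(4) by simp
    then show ?thesis using e(1) e(2)[rule_format, of "e / 2"] by (intro bexI[of _ "xw (M ks) (\<lambda>i. X ks w i + (e/2) * X ks p i) (rev ks)"]) auto
  qed
qed

lemma finite_Y: "finite {(\<lambda>w. Y ks w k) | ks k. set ks \<subseteq> K \<and> k \<in> K}"
proof -
  have "{(\<lambda>w. Y ks w k) | ks k. set ks \<subseteq> K \<and> k \<in> K}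
      \<subseteq> (\<lambda>(D, k) w. \<Sum>i\<in>UNIV. fst D i k * snd D w i) ` (dat ` W \<times> K)"
  proof (rule subsetI, elim CollectE exE conjE)
    fix f ks k assume "f = (\<lambda>w. Y ks w k)" "set ks \<subseteq> K" "k \<in> K"
    then show "f \<in> (\<lambda>(D, k) w. \<Sum>i\<in>UNIV. fst D i k * snd D w i) ` (dat ` W \<times> K)"
      by (intro image_eqI[of _ _ "(dat ks, k)"]) (auto simp: Y_dat)
  qed
  moreover have "finite ((\<lambda>(D, k) w. \<Sum>i\<in>UNIV. fst D i k * snd D w i) ` (dat ` W \<times> K))"
    by (intro finite_imageI finite_cartesian_product finite_dat finite)
  ultimately show ?thesis using finite_subset by blast
qed

text \<open>The y-variables are finitely many functions by \<open>finite_Y\<close>, and each is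
  nonzero on an open dense set.\<close>

lemma generic_dense:
  assumes "open S" "S \<noteq> {}"
  shows "\<exists>w\<in>S. generic w"
proof -
  have "\<exists>w\<in>S. \<forall>f\<in>\<F>. f w \<noteq> 0" if "finite \<F>" "\<F> \<subseteq> {(\<lambda>w. Y ks w k) | ks k. set ks \<subseteq> K \<and> k \<in> K}" for \<F>
    using that assms
  proof (induction \<F> arbitrary: S rule: finite_induct)
    case empty
    then show ?case by auto
  next
    case (insert f \<F>)
    from insert.prems(1) obtain ks k where f: "f = (\<lambda>w. Y ks w k)" "set ks \<subseteq> K" "k \<in> K" by blast
    have "open (S \<inter> {w. f w \<noteq> 0})"
      unfolding f(1) by (intro open_Int insert.prems open_Collect_neq continuous_Y continuous_intros)
    moreover have "S \<inter> {w. f w \<noteq> 0} \<noteq> {}"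
      using nonzero_dense[OF insert.prems(2,3) f(2,3)] f(1) by auto
    ultimately obtain w where "w \<in> S \<inter> {w. f w \<noteq> 0}" "\<forall>g\<in>\<F>. g w \<noteq> 0"
      using insert.IH[of "S \<inter> {w. f w \<noteq> 0}"] insert.prems(1) by auto
    then show ?case by auto
  qed
  from this[OF finite_Y subset_refl] obtain w where
    w: "w \<in> S" "\<forall>f\<in>{(\<lambda>w. Y ks w k) | ks k. set ks \<subseteq> K \<and> k \<in> K}. f w \<noteq> 0"
    by (rule bexE)
  have "generic w"
    unfolding generic_def
  proof (intro allI impI)
    fix ks k assume "set ks \<subseteq> K" "k \<in> K"
    then have "(\<lambda>w. Y ks w k) \<in> {(\<lambda>w. Y ks w k) | ks k. set ks \<subseteq> K \<and> k \<in> K}" by blast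
    from bspec[OF w(2) this] show "Y ks w k \<noteq> 0" .
  qed
  then show ?thesis using w(1) by blast
qed

text \<open>A violation of the inequality is an open condition on \<open>w\<close>. Pushing
  \<open>w\<close> into the interior of the cone of \<open>ks\<close> keeps the violation and makes
  the sink property stable as well, so that a generic point nearby contradicts
  \<open>sink_max_generic\<close>.\<close>

theorem sink_max:
  assumes ks: "set ks \<subseteq> K" and s: "sink ks w" and ls: "set ls \<subseteq> K"
  shows "F ls u w \<le> F ks u w"
proof (rule ccontr)
  assume "\<not> F ls u w \<le> F ks u w"
  then have w: "w \<in> {w. F ks u w < F ls u w}" by simp
  have op: "open {w. F ks u w < F ls u w}" by (intro open_Collect_less continuous_F)
  obtain p where p: "\<forall>k\<in>K. Y ks p k = - 1" using Y_onto[OF ks, of "\<lambda>_. - 1"] by blast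
  obtain e where e: "e > 0" "\<forall>t. 0 \<le> t \<longrightarrow> t < e \<longrightarrow>
      xw (M ks) (\<lambda>i. X ks w i + t * X ks p i) (rev ks) \<in> {w. F ks u w < F ls u w}"
    using perturb[OF op w, of ks "X ks p"] by blast
  define w' where "w' = xw (M ks) (\<lambda>i. X ks w i + (e/2) * X ks p i) (rev ks)"
  have "Y ks w' k < 0" if "k \<in> K" for k
    unfolding w'_def Y_perturb yv_line using s p that e(1) by (auto simp: sink_def intro: add_nonpos_neg)
  moreover define S where "S = {w. F ks u w < F ls u w} \<inter> (\<Inter>k\<in>K. {w. Y ks w k < 0})"
  moreover have "w' \<in> {w. F ks u w < F ls u w}"
    unfolding w'_def using e(1) by (intro e(2)[rule_format]) auto
  ultimately have "w' \<in> S" unfolding S_def by blast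
  then have "S \<noteq> {}" by blast
  moreover have "open S"
    unfolding S_def by (intro open_Int op open_INT ballI open_Collect_less continuous_Y continuous_on_const) simp
  ultimately have "\<exists>v\<in>S. generic v" by (intro generic_dense)
  then obtain v where v: "v \<in> S" "generic v" by (rule bexE)
  have "sink ks v" unfolding sink_def
  proof
    fix k assume "k \<in> K"
    then have "v \<in> {w. Y ks w k < 0}" using v(1) unfolding S_def by blast
    then show "Y ks v k \<le> 0" by simp
  qed
  from sink_max_generic[OF v(2) ks this ls, of u] have "F ls u v \<le> F ks u v" .
  moreover have "v \<in> {w. F ks u w < F ls u w}" using v(1) unfolding S_def by (rule IntD1)
  ultimately show False by simp
qed

text \<open>Maximality for \<open>w\<close> and, by skew-symmetry, for \<open>u\<close> squeeze
  \<open>Phi\<close> to a constant over all seeds; opposite signs at \<open>k\<close> would make it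
  jump under mutation at \<open>k\<close>.\<close>

theorem sign_coherence:
  assumes "sink [] u" "sink [] w" "set ls \<subseteq> K" "k \<in> K" "Y ls u k > 0"
  shows "Y ls w k \<ge> 0"
proof (rule ccontr)
  assume neg: "\<not> Y ls w k \<ge> 0"
  have const: "F ms u w = F [] u w" if "set ms \<subseteq> K" for ms
  proof (rule antisym)
    show "F ms u w \<le> F [] u w" using sink_max[of "[]" w ms u] assms(2) that by simp
    have "F ms w u \<le> F [] w u" using sink_max[of "[]" u ms w] assms(1) that by simp
    then show "F [] u w \<le> F ms u w"
      using Phi_skew[OF sk_M d_pos, of ms "X ms w" "X ms u"] Phi_skew[OF sk_M d_pos, of "[]" "X [] w" "X [] u"] by simp
  qed
  have "F (ls @ [k]) u w < F ls u w"
    unfolding F_snoc using neg assms(5) d_pos[of k] by (simp add: mult_neg_pos divide_neg_pos)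
  then show False using const[of "ls @ [k]"] const[of ls] assms(3,4) by simp
qed

end

section \<open>The opposite matrix and duality\<close>

lemma mm_uminus: "mm k (\<lambda>i j. - b i j) = (\<lambda>i j. - mm k b i j)"
  by (intro ext) (auto simp: mm_def sgn_minus)

lemma xm_uminus: "xm k (\<lambda>i j. - b i j) = xm k b"
  by (intro ext) (simp add: xm_def min.commute)

lemma bw_uminus: "bw (\<lambda>i j. - b i j) ks = (\<lambda>i j. - bw b ks i j)"
  by (induction ks arbitrary: b) (simp_all add: mm_uminus)

lemma xw_uminus: "xw (\<lambda>i j. - b i j) p ks = xw b p ks"
  by (induction ks arbitrary: b p) (simp_all add: mm_uminus xm_uminus)

lemma yv_uminus: "yv (\<lambda>i j. - b i j) p k = - yv b p k"
  by (simp add: yv_def sum_negf)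

lemma Phi_uminus: "Phi d (\<lambda>i j. - b i j) p q = - Phi d b p q"
  by (simp add: Phi_def yv_uminus sum_negf)

context trop_cluster
begin

text \<open>Negating \<open>b\<close> leaves the mutation of points unchanged and negates
  y-variables and \<open>Phi\<close>. Nonnegative y-variables thus become a sink, and
  \<open>sink_max\<close> becomes available for them.\<close>

lemma opposite: "trop_cluster d K (\<lambda>i j. - b i j)"
proof
  show "skew d (\<lambda>i j. - b i j)" using sk unfolding skew_def by (metis mult_minus_right)
  show "surj_on_K K (\<lambda>i j. - b i j)"
    unfolding surj_on_K_def yv_uminus
  proof
    fix t
    obtain p where "\<forall>k\<in>K. yv b p k = - t k" using onto[unfolded surj_on_K_def, rule_format, of "\<lambda>k. - t k"] by blast
    then show "\<exists>p. \<forall>k\<in>K. - yv b p k = t k" by (intro exI[of _ p]) simp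
  qed
  show "finite ((\<lambda>ks p. xw (\<lambda>i j. - b i j) p ks) ` W)" unfolding xw_uminus by (rule fin)
qed (auto simp: d_pos int)

text \<open>Two instances of \<open>sink_max\<close> give the two inequalities: for \<open>w\<close>
  at \<open>ks\<close>, and for \<open>u\<close> at the initial seed of the opposite matrix.\<close>

theorem duality:
  assumes u: "\<And>k. k \<in> K \<Longrightarrow> Y [] u k \<ge> 0" and w: "sink ks w" and ks: "set ks \<subseteq> K"
  shows "F ks u w = F [] u w"
proof (rule antisym)
  show "F [] u w \<le> F ks u w" using sink_max[OF ks w, of "[]" u] by simp
  interpret op: trop_cluster d K "\<lambda>i j. - b i j" by (rule opposite)
  have "op.sink [] u" unfolding op.sink_def using u by (simp add: yv_uminus)
  then have "op.F ks w u \<le> op.F [] w u" using op.sink_max[of "[]" u ks w] ks by simp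
  then show "F ks u w \<le> F [] u w"
    unfolding bw_uminus xw_uminus Phi_uminus
    using Phi_skew[OF sk_M d_pos, of ks "X ks w" "X ks u"] Phi_skew[OF sk_M d_pos, of "[]" "X [] w" "X [] u"] by simp
qed

theorem sign_coherence_pos:
  assumes "\<And>k. k \<in> K \<Longrightarrow> Y [] u k \<ge> 0" "\<And>k. k \<in> K \<Longrightarrow> Y [] w k \<ge> 0" "set ls \<subseteq> K" "k \<in> K" "Y ls u k > 0"
  shows "Y ls w k \<ge> 0"
proof (rule ccontr)
  assume neg: "\<not> Y ls w k \<ge> 0"
  interpret op: trop_cluster d K "\<lambda>i j. - b i j" by (rule opposite)
  have "op.sink [] u" "op.sink [] w" unfolding op.sink_def using assms by (simp_all add: yv_uminus)
  moreover have "op.Y ls w k > 0" using neg by (simp add: bw_uminus xw_uminus yv_uminus)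
  ultimately have "op.Y ls u k \<ge> 0" using op.sign_coherence[of w u ls k] assms(3,4) by blast
  then show False using assms(5) by (simp add: bw_uminus xw_uminus yv_uminus)
qed

end

section \<open>Positive Puiseux series\<close>

definition fls_real :: "complex fls \<Rightarrow> bool" where
  "fls_real f \<longleftrightarrow> (\<forall>k. fls_nth f k \<in> \<real>)"

definition fls_pos :: "complex fls \<Rightarrow> bool" where
  "fls_pos f \<longleftrightarrow> fls_real f \<and> f \<noteq> 0 \<and> Re (fls_nth f (fls_subdegree f)) > 0"

lemma fls_real_add: "fls_real f \<Longrightarrow> fls_real g \<Longrightarrow> fls_real (f + g)"
  by (simp add: fls_real_def)

lemma fls_real_mult: "fls_real f \<Longrightarrow> fls_real g \<Longrightarrow> fls_real (f * g)"
  unfolding fls_real_def by (simp add: fls_times_nth(1))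

lemma fls_nth_mult_subdegree:
  fixes f g :: "'a::idom fls"
  shows "fls_nth (f * g) (fls_subdegree f + fls_subdegree g)
    = fls_nth f (fls_subdegree f) * fls_nth g (fls_subdegree g)"
  by (simp add: fls_times_nth(2))

lemma fls_pos_mult:
  assumes "fls_pos f" "fls_pos g"
  shows "fls_pos (f * g)" "fls_subdegree (f * g) = fls_subdegree f + fls_subdegree g"
proof -
  show d: "fls_subdegree (f * g) = fls_subdegree f + fls_subdegree g"
    using assms by (simp add: fls_pos_def)
  have "Im (fls_nth f (fls_subdegree f)) = 0" "Im (fls_nth g (fls_subdegree g)) = 0"
    using assms by (auto simp: fls_pos_def fls_real_def complex_is_Real_iff)
  then show "fls_pos (f * g)"
    using assms fls_real_mult unfolding fls_pos_def d fls_nth_mult_subdegree by auto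
qed

text \<open>Both leading coefficients are positive, so they cannot cancel.\<close>

lemma fls_pos_add:
  assumes "fls_pos f" "fls_pos g"
  shows "fls_pos (f + g)" "fls_subdegree (f + g) = min (fls_subdegree f) (fls_subdegree g)"
proof -
  let ?m = "min (fls_subdegree f) (fls_subdegree g)"
  have nz: "Re (fls_nth (f + g) ?m) > 0"
  proof -
    consider "fls_subdegree f < fls_subdegree g" | "fls_subdegree g < fls_subdegree f"
      | "fls_subdegree f = fls_subdegree g" by linarith
    then show ?thesis using assms by cases (auto simp: fls_pos_def)
  qed
  show d: "fls_subdegree (f + g) = ?m"
  proof (rule fls_subdegree_eqI)
    show "fls_nth (f + g) ?m \<noteq> 0" using nz by (metis less_irrefl zero_complex.sel(1))
  qed auto
  have "f + g \<noteq> 0" using nz by (metis less_irrefl zero_complex.sel(1) fls_zero_nth)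
  then show "fls_pos (f + g)"
    using assms fls_real_add nz unfolding fls_pos_def d by auto
qed

text \<open>Split \<open>g\<close> into its coefficientwise real part \<open>k\<close> and imaginary
  part \<open>h\<close>. Then \<open>f * h\<close> is the imaginary part of the real series
  \<open>f * g\<close>, hence 0. This makes quotients of positive series real.\<close>

lemma fls_real_cancel:
  assumes "fls_real f" "f \<noteq> 0" "fls_real (f * g)"
  shows "fls_real g"
proof -
  define h where "h = Abs_fls (\<lambda>n. complex_of_real (Im (fls_nth g n)))"
  define k where "k = Abs_fls (\<lambda>n. complex_of_real (Re (fls_nth g n)))"
  have h: "fls_nth h n = complex_of_real (Im (fls_nth g n))"
    and k: "fls_nth k n = complex_of_real (Re (fls_nth g n))" for n
    unfolding h_def k_def
    by (rule nth_Abs_fls_lower_bound[of "fls_subdegree g"], simp)+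
  have g: "g = k + fls_const \<i> * h"
    by (rule fls_eqI) (simp add: h k complex_eq_iff)
  have "f * h = 0"
  proof (rule fls_eqI)
    fix n
    have r: "fls_real (f * h)" "fls_real (f * k)"
      by (rule fls_real_mult[OF assms(1)], simp add: fls_real_def h k)+
    have "f * g = f * k + fls_const \<i> * (f * h)" unfolding g by (simp add: algebra_simps)
    then have "fls_nth (f * g) n = fls_nth (f * k) n + \<i> * fls_nth (f * h) n" by simp
    then have "Im (fls_nth (f * g) n) = Im (fls_nth (f * k) n) + Re (fls_nth (f * h) n)" by simp
    then have "Re (fls_nth (f * h) n) = 0"
      using r(2) assms(3) by (simp add: fls_real_def complex_is_Real_iff)
    then show "fls_nth (f * h) n = fls_nth 0 n"
      using r(1) by (simp add: fls_real_def complex_is_Real_iff complex_eq_iff)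
  qed
  then have "h = 0" using assms(2) by simp
  then have "Im (fls_nth g n) = 0" for n using h[of n] by simp
  then show ?thesis by (simp add: fls_real_def complex_is_Real_iff)
qed

lemma pos_puiseux_of:
  assumes "e > 0"
  shows "puiseux_of e f \<in> pos_puiseux \<longleftrightarrow> fls_pos f"
proof -
  have "puiseux_of e f = 0 \<longleftrightarrow> f = 0"
    using puiseux_of_eq_iff[OF assms assms, of f 0] puiseux_of_0[OF assms]
    by (metis assms fls_compose_power_inject)
  then show ?thesis
    unfolding pos_puiseux_def fls_pos_def fls_real_def
    using puiseux_of_real_iff[OF assms, of f] puiseux_lead_of[OF assms, of f] by simp
qed

lemma pos_puiseux_add:
  assumes "x \<in> pos_puiseux" "y \<in> pos_puiseux"
  shows "x + y \<in> pos_puiseux \<and> puiseux_val (x + y) = min (puiseux_val x) (puiseux_val y)"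
proof -
  obtain e f g where e: "e > 0" and x: "x = puiseux_of e f" and y: "y = puiseux_of e g"
    by (rule puiseux_common_denominator[of x y 0])
  have p: "fls_pos f" "fls_pos g" using assms pos_puiseux_of[OF e] x y by auto
  show ?thesis
    unfolding x y puiseux_of_add[OF e, symmetric] pos_puiseux_of[OF e] puiseux_val_of[OF e]
    using fls_pos_add[OF p] e by (auto simp: min_def divide_le_cancel)
qed

lemma pos_puiseux_mult:
  assumes "x \<in> pos_puiseux" "y \<in> pos_puiseux"
  shows "x * y \<in> pos_puiseux \<and> puiseux_val (x * y) = puiseux_val x + puiseux_val y"
proof -
  obtain e f g where e: "e > 0" and x: "x = puiseux_of e f" and y: "y = puiseux_of e g"
    by (rule puiseux_common_denominator[of x y 0])
  have p: "fls_pos f" "fls_pos g" using assms pos_puiseux_of[OF e] x y by auto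
  show ?thesis
    unfolding x y puiseux_of_mult[OF e, symmetric] pos_puiseux_of[OF e] puiseux_val_of[OF e]
    using fls_pos_mult[OF p] by (auto simp: add_divide_distrib)
qed

lemma pos_puiseux_1: "1 \<in> pos_puiseux" "puiseux_val (1 :: complex puiseux) = 0"
proof -
  have e: "puiseux_of 1 1 = (1 :: complex puiseux)" by (rule puiseux_of_1) simp
  show "1 \<in> pos_puiseux" "puiseux_val (1 :: complex puiseux) = 0"
    using pos_puiseux_of[of 1 1] puiseux_val_of[of 1 "1 :: complex fls"] unfolding e
    by (auto simp: fls_pos_def fls_real_def)
qed

lemma pos_puiseux_nonzero: "x \<in> pos_puiseux \<Longrightarrow> x \<noteq> 0"
  by (simp add: pos_puiseux_def)

lemma pos_puiseux_divide:
  assumes "x \<in> pos_puiseux" "y \<in> pos_puiseux"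
  shows "x / y \<in> pos_puiseux \<and> puiseux_val (x / y) = puiseux_val x - puiseux_val y"
proof -
  obtain e f g h where e: "e > 0" and x: "x = puiseux_of e f" and y: "y = puiseux_of e g"
    and z: "x / y = puiseux_of e h"
    by (rule puiseux_common_denominator[of x y "x / y"])
  have p: "fls_pos f" "fls_pos g" using assms pos_puiseux_of[OF e] x y by auto
  have "y * (x / y) = x" using pos_puiseux_nonzero[OF assms(2)] by simp
  then have "puiseux_of e (g * h) = puiseux_of e f"
    unfolding puiseux_of_mult[OF e] x[symmetric] y[symmetric] z[symmetric] .
  then have gh: "g * h = f"
    using puiseux_of_eq_iff[OF e e] fls_compose_power_inject[OF e] by blast
  have nz: "h \<noteq> 0" "g \<noteq> 0" using gh p by (auto simp: fls_pos_def)
  have "fls_real h" using fls_real_cancel[of g h] p gh by (auto simp: fls_pos_def)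
  moreover have "Re (fls_nth h (fls_subdegree h)) > 0"
  proof -
    have "fls_nth f (fls_subdegree f) = fls_nth g (fls_subdegree g) * fls_nth h (fls_subdegree h)"
      using fls_nth_mult_subdegree[of g h] nz unfolding gh[symmetric] by simp
    moreover have "Im (fls_nth g (fls_subdegree g)) = 0"
      using p by (auto simp: fls_pos_def fls_real_def complex_is_Real_iff)
    ultimately have "Re (fls_nth g (fls_subdegree g)) * Re (fls_nth h (fls_subdegree h)) > 0"
      using p by (simp add: fls_pos_def)
    then show ?thesis using p by (simp add: fls_pos_def zero_less_mult_iff)
  qed
  ultimately have "fls_pos h" using nz by (simp add: fls_pos_def)
  then have zp: "x / y \<in> pos_puiseux" unfolding z pos_puiseux_of[OF e] .
  then have "puiseux_val (y * (x / y)) = puiseux_val y + puiseux_val (x / y)"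
    using pos_puiseux_mult assms by blast
  then show ?thesis using zp \<open>y * (x / y) = x\<close> by simp
qed

lemma pos_puiseux_rational:
  assumes "r \<in> \<rat>"
  shows "\<exists>x\<in>pos_puiseux. puiseux_val x = r"
proof -
  obtain m :: int and n :: nat where mn: "n > 0" "r = real_of_int m / real n"
    using assms unfolding Rats_eq_int_div_nat by auto
  have "fls_pos (fls_X_intpow m)" by (auto simp: fls_pos_def fls_real_def)
  then show ?thesis
    using pos_puiseux_of[OF mn(1), of "fls_X_intpow m"] puiseux_val_of[OF mn(1), of "fls_X_intpow m :: complex fls"] mn(2)
    by (intro bexI[of _ "puiseux_of n (fls_X_intpow m)"]) auto
qed

section \<open>Subtraction-free rational functions\<close>

lemma puiseux_const_hom:
  "puiseux_const (x + y) = puiseux_const x + (puiseux_const y :: 'a::idom puiseux)"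
  "puiseux_const (x * y) = puiseux_const x * (puiseux_const y :: 'a::idom puiseux)"
  "puiseux_const 0 = (0 :: 'a::idom puiseux)" "puiseux_const 1 = (1 :: 'a::idom puiseux)"
  unfolding puiseux_const_def
  by (simp_all only: fls_plus_const[symmetric] fls_const_mult_const[symmetric] puiseux_of_add puiseux_of_mult
      fls_const_0 fls_const_1 puiseux_of_0 puiseux_of_1 zero_less_one)

definition mon_eval :: "('v::finite \<Rightarrow> complex puiseux) \<Rightarrow> ('v \<Rightarrow>\<^sub>0 nat) \<Rightarrow> complex puiseux" where
  "mon_eval a m = (\<Prod>v\<in>UNIV. a v ^ Poly_Mapping.lookup m v)"

definition poly_eval ::
  "('v::finite \<Rightarrow> complex puiseux) \<Rightarrow> (('v \<Rightarrow>\<^sub>0 nat) \<Rightarrow>\<^sub>0 complex) \<Rightarrow> complex puiseux" where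
  "poly_eval a p = (\<Sum>m\<in>Poly_Mapping.keys p. puiseux_const (Poly_Mapping.lookup p m) * mon_eval a m)"

lemma mon_eval_add: "mon_eval a (m + n) = mon_eval a m * mon_eval a n"
  by (simp add: mon_eval_def lookup_add power_add prod.distrib)

lemma poly_eval_superset:
  assumes "finite S" "Poly_Mapping.keys p \<subseteq> S"
  shows "poly_eval a p = (\<Sum>m\<in>S. puiseux_const (Poly_Mapping.lookup p m) * mon_eval a m)"
  unfolding poly_eval_def
  by (rule sum.mono_neutral_left) (use assms in \<open>auto simp: in_keys_iff puiseux_const_hom\<close>)

lemma poly_eval_add: "poly_eval a (p + q) = poly_eval a p + poly_eval a q"
proof -
  let ?S = "Poly_Mapping.keys p \<union> Poly_Mapping.keys q"
  have "poly_eval a r = (\<Sum>m\<in>?S. puiseux_const (Poly_Mapping.lookup r m) * mon_eval a m)"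
    if "Poly_Mapping.keys r \<subseteq> ?S" for r
    by (rule poly_eval_superset[OF _ that]) simp
  then show ?thesis
    using keys_add[of p q] by (simp add: lookup_add puiseux_const_hom distrib_right sum.distrib)
qed

lemma poly_eval_0 [simp]: "poly_eval a 0 = 0"
  by (simp add: poly_eval_def)

lemma poly_eval_sum: "poly_eval a (sum f I) = (\<Sum>i\<in>I. poly_eval a (f i))"
  by (induction I rule: infinite_finite_induct) (simp_all add: poly_eval_add)

lemma poly_eval_single: "poly_eval a (Poly_Mapping.single m c) = puiseux_const c * mon_eval a m"
  using poly_eval_superset[of "{m}" "Poly_Mapping.single m c" a] by simp

lemma poly_eval_1 [simp]: "poly_eval a 1 = 1"
  using poly_eval_single[of a 0 1] by (simp add: puiseux_const_hom mon_eval_def)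

lemma poly_mapping_decompose:
  fixes p :: "'a \<Rightarrow>\<^sub>0 'b::comm_monoid_add"
  shows "p = (\<Sum>m\<in>Poly_Mapping.keys p. Poly_Mapping.single m (Poly_Mapping.lookup p m))"
  by (rule poly_mapping_eqI) (simp add: lookup_sum lookup_single when_def in_keys_iff)

lemma poly_eval_mult: "poly_eval a (p * q) = poly_eval a p * poly_eval a q"
proof -
  have "p * q = (\<Sum>m\<in>Poly_Mapping.keys p. \<Sum>n\<in>Poly_Mapping.keys q.
      Poly_Mapping.single (m + n) (Poly_Mapping.lookup p m * Poly_Mapping.lookup q n))"
    by (subst poly_mapping_decompose[of p], subst poly_mapping_decompose[of q])
       (simp only: sum_distrib_left sum_distrib_right mult_single, rule sum.swap)
  then show ?thesis
    by (simp add: poly_eval_sum poly_eval_single puiseux_const_hom mon_eval_add poly_eval_def[of a p]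
        poly_eval_def[of a q] sum_product mult_ac)
qed

text \<open>Evaluation is defined on the local ring of fractions whose denominator does not vanish at \<open>a\<close>.\<close>

definition rat_eval :: "('v::{finite,linorder} \<Rightarrow> complex puiseux) \<Rightarrow> 'v rat_fun \<Rightarrow> complex puiseux \<Rightarrow> bool" where
  "rat_eval a f z \<longleftrightarrow> (\<exists>p q. f = Fract p q \<and> poly_eval a q \<noteq> 0 \<and> z = poly_eval a p / poly_eval a q)"

lemma poly_eval_nonzero: "poly_eval a q \<noteq> 0 \<Longrightarrow> q \<noteq> 0"
  by auto

lemma rat_eval_unique:
  assumes "rat_eval a f z" "rat_eval a f z'"
  shows "z = z'"
proof -
  obtain p q p' q' where *: "f = Fract p q" "poly_eval a q \<noteq> 0" "z = poly_eval a p / poly_eval a q"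
    "f = Fract p' q'" "poly_eval a q' \<noteq> 0" "z' = poly_eval a p' / poly_eval a q'"
    using assms unfolding rat_eval_def by blast
  then have "p * q' = p' * q"
    using eq_fract(1)[of q q' p p'] poly_eval_nonzero by metis
  then have "poly_eval a p * poly_eval a q' = poly_eval a p' * poly_eval a q"
    by (metis poly_eval_mult)
  then show ?thesis using * by (simp add: frac_eq_eq)
qed

lemma rat_eval_const: "rat_eval a (rf_const c) (puiseux_const c)"
  unfolding rat_eval_def rf_const_def
  by (intro exI[of _ "Poly_Mapping.single 0 c"] exI[of _ 1]) (simp add: poly_eval_single mon_eval_def)

lemma rat_eval_var: "rat_eval a (rf_var v) (a v)"
proof -
  have "mon_eval a (Poly_Mapping.single v 1) = (\<Prod>u\<in>UNIV. if u = v then a v else 1)"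
    unfolding mon_eval_def by (rule prod.cong) (auto simp: lookup_single when_def)
  then have "mon_eval a (Poly_Mapping.single v 1) = a v" by simp
  then show ?thesis
    unfolding rat_eval_def rf_var_def
    by (intro exI[of _ "Poly_Mapping.single (Poly_Mapping.single v 1) 1"] exI[of _ 1])
       (simp add: poly_eval_single puiseux_const_hom)
qed

lemma rat_eval_1: "rat_eval a 1 1"
  unfolding rat_eval_def One_fract_def by (intro exI[of _ 1]) simp

lemma rat_eval_add:
  assumes "rat_eval a f y" "rat_eval a g z"
  shows "rat_eval a (f + g) (y + z)"
proof -
  obtain p q p' q' where *: "f = Fract p q" "poly_eval a q \<noteq> 0" "y = poly_eval a p / poly_eval a q"
    "g = Fract p' q'" "poly_eval a q' \<noteq> 0" "z = poly_eval a p' / poly_eval a q'"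
    using assms unfolding rat_eval_def by blast
  then show ?thesis
    unfolding rat_eval_def
    by (intro exI[of _ "p * q' + p' * q"] exI[of _ "q * q'"])
       (simp add: poly_eval_nonzero poly_eval_mult poly_eval_add add_frac_eq)
qed

lemma rat_eval_mult:
  assumes "rat_eval a f y" "rat_eval a g z"
  shows "rat_eval a (f * g) (y * z)"
proof -
  obtain p q p' q' where *: "f = Fract p q" "poly_eval a q \<noteq> 0" "y = poly_eval a p / poly_eval a q"
    "g = Fract p' q'" "poly_eval a q' \<noteq> 0" "z = poly_eval a p' / poly_eval a q'"
    using assms unfolding rat_eval_def by blast
  then show ?thesis
    unfolding rat_eval_def
    by (intro exI[of _ "p * p'"] exI[of _ "q * q'"]) (simp add: poly_eval_mult)
qed

lemma rat_eval_inverse: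
  assumes "rat_eval a f y" "y \<noteq> 0"
  shows "rat_eval a (inverse f) (inverse y)"
proof -
  obtain p q where *: "f = Fract p q" "poly_eval a q \<noteq> 0" "y = poly_eval a p / poly_eval a q"
    using assms unfolding rat_eval_def by blast
  then show ?thesis
    unfolding rat_eval_def using assms(2)
    by (intro exI[of _ q] exI[of _ p]) simp
qed

lemma rat_eval_divide:
  assumes "rat_eval a f y" "rat_eval a g z" "z \<noteq> 0"
  shows "rat_eval a (f / g) (y / z)"
  using rat_eval_mult[OF assms(1) rat_eval_inverse[OF assms(2,3)]] by (simp add: divide_inverse)

text \<open>At a positive point no denominator vanishes, so the partial evaluation
  \<open>rat_eval\<close> is defined on every subtraction-free expression, and valuation turns the
  operations into their tropical counterparts.\<close>

lemma sf_eval_pos: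
  assumes "\<And>v. a v \<in> pos_puiseux"
  shows "\<exists>z\<in>pos_puiseux. rat_eval a (sf_eval e) z \<and> puiseux_val z = sf_trop e (\<chi> v. puiseux_val (a v))"
proof (induction e)
  case (SF_Var v)
  then show ?case using assms rat_eval_var by (intro bexI[of _ "a v"]) auto
next
  case SF_One
  then show ?case using pos_puiseux_1 rat_eval_1 by (intro bexI[of _ 1]) auto
next
  case (SF_Add e1 e2)
  then show ?case using pos_puiseux_add rat_eval_add by (metis sf_eval.simps(3) sf_trop.simps(3))
next
  case (SF_Mult e1 e2)
  then show ?case using pos_puiseux_mult rat_eval_mult by (metis sf_eval.simps(4) sf_trop.simps(4))
next
  case (SF_Div e1 e2)
  then show ?case
    using pos_puiseux_divide rat_eval_divide pos_puiseux_nonzero by (metis sf_eval.simps(5) sf_trop.simps(5))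
qed

lemma continuous_sf_trop: "continuous_on UNIV (sf_trop e)"
  by (induction e) (auto intro!: continuous_intros)

lemma closure_rational_vectors: "closure {w :: real^'v. \<forall>v. w $ v \<in> \<rat>} = UNIV"
proof -
  have "{w :: real^'v. \<forall>v. w $ v \<in> \<rat>} = (\<Union>f \<in> Basis \<rightarrow> \<rat>. {\<Sum>i \<in> Basis. f i *\<^sub>R i})" (is "?A = ?B")
  proof
    show "?A \<subseteq> ?B"
    proof
      fix w :: "real^'v" assume "w \<in> ?A"
      then have "(\<lambda>i. w \<bullet> i) \<in> Basis \<rightarrow> \<rat>" by (auto simp: Basis_vec_def inner_axis)
      moreover have "w = (\<Sum>i\<in>Basis. (w \<bullet> i) *\<^sub>R i)" by (simp add: euclidean_representation)
      ultimately show "w \<in> ?B" by blast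
    qed
    show "?B \<subseteq> ?A"
    proof
      fix w assume "w \<in> ?B"
      then obtain f where f: "f \<in> Basis \<rightarrow> \<rat>" "w = (\<Sum>i\<in>Basis. f i *\<^sub>R i)" by blast
      have "w $ v = f (axis v 1)" for v
      proof -
        have "w $ v = w \<bullet> axis v 1" by (simp add: inner_axis)
        also have "\<dots> = f (axis v 1)"
          unfolding f(2) by (rule inner_sum_left_Basis) (auto simp: Basis_vec_def)
        finally show ?thesis .
      qed
      then show "w \<in> ?A" using f(1) by (auto simp: Basis_vec_def)
    qed
  qed
  then show ?thesis using closure_rational_coordinates by simp
qed

lemma pos_point_exists:
  assumes "\<forall>v. w $ v \<in> \<rat>"
  shows "\<exists>a. (\<forall>v. a v \<in> pos_puiseux) \<and> w = (\<chi> v. puiseux_val (a v))"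
proof -
  have "\<forall>v. \<exists>x. x \<in> pos_puiseux \<and> puiseux_val x = w $ v" using assms pos_puiseux_rational by blast
  then obtain a where "\<forall>v. a v \<in> pos_puiseux \<and> puiseux_val (a v) = w $ v" by metis
  then show ?thesis by (intro exI[of _ a]) (simp add: vec_eq_iff)
qed

text \<open>Both tropicalizations compute the valuation of one rational function at positive points.
  Every rational vector is the valuation of such a point, and continuity does the rest.\<close>

lemma sf_trop_unique:
  fixes e e' :: "'v::{finite,linorder} sf_expr"
  assumes "sf_eval e = sf_eval e'"
  shows "sf_trop e = sf_trop e'"
proof -
  have "closed {w. sf_trop e w = sf_trop e' w}"
    by (intro closed_Collect_eq continuous_sf_trop)
  moreover have "{w. \<forall>v. w $ v \<in> \<rat>} \<subseteq> {w. sf_trop e w = sf_trop e' w}"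
  proof (rule subsetI, unfold mem_Collect_eq)
    fix w :: "(real, 'v) vec" assume "\<forall>v. w $ v \<in> \<rat>"
    then obtain a where a: "\<And>v. a v \<in> pos_puiseux" "w = (\<chi> v. puiseux_val (a v))"
      using pos_point_exists by metis
    obtain z where z: "rat_eval a (sf_eval e) z" "puiseux_val z = sf_trop e w"
      using sf_eval_pos[of a e, OF a(1)] unfolding a(2) by (elim bexE conjE)
    obtain z' where z': "rat_eval a (sf_eval e') z'" "puiseux_val z' = sf_trop e' w"
      using sf_eval_pos[of a e', OF a(1)] unfolding a(2) by (elim bexE conjE)
    have "z = z'" by (rule rat_eval_unique[OF z(1)]) (use z'(1) assms in simp)
    then show "sf_trop e w = sf_trop e' w" using z(2) z'(2) by simp
  qed
  ultimately have "UNIV \<subseteq> {w. sf_trop e w = sf_trop e' w}"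
    unfolding closure_rational_vectors[symmetric] by (intro closure_minimal)
  then show ?thesis by (intro ext) blast
qed

definition subtraction_free :: "'v::{finite,linorder} rat_fun \<Rightarrow> ((real, 'v) vec \<Rightarrow> real) \<Rightarrow> bool" where
  "subtraction_free f g \<longleftrightarrow> (\<exists>e. sf_eval e = f \<and> sf_trop e = g)"

lemma tropicalization_eq: "subtraction_free f g \<Longrightarrow> tropicalization f = g"
  unfolding tropicalization_def subtraction_free_def
  by (rule the_equality) (use sf_trop_unique in blast)+

lemma subtraction_free_var: "subtraction_free (rf_var v) (\<lambda>w. w $ v)"
  unfolding subtraction_free_def by (intro exI[of _ "SF_Var v"]) auto

lemma subtraction_free_1: "subtraction_free 1 (\<lambda>w. 0)"
  unfolding subtraction_free_def by (intro exI[of _ SF_One]) auto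

lemma subtraction_free_add:
  "subtraction_free f g \<Longrightarrow> subtraction_free f' g' \<Longrightarrow> subtraction_free (f + f') (\<lambda>w. min (g w) (g' w))"
  unfolding subtraction_free_def by (metis sf_eval.simps(3) sf_trop.simps(3) ext)

lemma subtraction_free_mult:
  "subtraction_free f g \<Longrightarrow> subtraction_free f' g' \<Longrightarrow> subtraction_free (f * f') (\<lambda>w. g w + g' w)"
  unfolding subtraction_free_def by (metis sf_eval.simps(4) sf_trop.simps(4) ext)

lemma subtraction_free_divide:
  "subtraction_free f g \<Longrightarrow> subtraction_free f' g' \<Longrightarrow> subtraction_free (f / f') (\<lambda>w. g w - g' w)"
  unfolding subtraction_free_def by (metis sf_eval.simps(5) sf_trop.simps(5) ext)

lemma subtraction_free_power:
  assumes "subtraction_free f g"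
  shows "subtraction_free (f ^ n) (\<lambda>w. real n * g w)"
proof (induction n)
  case (Suc n)
  then show ?case using subtraction_free_mult[OF assms Suc] by (simp add: algebra_simps)
qed (simp add: subtraction_free_1)

lemma subtraction_free_prod:
  assumes "finite I" "\<And>i. i \<in> I \<Longrightarrow> subtraction_free (f i) (g i)"
  shows "subtraction_free (prod f I) (\<lambda>w. \<Sum>i\<in>I. g i w)"
  using assms
  by (induction I rule: finite_induct) (simp_all add: subtraction_free_1 subtraction_free_mult)

section \<open>The positive tropicalization as a graph\<close>

locale cluster_setting =
  fixes \<iota> :: "'n::{finite,linorder} \<Rightarrow> 'v::{finite,linorder}" and Bt :: "('n, 'v) int_matrix" and dn :: "'n \<Rightarrow> int"
  assumes inj: "inj \<iota>"
    and dn_pos: "\<And>i. dn i > 0"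
    and dn_skew: "\<And>i j. dn i * Bt $ \<iota> i $ j = - (dn j * Bt $ \<iota> j $ i)"
    and rank: "full_rank Bt"
    and finite_type: "cluster_finite_type \<iota> Bt"
begin

definition seedw :: "'n list \<Rightarrow> ('n, 'v) seed" where
  "seedw ks = foldl (\<lambda>s k. mutate \<iota> k s) (rf_var, Bt) ks"

lemma seedw_simps: "seedw [] = (rf_var, Bt)" "seedw (ks @ [k]) = mutate \<iota> k (seedw ks)"
  by (simp_all add: seedw_def)

lemma seeds_eq: "seeds \<iota> Bt = range seedw"
proof (intro subset_antisym subsetI)
  fix s assume "s \<in> seeds \<iota> Bt"
  then show "s \<in> range seedw"
  proof induction
    case initial
    then show ?case using seedw_simps(1) by (metis rangeI)
  next
    case (mutation s k)
    then show ?case using seedw_simps(2) by (metis rangeI imageE)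
  qed
next
  fix s assume "s \<in> range seedw"
  then obtain ks where s: "s = seedw ks" by blast
  show "s \<in> seeds \<iota> Bt"
    unfolding s by (induction ks rule: rev_induct) (auto simp: seedw_simps intro: seeds.intros)
qed

abbreviation "xs ks \<equiv> fst (seedw ks)"

abbreviation "bs ks \<equiv> snd (seedw ks)"

definition dv :: "'v \<Rightarrow> real" where
  "dv v = (if v \<in> range \<iota> then real_of_int (dn (inv \<iota> v)) else 1)"

text \<open>The square completion of \<open>Bt\<close>: its frozen columns are determined by skew-symmetrizability, up to the
  frozen-frozen block, which is set to zero.\<close>

definition \<beta> :: "'v \<Rightarrow> 'v \<Rightarrow> real" where
  "\<beta> i j = (if j \<in> range \<iota> then real_of_int (Bt $ i $ inv \<iota> j)
     else if i \<in> range \<iota> then - real_of_int (Bt $ j $ inv \<iota> i) / real_of_int (dn (inv \<iota> i)) else 0)"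

lemma inv_\<iota> [simp]: "inv \<iota> (\<iota> k) = k"
  using inj by simp

lemma dv_pos: "dv v > 0"
  using dn_pos by (simp add: dv_def)

lemma skew_\<beta>: "skew dv \<beta>"
  unfolding skew_def
proof (intro allI)
  fix i j
  consider k l where "i = \<iota> k" "j = \<iota> l" | k where "i = \<iota> k" "j \<notin> range \<iota>"
    | l where "i \<notin> range \<iota>" "j = \<iota> l" | "i \<notin> range \<iota>" "j \<notin> range \<iota>" by blast
  then show "dv i * \<beta> i j = - (dv j * \<beta> j i)"
  proof cases
    case (1 k l)
    then show ?thesis
      using arg_cong[OF dn_skew[of k l], of real_of_int] by (simp add: dv_def \<beta>_def)
  next
    case (2 k)
    then show ?thesis using dn_pos[of k] by (simp add: dv_def \<beta>_def)
  next
    case (3 l)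
    then show ?thesis using dn_pos[of l] by (simp add: dv_def \<beta>_def)
  next
    case 4
    then show ?thesis by (simp add: dv_def \<beta>_def)
  qed
qed

lemma mm_mutate_matrix:
  assumes "\<And>i k. c i (\<iota> k) = real_of_int (b $ i $ k)"
  shows "mm (\<iota> l) c i (\<iota> k) = real_of_int (mutate_matrix \<iota> l b $ i $ k)"
proof -
  have "\<iota> k = \<iota> l \<longleftrightarrow> k = l" using inj by (metis injD)
  moreover have "real_of_int (max 0 x) = max 0 (real_of_int x)" for x by (simp add: of_int_max)
  moreover have "real_of_int (sgn x) = sgn (real_of_int x)" for x by (simp add: sgn_if)
  ultimately show ?thesis
    using assms by (simp add: mm_def mutate_matrix_def)
qed

lemma bw_\<beta>: "bw \<beta> (map \<iota> ks) i (\<iota> k) = real_of_int (bs ks $ i $ k)"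
proof (induction ks arbitrary: i k rule: rev_induct)
  case Nil
  then show ?case by (simp add: seedw_simps \<beta>_def)
next
  case (snoc l ks)
  then show ?case using mm_mutate_matrix[of "bw \<beta> (map \<iota> ks)" "bs ks" l i k, OF snoc.IH]
    by (simp add: bw_append seedw_simps mutate_def)
qed

abbreviation "tx ks w \<equiv> xw \<beta> (($) w) (map \<iota> ks)"

lemma pos_part_sum:
  fixes g :: "'a::finite \<Rightarrow> real" and c :: "'a \<Rightarrow> int"
  shows "(\<Sum>i | c i > 0. real (nat (c i)) * g i) = (\<Sum>i\<in>UNIV. max 0 (real_of_int (c i)) * g i)"
  by (rule sum.mono_neutral_cong_left) auto

text \<open>The exchange relation is itself subtraction-free, and \<open>xm\<close> is its
  tropicalization.\<close>

lemma subtraction_free_xs: "subtraction_free (xs ks i) (\<lambda>w. tx ks w i)"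
proof (induction ks arbitrary: i rule: rev_induct)
  case Nil
  then show ?case by (simp add: seedw_simps subtraction_free_var)
next
  case (snoc k ks)
  let ?b = "\<lambda>i. bs ks $ i $ k"
  have "subtraction_free (exchange \<iota> k (seedw ks))
      (\<lambda>w. min (\<Sum>i | ?b i > 0. real (nat (?b i)) * tx ks w i) (\<Sum>i | ?b i < 0. real (nat (- ?b i)) * tx ks w i)
        - tx ks w (\<iota> k))"
    unfolding exchange_def
    by (intro subtraction_free_divide subtraction_free_add subtraction_free_prod subtraction_free_power snoc.IH) auto
  moreover have neg: "(\<Sum>i | ?b i < 0. real (nat (- ?b i)) * tx ks w i) = (\<Sum>i\<in>UNIV. max 0 (- real_of_int (?b i)) * tx ks w i)" for w
    using pos_part_sum[of "\<lambda>i. - ?b i" "tx ks w"] by simp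
  moreover have "tx (ks @ [k]) w (\<iota> k) = min (\<Sum>i\<in>UNIV. max 0 (real_of_int (?b i)) * tx ks w i)
      (\<Sum>i\<in>UNIV. max 0 (- real_of_int (?b i)) * tx ks w i) - tx ks w (\<iota> k)" for w
    by (simp add: xw_append xm_def bw_\<beta>)
  ultimately have *: "subtraction_free (exchange \<iota> k (seedw ks)) (\<lambda>w. tx (ks @ [k]) w (\<iota> k))"
    by (simp only: neg pos_part_sum)
  show ?case
  proof (cases "i = \<iota> k")
    case True
    then show ?thesis using * by (simp add: seedw_simps mutate_def)
  next
    case False
    then have "(\<lambda>w. tx (ks @ [k]) w i) = (\<lambda>w. tx ks w i)" by (simp add: xw_append xm_def)
    then show ?thesis using snoc.IH[of i] False by (simp add: seedw_simps mutate_def)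
  qed
qed

lemma tropicalization_xs: "tropicalization (xs ks i) = (\<lambda>w. tx ks w i)"
  by (rule tropicalization_eq[OF subtraction_free_xs])

lemma xs_frozen: "v \<notin> range \<iota> \<Longrightarrow> xs ks v = rf_var v"
  by (induction ks rule: rev_induct) (auto simp: seedw_simps mutate_def)

lemma cluster_vars_eq: "cluster_vars \<iota> Bt = {xs ks (\<iota> k) | ks k. True}"
  unfolding cluster_vars_def seeds_eq cluster_def by blast

lemma coordinates_eq: "coordinates \<iota> Bt = {xs ks i | ks i. True}"
proof (intro subset_antisym subsetI)
  fix f assume "f \<in> coordinates \<iota> Bt"
  then consider "f \<in> cluster_vars \<iota> Bt" | v where "f = rf_var v" "v \<notin> range \<iota>"
    by (auto simp: coordinates_def frozen_vars_def)
  then show "f \<in> {xs ks i | ks i. True}"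
  proof cases
    case 1
    then show ?thesis unfolding cluster_vars_eq by blast
  next
    case 2
    then have "f = xs [] v" by (simp add: xs_frozen)
    then show ?thesis by blast
  qed
next
  fix f assume "f \<in> {xs ks i | ks i. True}"
  then obtain ks i where f: "f = xs ks i" by blast
  show "f \<in> coordinates \<iota> Bt"
  proof (cases "i \<in> range \<iota>")
    case True
    then show ?thesis unfolding coordinates_def cluster_vars_eq f by blast
  next
    case False
    then show ?thesis unfolding coordinates_def frozen_vars_def f using xs_frozen by blast
  qed
qed

lemma rf_var_coordinate: "rf_var v \<in> coordinates \<iota> Bt"
  unfolding coordinates_eq using seedw_simps(1) by (metis (mono_tags, lifting) fst_conv mem_Collect_eq)

lemma finite_xs: "finite (range xs)"
proof -
  let ?T = "cluster_vars \<iota> Bt \<union> range rf_var"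
  have "finite ?T" using finite_type by (simp add: cluster_finite_type_def)
  moreover have "range xs \<subseteq> PiE UNIV (\<lambda>_. ?T)"
  proof
    fix x assume "x \<in> range xs"
    then obtain ks where x: "x = xs ks" by blast
    have "xs ks i \<in> ?T" for i
    proof (cases "i \<in> range \<iota>")
      case True
      then show ?thesis unfolding cluster_vars_eq by blast
    qed (simp add: xs_frozen)
    then show "x \<in> PiE UNIV (\<lambda>_. ?T)" unfolding x by auto
  qed
  moreover have "finite (PiE (UNIV :: 'v set) (\<lambda>_. ?T))"
    using \<open>finite ?T\<close> by (intro finite_PiE) auto
  ultimately show ?thesis using finite_subset by blast
qed

lemma words_range: "{ks. set ks \<subseteq> range \<iota>} = range (map \<iota>)"
  by (auto simp: lists_eq_set[symmetric] lists_image[symmetric] simp flip: lists_UNIV)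

lemma onto_\<beta>: "surj_on_K (range \<iota>) \<beta>"
proof -
  define A :: "((real, 'n) vec, 'v) vec" where "A = (\<chi> i j. real_of_int (Bt $ i $ j))"
  have "rank (transpose A) = CARD('n)" using rank by (simp add: full_rank_def A_def rank_transpose)
  then have surj: "surj ((*v) (transpose A))" using full_rank_surjective[of "transpose A"] by simp
  show ?thesis
    unfolding surj_on_K_def
  proof
    fix t
    obtain p where p: "transpose A *v p = (\<chi> k. t (\<iota> k))" using surj by (metis surjD)
    have "yv \<beta> (($) p) (\<iota> k) = t (\<iota> k)" for k
      using arg_cong[OF p, of "\<lambda>x. x $ k"]
      by (simp add: yv_def \<beta>_def matrix_vector_mult_def transpose_def A_def)
    then show "\<exists>p. \<forall>k\<in>range \<iota>. yv \<beta> p k = t k" by blast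
  qed
qed

sublocale core: trop_cluster dv "range \<iota>" \<beta>
proof
  show "\<beta> i k \<in> \<int>" if "i \<in> range \<iota>" "k \<in> range \<iota>" for i k
    using that by (simp add: \<beta>_def)
  \<comment> \<open>A coordinate map depends only on the labelled extended cluster at the end of the
    word, as tropicalization is a function of the variable; there are finitely many such
    clusters.\<close>
  have "(\<lambda>ks p. xw \<beta> p ks) ` {ks. set ks \<subseteq> range \<iota>} \<subseteq> (\<lambda>x p i. tropicalization (x i) (\<chi> v. p v)) ` range xs"
  proof
    fix g assume "g \<in> (\<lambda>ks p. xw \<beta> p ks) ` {ks. set ks \<subseteq> range \<iota>}"
    then obtain ks where "g = (\<lambda>p. xw \<beta> p (map \<iota> ks))" unfolding words_range by blast
    moreover have "xw \<beta> p (map \<iota> ks) = (\<lambda>i. tropicalization (xs ks i) (\<chi> v. p v))" for p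
    proof -
      have "($) (\<chi> v. p v) = p" by (simp add: fun_eq_iff)
      then show ?thesis unfolding tropicalization_xs by simp
    qed
    ultimately show "g \<in> (\<lambda>x p i. tropicalization (x i) (\<chi> v. p v)) ` range xs" by blast
  qed
  then show "finite ((\<lambda>ks p. xw \<beta> p ks) ` {ks. set ks \<subseteq> range \<iota>})"
    using finite_xs finite_subset by blast
qed (use dv_pos skew_\<beta> onto_\<beta> in auto)

section \<open>Positive points of the spectrum and their valuations\<close>

definition graph_map :: "(real, 'v) vec \<Rightarrow> 'v rat_fun \<Rightarrow> real" where
  "graph_map w = (\<lambda>f. if f \<in> coordinates \<iota> Bt then tropicalization f w else 0)"

lemma initial_projection_graph_map: "initial_projection (graph_map w) = w"
  by (simp add: initial_projection_def graph_map_def vec_eq_iff rf_var_coordinate tropicalization_eq[OF subtraction_free_var])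

lemma prod_closed_hom:
  assumes "spec_point \<iota> Bt \<phi>" "finite I" "\<And>i. i \<in> I \<Longrightarrow> f i \<in> cluster_algebra \<iota> Bt \<and> \<phi> (f i) \<in> pos_puiseux"
  shows "(\<Prod>i\<in>I. f i ^ n i) \<in> cluster_algebra \<iota> Bt \<and> \<phi> (\<Prod>i\<in>I. f i ^ n i) \<in> pos_puiseux
    \<and> puiseux_val (\<phi> (\<Prod>i\<in>I. f i ^ n i)) = (\<Sum>i\<in>I. real (n i) * puiseux_val (\<phi> (f i)))"
proof -
  have hom: "\<phi> (g * h) = \<phi> g * \<phi> h" if "g \<in> cluster_algebra \<iota> Bt" "h \<in> cluster_algebra \<iota> Bt" for g h
    using assms(1) that by (simp add: spec_point_def)
  have one: "rf_const 1 = (1 :: 'v rat_fun)" by (simp add: rf_const_def One_fract_def)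
  then have 1: "1 \<in> cluster_algebra \<iota> Bt" "\<phi> 1 = 1"
    using cluster_algebra.const[of 1] assms(1) puiseux_const_hom(4) by (metis, metis spec_point_def)
  have pow: "g ^ m \<in> cluster_algebra \<iota> Bt \<and> \<phi> (g ^ m) \<in> pos_puiseux \<and> puiseux_val (\<phi> (g ^ m)) = real m * puiseux_val (\<phi> g)"
    if "g \<in> cluster_algebra \<iota> Bt" "\<phi> g \<in> pos_puiseux" for g m
  proof (induction m)
    case (Suc m)
    then show ?case
      using that hom[of g "g ^ m"] pos_puiseux_mult[of "\<phi> g" "\<phi> (g ^ m)"] cluster_algebra.mult[of g \<iota> Bt "g ^ m"]
      by (simp add: algebra_simps)
  qed (use 1 pos_puiseux_1 in simp)
  show ?thesis using assms(2,3)
  proof (induction I rule: finite_induct)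
    case empty
    then show ?case using 1 pos_puiseux_1 by simp
  next
    case (insert i I)
    have *: "f i ^ n i \<in> cluster_algebra \<iota> Bt" "\<phi> (f i ^ n i) \<in> pos_puiseux"
      "puiseux_val (\<phi> (f i ^ n i)) = real (n i) * puiseux_val (\<phi> (f i))"
      using pow insert.prems by auto
    have IH: "(\<Prod>i\<in>I. f i ^ n i) \<in> cluster_algebra \<iota> Bt" "\<phi> (\<Prod>i\<in>I. f i ^ n i) \<in> pos_puiseux"
      "puiseux_val (\<phi> (\<Prod>i\<in>I. f i ^ n i)) = (\<Sum>i\<in>I. real (n i) * puiseux_val (\<phi> (f i)))"
      using insert.IH insert.prems by auto
    show ?case
      unfolding prod.insert[OF insert.hyps] sum.insert[OF insert.hyps] hom[OF *(1) IH(1)]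
      using pos_puiseux_mult[OF *(2) IH(2)] cluster_algebra.mult[OF *(1) IH(1)] *(3) IH(3) by simp
  qed
qed

lemma coordinate_in_algebra: "f \<in> coordinates \<iota> Bt \<Longrightarrow> f \<in> cluster_algebra \<iota> Bt"
  by (auto simp: coordinates_def intro: cluster_algebra.intros)

lemma valuation_of_spec_point:
  assumes sp: "spec_point \<iota> Bt \<phi>" and pos: "\<forall>f\<in>coordinates \<iota> Bt. \<phi> f \<in> pos_puiseux"
  shows "puiseux_val (\<phi> (xs ks i)) = tx ks (\<chi> v. puiseux_val (\<phi> (rf_var v))) i"
proof (induction ks arbitrary: i rule: rev_induct)
  case Nil
  then show ?case by (simp add: seedw_simps)
next
  case (snoc k ks)
  let ?w = "\<chi> v. puiseux_val (\<phi> (rf_var v))"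
  let ?b = "\<lambda>i. bs ks $ i $ k"
  define P Q where "P = (\<Prod>i | ?b i > 0. xs ks i ^ nat (?b i))" and "Q = (\<Prod>i | ?b i < 0. xs ks i ^ nat (- ?b i))"
  have cl: "xs ls j \<in> cluster_algebra \<iota> Bt" "\<phi> (xs ls j) \<in> pos_puiseux" for ls j
    using coordinate_in_algebra[of "xs ls j"] pos coordinates_eq by blast+
  have P: "P \<in> cluster_algebra \<iota> Bt" "\<phi> P \<in> pos_puiseux"
    "puiseux_val (\<phi> P) = (\<Sum>i\<in>UNIV. max 0 (real_of_int (?b i)) * tx ks ?w i)"
    using prod_closed_hom[OF sp, of "{i. ?b i > 0}" "xs ks" "\<lambda>i. nat (?b i)"] cl
    unfolding P_def snoc.IH pos_part_sum by auto
  have Q: "Q \<in> cluster_algebra \<iota> Bt" "\<phi> Q \<in> pos_puiseux"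
    "puiseux_val (\<phi> Q) = (\<Sum>i\<in>UNIV. max 0 (- real_of_int (?b i)) * tx ks ?w i)"
    using prod_closed_hom[OF sp, of "{i. ?b i < 0}" "xs ks" "\<lambda>i. nat (- ?b i)"] cl
      pos_part_sum[of "\<lambda>i. - ?b i" "tx ks ?w"]
    unfolding Q_def snoc.IH by auto
  have x': "xs (ks @ [k]) (\<iota> k) = (P + Q) / xs ks (\<iota> k)"
    by (simp add: seedw_simps mutate_def exchange_def P_def Q_def)
  have "\<phi> 0 = 0"
  proof -
    have "rf_const 0 = (0 :: 'v rat_fun)" by (simp add: rf_const_def Zero_fract_def)
    then show ?thesis using sp puiseux_const_hom(3) by (metis spec_point_def)
  qed
  then have "xs ks (\<iota> k) \<noteq> 0" using cl(2)[of ks "\<iota> k"] pos_puiseux_nonzero by metis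
  \<comment> \<open>The exchange relation is used in multiplied-out form: \<phi> respects sums and
    products inside the cluster algebra, and nothing is assumed about its values on
    quotients.\<close>
  then have "xs (ks @ [k]) (\<iota> k) * xs ks (\<iota> k) = P + Q" unfolding x' by simp
  then have "\<phi> (xs (ks @ [k]) (\<iota> k)) * \<phi> (xs ks (\<iota> k)) = \<phi> P + \<phi> Q"
    using sp cl(1) P(1) Q(1) unfolding spec_point_def by metis
  then have "puiseux_val (\<phi> (xs (ks @ [k]) (\<iota> k))) + puiseux_val (\<phi> (xs ks (\<iota> k)))
      = min (puiseux_val (\<phi> P)) (puiseux_val (\<phi> Q))"
    using pos_puiseux_mult[OF cl(2) cl(2)] pos_puiseux_add[OF P(2) Q(2)] by metis
  then have *: "puiseux_val (\<phi> (xs (ks @ [k]) (\<iota> k))) = tx (ks @ [k]) ?w (\<iota> k)"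
    unfolding P(3) Q(3) snoc.IH by (simp add: xw_append xm_def bw_\<beta>)
  show ?case
  proof (cases "i = \<iota> k")
    case False
    then have "xs (ks @ [k]) i = xs ks i" "tx (ks @ [k]) ?w i = tx ks ?w i"
      by (simp_all add: seedw_simps mutate_def xw_append xm_def)
    then show ?thesis using snoc.IH[of i] by (simp only:)
  next
    case True
    show ?thesis unfolding True by (rule *)
  qed
qed

text \<open>Evaluation at \<open>a\<close> is defined on the whole cluster algebra, because its
  generators are constants, subtraction-free functions, and inverses of frozen variables, whose
  values are nonzero.\<close>

lemma spec_point_exists:
  assumes a: "\<And>v. a v \<in> pos_puiseux"
  shows "\<exists>\<phi>. spec_point \<iota> Bt \<phi> \<and> (\<forall>f\<in>coordinates \<iota> Bt. \<phi> f \<in> pos_puiseux) \<and> (\<forall>v. \<phi> (rf_var v) = a v)"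
proof -
  define \<phi> where "\<phi> f = (THE z. rat_eval a f z)" for f :: "'v rat_fun"
  have \<phi>: "\<phi> f = z" if "rat_eval a f z" for f z
    unfolding \<phi>_def using that rat_eval_unique by blast
  have co: "\<exists>z\<in>pos_puiseux. rat_eval a f z" if f: "f \<in> coordinates \<iota> Bt" for f
  proof -
    obtain e where "sf_eval e = f"
      using f subtraction_free_xs unfolding coordinates_eq subtraction_free_def by blast
    then show ?thesis using sf_eval_pos[of a e, OF a] by blast
  qed
  have dom: "\<exists>z. rat_eval a f z" if "f \<in> cluster_algebra \<iota> Bt" for f
    using that
  proof induction
    case (const c)
    then show ?case using rat_eval_const by blast
  next
    case (cluster f)
    then show ?case using co[of f] by (auto simp: coordinates_def)
  next
    case (frozen f)
    then show ?case using co[of f] by (auto simp: coordinates_def)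
  next
    case (frozen_inverse f)
    then show ?case using co[of f] rat_eval_inverse pos_puiseux_nonzero by (metis UnI2 coordinates_def)
  next
    case (add f g)
    then show ?case using rat_eval_add by blast
  next
    case (mult f g)
    then show ?case using rat_eval_mult by blast
  qed
  have "spec_point \<iota> Bt \<phi>"
    unfolding spec_point_def
  proof (intro conjI allI ballI)
    show "\<phi> (rf_const c) = puiseux_const c" for c by (rule \<phi>[OF rat_eval_const])
  next
    fix f g assume "f \<in> cluster_algebra \<iota> Bt" "g \<in> cluster_algebra \<iota> Bt"
    then obtain y z where yz: "rat_eval a f y" "rat_eval a g z" using dom by blast
    show "\<phi> (f + g) = \<phi> f + \<phi> g" using \<phi>[OF yz(1)] \<phi>[OF yz(2)] \<phi>[OF rat_eval_add[OF yz]] by simp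
    show "\<phi> (f * g) = \<phi> f * \<phi> g" using \<phi>[OF yz(1)] \<phi>[OF yz(2)] \<phi>[OF rat_eval_mult[OF yz]] by simp
  qed
  moreover have "\<forall>f\<in>coordinates \<iota> Bt. \<phi> f \<in> pos_puiseux" using co \<phi> by fastforce
  moreover have "\<forall>v. \<phi> (rf_var v) = a v" using \<phi>[OF rat_eval_var] by blast
  ultimately show ?thesis by blast
qed

lemma continuous_graph_map: "continuous_on UNIV graph_map"
proof (rule continuous_on_coordinatewise_then_product)
  fix f :: "'v rat_fun"
  show "continuous_on UNIV (\<lambda>w. graph_map w f)"
  proof (cases "f \<in> coordinates \<iota> Bt")
    case True
    then obtain e where e: "sf_eval e = f" "sf_trop e = tropicalization f"
      unfolding coordinates_eq using subtraction_free_xs tropicalization_xs unfolding subtraction_free_def by fastforce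
    then show ?thesis using True continuous_sf_trop[of e] by (simp add: graph_map_def)
  qed (simp add: graph_map_def)
qed

lemma continuous_initial_projection: "continuous_on UNIV (initial_projection :: ('v rat_fun \<Rightarrow> real) \<Rightarrow> _)"
  unfolding initial_projection_def by (intro continuous_intros continuous_on_product_coordinates)

text \<open>The graph is closed, being the set of fixed points of \<open>graph_map\<close> after
  \<open>initial_projection\<close>. Its points over rational vectors are valuations of positive
  points and are dense in it.\<close>

theorem Trop_pos_eq: "Trop_pos \<iota> Bt = range graph_map"
proof -
  define Pts where "Pts = {(\<lambda>f. if f \<in> coordinates \<iota> Bt then puiseux_val (\<phi> f) else 0) | \<phi>.
        spec_point \<iota> Bt \<phi> \<and> (\<forall>f\<in>coordinates \<iota> Bt. \<phi> f \<in> pos_puiseux)}"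
  have pt: "(\<lambda>f. if f \<in> coordinates \<iota> Bt then puiseux_val (\<phi> f) else 0)
      = graph_map (\<chi> v. puiseux_val (\<phi> (rf_var v)))"
    if "spec_point \<iota> Bt \<phi>" "\<forall>f\<in>coordinates \<iota> Bt. \<phi> f \<in> pos_puiseux" for \<phi>
  proof
    fix f
    show "(if f \<in> coordinates \<iota> Bt then puiseux_val (\<phi> f) else 0) = graph_map (\<chi> v. puiseux_val (\<phi> (rf_var v))) f"
    proof (cases "f \<in> coordinates \<iota> Bt")
      case True
      then obtain ks i where "f = xs ks i" unfolding coordinates_eq by blast
      then show ?thesis
        using True valuation_of_spec_point[OF that, of ks i] by (simp add: graph_map_def tropicalization_xs)
    qed (simp add: graph_map_def)
  qed
  have sub: "Pts \<subseteq> range graph_map" using pt unfolding Pts_def by blast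
  have sup: "graph_map ` {w. \<forall>v. w $ v \<in> \<rat>} \<subseteq> Pts"
  proof
    fix g assume "g \<in> graph_map ` {w. \<forall>v. w $ v \<in> \<rat>}"
    then obtain w where w: "\<forall>v. w $ v \<in> \<rat>" "g = graph_map w" by blast
    obtain a where a: "\<And>v. a v \<in> pos_puiseux" "w = (\<chi> v. puiseux_val (a v))"
      using pos_point_exists[OF w(1)] by blast
    obtain \<phi> where \<phi>: "spec_point \<iota> Bt \<phi>" "\<forall>f\<in>coordinates \<iota> Bt. \<phi> f \<in> pos_puiseux" "\<forall>v. \<phi> (rf_var v) = a v"
      using spec_point_exists[of a, OF a(1)] by blast
    have "g = graph_map (\<chi> v. puiseux_val (\<phi> (rf_var v)))" using w(2) a(2) \<phi>(3) by simp
    then have "g = (\<lambda>f. if f \<in> coordinates \<iota> Bt then puiseux_val (\<phi> f) else 0)"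
      using pt[OF \<phi>(1,2)] by simp
    then show "g \<in> Pts" unfolding Pts_def mem_Collect_eq by (intro exI[of _ \<phi>] conjI \<phi>(1,2))
  qed
  have "range graph_map = {g. graph_map (initial_projection g) = g}"
    using initial_projection_graph_map by (auto intro: range_eqI[OF sym])
  also have "\<dots> = (\<Inter>f. {g. graph_map (initial_projection g) f = g f})" by auto
  moreover have "closed (\<Inter>f. {g. graph_map (initial_projection g) f = g f})"
  proof (intro closed_INT ballI closed_Collect_eq continuous_on_product_coordinates)
    fix f
    have "continuous_on UNIV (\<lambda>w. graph_map w f)"
      by (rule continuous_on_product_then_coordinatewise[OF continuous_graph_map])
    then show "continuous_on UNIV (\<lambda>g. graph_map (initial_projection g) f)"
      by (rule continuous_on_compose2[OF _ continuous_initial_projection]) auto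
  qed
  ultimately have "closed (range graph_map)" by simp
  then have 1: "closure Pts \<subseteq> range graph_map" using sub by (rule closure_minimal[rotated])
  have "range graph_map = graph_map ` closure {w. \<forall>v. w $ v \<in> \<rat>}" unfolding closure_rational_vectors ..
  also have "\<dots> \<subseteq> closure (graph_map ` {w. \<forall>v. w $ v \<in> \<rat>})"
    by (rule image_closure_subset[OF continuous_on_subset[OF continuous_graph_map] closed_closure closure_subset]) auto
  also have "\<dots> \<subseteq> closure Pts" by (rule closure_mono[OF sup])
  finally show ?thesis using 1 unfolding Trop_pos_def Pts_def by (rule subset_antisym[rotated])
qed

end

section \<open>Domains of linearity\<close>

definition lin_step :: "real \<Rightarrow> 'v::finite \<Rightarrow> ('v \<Rightarrow> 'v \<Rightarrow> real) \<Rightarrow> ('v \<Rightarrow> 'v \<Rightarrow> real) \<Rightarrow> 'v \<Rightarrow> 'v \<Rightarrow> real" where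
  "lin_step e k b a = (\<lambda>i j. if i = k then - a k j + (\<Sum>l\<in>UNIV. max 0 (- (e * b l k)) * a l j) else a i j)"

lemma xl_lin_step:
  assumes "\<And>i. p i = (\<Sum>j\<in>UNIV. a i j * z j)"
  shows "xl e k b p i = (\<Sum>j\<in>UNIV. lin_step e k b a i j * z j)"
proof -
  have "(\<Sum>l\<in>UNIV. max 0 (- (e * b l k)) * (\<Sum>j\<in>UNIV. a l j * z j))
      = (\<Sum>l\<in>UNIV. \<Sum>j\<in>UNIV. max 0 (- (e * b l k)) * a l j * z j)"
    by (simp add: sum_distrib_left mult.assoc)
  also have "\<dots> = (\<Sum>j\<in>UNIV. (\<Sum>l\<in>UNIV. max 0 (- (e * b l k)) * a l j) * z j)"
    by (subst sum.swap) (simp add: sum_distrib_right)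
  finally show ?thesis
    using assms by (simp add: xl_def lin_step_def left_diff_distrib sum_subtractf)
qed

lemma nth_vec_lambda: "($) (vec_lambda f) = f"
  by (simp add: fun_eq_iff)

context trop_cluster
begin

text \<open>By sign coherence all these points use the same linear piece of \<open>xm\<close> in
  each step.\<close>

lemma sink_linear:
  assumes "set ls \<subseteq> K"
  shows "\<exists>a. \<forall>z. sink [] z \<longrightarrow> (\<forall>i. X ls z i = (\<Sum>j\<in>UNIV. a i j * z j))"
  using assms
proof (induction ls rule: rev_induct)
  case Nil
  show ?case
    by (rule exI[of _ "\<lambda>i j. if j = i then 1 else 0"]) (simp add: if_distrib[of "\<lambda>x. x * _"] cong: if_cong)
next
  case (snoc k ls)
  then have k: "k \<in> K" "set ls \<subseteq> K" by auto
  obtain a where a: "\<And>z i. sink [] z \<Longrightarrow> X ls z i = (\<Sum>j\<in>UNIV. a i j * z j)"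
    using snoc.IH[OF k(2)] by blast
  \<comment> \<open>If no point has a positive y-variable, \<open>- 1\<close> is a correct choice
    for all of them; where the y-variable vanishes the two pieces agree.\<close>
  define e :: real where "e = (if \<exists>u. sink [] u \<and> Y ls u k > 0 then 1 else - 1)"
  have "X (ls @ [k]) z = xl e k (M ls) (X ls z)" if "sink [] z" for z
    unfolding X_snoc
  proof (rule xm_eq_xl)
    show "e = 1 \<and> Y ls z k \<ge> 0 \<or> e = - 1 \<and> Y ls z k \<le> 0"
    proof (cases "\<exists>u. sink [] u \<and> Y ls u k > 0")
      case True
      then show ?thesis using sign_coherence[OF _ that k(2,1)] by (auto simp: e_def)
    next
      case False
      then show ?thesis using that by (auto simp: e_def not_less)
    qed
  qed
  then have "X (ls @ [k]) z i = (\<Sum>j\<in>UNIV. lin_step e k (M ls) a i j * z j)" if "sink [] z" for z i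
    using xl_lin_step[of "X ls z" a z e k "M ls" i] a that by simp
  then show ?case by blast
qed

text \<open>Mutation in \<open>K\<close> expresses the new y-variables through those with index in
  \<open>K\<close>, so these form a closed system.\<close>

lemma yw_cong_K:
  assumes "set ls \<subseteq> K" "\<And>k. k \<in> K \<Longrightarrow> y k = y' k" "k \<in> K"
  shows "yw c y ls k = yw c y' ls k"
  using assms
proof (induction ls arbitrary: c y y')
  case (Cons l ls)
  show ?case
    unfolding yw.simps
    by (rule Cons.IH) (use Cons.prems in \<open>auto simp: ym_def\<close>)
qed simp

lemma Y_cong:
  assumes "set ls \<subseteq> K" "\<And>k. k \<in> K \<Longrightarrow> Y [] w k = Y [] w' k" "k \<in> K"
  shows "Y ls w k = Y ls w' k"
  using Y_append[of "[]" ls w] Y_append[of "[]" ls w'] yw_cong_K[where c=b, OF assms] by simp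

end

context cluster_setting
begin

section \<open>Cones of seeds and the charts on them\<close>

abbreviation "ty ks w k \<equiv> yv (bw \<beta> (map \<iota> ks)) (tx ks w) (\<iota> k)"

definition seed_cone :: "'n list \<Rightarrow> (real, 'v) vec set" where
  "seed_cone ks = {w. \<forall>k. ty ks w k \<le> 0}"

lemma range_words: "set (map \<iota> ks) \<subseteq> range \<iota>"
  by auto

lemma cone_cover: "\<exists>ks. w \<in> seed_cone ks"
proof -
  obtain ls where ls: "set ls \<subseteq> range \<iota>" "core.sink ls (($) w)"
    using core.sink_exists[of "[]" "($) w"] by auto
  then obtain ks where "ls = map \<iota> ks" using words_range by blast
  then show ?thesis using ls(2) unfolding seed_cone_def core.sink_def by auto
qed

lemma ty_onto: "\<exists>w. \<forall>k. ty ks w k = t k"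
proof -
  obtain p where "\<forall>k\<in>range \<iota>. core.Y (map \<iota> ks) p k = t (inv \<iota> k)"
    using core.Y_onto[OF range_words, of ks "\<lambda>k. t (inv \<iota> k)"] by blast
  moreover have "($) (\<chi> i. p i) = p" by (simp add: fun_eq_iff)
  ultimately have "\<forall>k. ty ks (\<chi> i. p i) k = t k" by simp
  then show ?thesis by blast
qed

lemma chart_onto_cone:
  assumes "\<And>k. yv (bw \<beta> (map \<iota> ks)) (($) z) (\<iota> k) \<le> 0"
  shows "\<exists>w\<in>seed_cone ks. (\<chi> i. tx ks w i) = z"
proof -
  define w where "w = (\<chi> i. xw (bw \<beta> (map \<iota> ks)) (($) z) (rev (map \<iota> ks)) i)"
  have "($) w = xw (bw \<beta> (map \<iota> ks)) (($) z) (rev (map \<iota> ks))"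
    unfolding w_def nth_vec_lambda ..
  then have "tx ks w = ($) z" using xw_rev'[OF skew_\<beta> dv_pos, of "map \<iota> ks" "($) z"] by simp
  then show ?thesis using assms by (intro bexI[of _ w]) (auto simp: seed_cone_def vec_eq_iff)
qed

lemma tx_from_chart: "xw (bw \<beta> (map \<iota> ks)) (tx ks w) (rev (map \<iota> ks) @ map \<iota> ls) = tx ls w"
  unfolding xw_append xw_rev[OF skew_\<beta> dv_pos] bw_rev[OF skew_\<beta> dv_pos] ..

lemma tx_linear_in_chart:
  "\<exists>N. linear N \<and> (\<forall>w\<in>seed_cone ks. (\<chi> i. tx ls w i) = N (\<chi> i. tx ks w i))"
proof -
  define W where "W = map \<iota> ks"
  have W: "set W \<subseteq> range \<iota>" unfolding W_def by (rule range_words)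
  interpret base: trop_cluster dv "range \<iota>" "bw \<beta> W" by (rule core.base_change[OF W])
  have sink: "base.sink [] (tx ks w) \<longleftrightarrow> w \<in> seed_cone ks" for w
    unfolding base.sink_def seed_cone_def by (auto simp: W_def)
  obtain a where a: "\<And>z i. base.sink [] z \<Longrightarrow> base.X (rev W @ map \<iota> ls) z i = (\<Sum>j\<in>UNIV. a i j * z j)"
    using base.sink_linear[of "rev W @ map \<iota> ls"] W range_words by auto
  define N where "N z = (\<chi> i. \<Sum>j\<in>UNIV. a i j * z $ j)" for z :: "(real, 'v) vec"
  have "linear N"
    by (rule linearI) (simp_all add: N_def vec_eq_iff distrib_left sum.distrib sum_distrib_left mult_ac)
  moreover have "(\<chi> i. tx ls w i) = N (\<chi> i. tx ks w i)" if "w \<in> seed_cone ks" for w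
    using a[of "tx ks w"] that sink tx_from_chart[of ks w ls] by (simp add: N_def vec_eq_iff W_def)
  ultimately show ?thesis by blast
qed

lemma yv_linear:
  "yv c (($) (x + y)) k = yv c (($) x) k + yv c (($) y) k"
  "yv c (($) (s *\<^sub>R x)) k = s * yv c (($) x) k"
  by (simp_all add: yv_def distrib_left sum.distrib sum_distrib_left mult_ac)

text \<open>On the cone of \<open>ks\<close> the coordinates of every seed are linear functions of the coordinates \<open>z\<close> of
  the seed \<open>ks\<close>; since \<open>z\<close> ranges over a full-dimensional cone, they are also linear functions of the initial ones.\<close>

lemma tx_linear_on_cone: "\<exists>l. linear l \<and> (\<forall>w\<in>seed_cone ks. tx ls w i = l w)"
proof -
  let ?y = "\<lambda>z k. yv (bw \<beta> (map \<iota> ks)) (($) z) (\<iota> k)"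
  obtain N0 where N0: "linear N0" "\<And>w. w \<in> seed_cone ks \<Longrightarrow> (\<chi> i. tx [] w i) = N0 (\<chi> i. tx ks w i)"
    using tx_linear_in_chart[of ks "[]"] by blast
  obtain N where N: "linear N" "\<And>w. w \<in> seed_cone ks \<Longrightarrow> (\<chi> i. tx ls w i) = N (\<chi> i. tx ks w i)"
    using tx_linear_in_chart[of ks ls] by blast
  have "inj N0"
  proof (rule linear_injective_0[OF N0(1), THEN iffD2], intro allI impI)
    fix z assume z: "N0 z = 0"
    obtain w1 where w1: "\<forall>k. ty ks w1 k = - 1" using ty_onto[of ks "\<lambda>_. - 1"] by blast
    define p where "p = (\<chi> i. tx ks w1 i)"
    have p: "?y p k = - 1" for k
      using w1 unfolding p_def nth_vec_lambda by blast
    \<comment> \<open>For this \<open>c\<close> both \<open>c *\<^sub>R p\<close> and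
      \<open>z + c *\<^sub>R p\<close> satisfy the inequalities of the cone. So \<open>z\<close> is
      a difference of chart images of cone points, and on those \<open>N0\<close> recovers the
      point.\<close>
    define c where "c = (\<Sum>k\<in>UNIV. \<bar>?y z k\<bar>)"
    have c: "?y z k \<le> c" for k
    proof -
      have "\<bar>?y z k\<bar> \<le> c" unfolding c_def by (rule member_le_sum) auto
      then show ?thesis by simp
    qed
    have "c \<ge> 0" unfolding c_def by (rule sum_nonneg) simp
    have "?y (c *\<^sub>R p) k \<le> 0" "?y (z + c *\<^sub>R p) k \<le> 0" for k
      unfolding yv_linear using p c[of k] \<open>c \<ge> 0\<close> by auto
    then obtain w w' where w: "w \<in> seed_cone ks" "(\<chi> i. tx ks w i) = c *\<^sub>R p"
      and w': "w' \<in> seed_cone ks" "(\<chi> i. tx ks w' i) = z + c *\<^sub>R p" using chart_onto_cone by metis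
    have "(\<chi> i. tx [] w i) = (\<chi> i. tx [] w' i)"
      unfolding N0(2)[OF w(1)] N0(2)[OF w'(1)] w(2) w'(2) linear_add[OF N0(1)] z by simp
    then have "w = w'" by (simp add: vec_eq_iff)
    then show "z = 0" using w(2) w'(2) by simp
  qed
  then obtain g where g: "linear g" "g \<circ> N0 = id"
    using linear_injective_left_inverse[OF N0(1)] by blast
  have "tx ls w i = (N (g w)) $ i" if "w \<in> seed_cone ks" for w
  proof -
    have "w = N0 (\<chi> i. tx ks w i)" using N0(2)[OF that] by (simp add: vec_eq_iff)
    then have "g w = (\<chi> i. tx ks w i)" using g(2) by (metis comp_apply id_apply)
    then show ?thesis using N(2)[OF that] by (metis vec_lambda_beta)
  qed
  moreover have "linear (\<lambda>w. (N (g w)) $ i)"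
    by (intro linearI) (simp_all add: linear_add[OF g(1)] linear_add[OF N(1)] linear_scale[OF g(1)] linear_scale[OF N(1)])
  ultimately show ?thesis by blast
qed

lemma ty_linear_on_cone: "\<exists>l. linear l \<and> (\<forall>w\<in>seed_cone ks. ty ls w k = l w)"
proof -
  obtain l where l: "\<And>i. linear (l i)" "\<And>i w. w \<in> seed_cone ks \<Longrightarrow> tx ls w i = l i w"
    using tx_linear_on_cone[of ks ls] by metis
  have "linear (\<lambda>w. \<Sum>i\<in>UNIV. bw \<beta> (map \<iota> ls) i (\<iota> k) * l i w)"
    by (rule linearI) (simp_all add: linear_add[OF l(1)] linear_scale[OF l(1)] distrib_left sum.distrib sum_distrib_left mult.left_commute)
  moreover have "ty ls w k = (\<Sum>i\<in>UNIV. bw \<beta> (map \<iota> ls) i (\<iota> k) * l i w)" if "w \<in> seed_cone ks" for w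
    using l(2)[OF that] by (simp add: yv_def)
  ultimately show ?thesis by blast
qed

end

context cluster_setting
begin

section \<open>Maximal domains of linearity\<close>

lemma seed_coneD: "w \<in> seed_cone ks \<Longrightarrow> ty ks w k \<le> 0"
  unfolding seed_cone_def by blast

text \<open>The inequalities defining the cone are a priori only piecewise linear in
  \<open>w\<close>. In the chart of \<open>ks\<close> they are linear, and on the cone the chart map
  is inverted by the linear map \<open>N\<close>.\<close>

lemma convex_cone_seed_cone: "convex_cone (seed_cone ks)"
proof -
  obtain N where N: "linear N" "\<And>w. w \<in> seed_cone ks \<Longrightarrow> w = N (\<chi> i. tx ks w i)"
    using tx_linear_in_chart[of ks "[]"] by (auto simp: vec_eq_iff)
  have chart: "yv (bw \<beta> (map \<iota> ks)) (($) (\<chi> i. tx ks w i)) (\<iota> k) \<le> 0" if "w \<in> seed_cone ks" for w k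
    using that unfolding nth_vec_lambda seed_cone_def by blast
  have image: "N z \<in> seed_cone ks" if "\<And>k. yv (bw \<beta> (map \<iota> ks)) (($) z) (\<iota> k) \<le> 0" for z
    using chart_onto_cone[of ks z, OF that] N(2) by metis
  show ?thesis
    unfolding convex_cone_iff
  proof (intro conjI ballI allI impI)
    have "N 0 \<in> seed_cone ks" by (rule image) (simp add: yv_def)
    then show "0 \<in> seed_cone ks" using linear_0[OF N(1)] by simp
  next
    fix x y assume xy: "x \<in> seed_cone ks" "y \<in> seed_cone ks"
    have "N ((\<chi> i. tx ks x i) + (\<chi> i. tx ks y i)) \<in> seed_cone ks"
      by (rule image, unfold yv_linear) (intro add_nonpos_nonpos chart xy)
    then show "x + y \<in> seed_cone ks"
      unfolding linear_add[OF N(1)] N(2)[OF xy(1), symmetric] N(2)[OF xy(2), symmetric] .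
  next
    fix x and c :: real assume x: "x \<in> seed_cone ks" "c \<ge> 0"
    have "N (c *\<^sub>R (\<chi> i. tx ks x i)) \<in> seed_cone ks"
      by (rule image, unfold yv_linear) (intro mult_nonneg_nonpos x chart)
    then show "c *\<^sub>R x \<in> seed_cone ks"
      unfolding linear_scale[OF N(1)] N(2)[OF x(1), symmetric] .
  qed
qed

lemma linearity_seed_cone: "linearity_cone \<iota> Bt (seed_cone ks)"
  unfolding linearity_cone_def
proof (intro conjI ballI convex_cone_seed_cone)
  fix f assume "f \<in> cluster_vars \<iota> Bt"
  then obtain ls i where "f = xs ls i" unfolding cluster_vars_eq by blast
  then show "\<exists>l. linear l \<and> (\<forall>w\<in>seed_cone ks. tropicalization f w = l w)"
    using tx_linear_on_cone[of ks ls i] by (simp add: tropicalization_xs)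
qed

lemma linearity_cone_tx:
  assumes "linearity_cone \<iota> Bt C"
  shows "\<exists>l. linear l \<and> (\<forall>w\<in>C. tx ks w i = l w)"
proof (cases "i \<in> range \<iota>")
  case True
  then have "xs ks i \<in> cluster_vars \<iota> Bt" unfolding cluster_vars_eq by blast
  then show ?thesis using assms unfolding linearity_cone_def by (metis tropicalization_xs)
next
  case False
  then have "tx ks w i = w $ i" for w
    using range_words[of ks] by (intro xw_fixed) blast
  moreover have "linear (\<lambda>w :: (real, 'v) vec. w $ i)" by (rule linearI) simp_all
  ultimately show ?thesis by blast
qed

text \<open>If different functions are strictly minimal at two points, then at the sum of the points
  the minimum strictly exceeds the sum of the two minima.\<close>

lemma min_linear_sign:
  fixes l p q :: "'a::real_vector \<Rightarrow> real"
  assumes C: "convex_cone C" and lin: "linear l" "linear p" "linear q"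
    and min: "\<And>w. w \<in> C \<Longrightarrow> min (p w) (q w) = l w"
  shows "(\<forall>w\<in>C. p w \<le> q w) \<or> (\<forall>w\<in>C. q w \<le> p w)"
proof (rule ccontr)
  assume "\<not> ((\<forall>w\<in>C. p w \<le> q w) \<or> (\<forall>w\<in>C. q w \<le> p w))"
  then obtain a b where "a \<in> C" "b \<in> C" "\<not> p a \<le> q a" "\<not> q b \<le> p b" by blast
  then have ab: "a \<in> C" "b \<in> C" "p a > q a" "q b > p b" by simp_all
  have "a + b \<in> C" using convex_cone_add[OF C] ab by blast
  then have "min (p a + p b) (q a + q b) = l a + l b"
    using min[of "a + b"] by (simp add: linear_add[OF lin(1)] linear_add[OF lin(2)] linear_add[OF lin(3)])
  also have "\<dots> = q a + p b" using min[OF ab(1)] min[OF ab(2)] ab by simp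
  finally show False using ab by (simp add: min_def split: if_splits)
qed

text \<open>The exchange relation at \<open>k\<close> makes a minimum of two linear functions linear
  on \<open>C\<close>. Their difference is the \<open>k\<close>-th y-variable, which therefore has
  constant weak sign.\<close>

lemma linearity_cone_ty:
  assumes "linearity_cone \<iota> Bt C"
  shows "\<exists>l. linear l \<and> (\<forall>w\<in>C. ty ks w k = l w) \<and> ((\<forall>w\<in>C. l w \<ge> 0) \<or> (\<forall>w\<in>C. l w \<le> 0))"
proof -
  have C: "convex_cone C" using assms by (simp add: linearity_cone_def)
  obtain x where x: "\<And>i. linear (x i)" "\<And>i w. w \<in> C \<Longrightarrow> tx ks w i = x i w"
    using linearity_cone_tx[OF assms, of ks] by metis
  obtain x' where x': "linear x'" "\<And>w. w \<in> C \<Longrightarrow> tx (ks @ [k]) w (\<iota> k) = x' w"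
    using linearity_cone_tx[OF assms, of "ks @ [k]" "\<iota> k"] by metis
  let ?b = "\<lambda>i. bw \<beta> (map \<iota> ks) i (\<iota> k)"
  have lin: "linear (\<lambda>w. \<Sum>i\<in>UNIV. c i * x i w)" for c
    by (rule linearI) (simp_all add: linear_add[OF x(1)] linear_scale[OF x(1)] distrib_left sum.distrib sum_distrib_left mult.left_commute)
  define p q where "p w = (\<Sum>i\<in>UNIV. max 0 (?b i) * x i w)" and "q w = (\<Sum>i\<in>UNIV. max 0 (- ?b i) * x i w)" for w
  have pq: "linear p" "linear q" unfolding p_def q_def by (rule lin)+
  have "min (p w) (q w) = x' w + x (\<iota> k) w" if "w \<in> C" for w
  proof -
    have "tx (ks @ [k]) w (\<iota> k) = - tx ks w (\<iota> k) + min (p w) (q w)"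
      unfolding p_def q_def x(2)[OF that, symmetric] by (simp add: xw_append xm_def)
    then show ?thesis using x(2)[OF that] x'(2)[OF that] by simp
  qed
  moreover have "linear (\<lambda>w. x' w + x (\<iota> k) w)" by (rule linear_compose_add[OF x'(1) x(1)])
  ultimately have "(\<forall>w\<in>C. p w \<le> q w) \<or> (\<forall>w\<in>C. q w \<le> p w)"
    using min_linear_sign[OF C _ pq] by blast
  moreover have "ty ks w k = p w - q w" if "w \<in> C" for w
    unfolding yv_pos_parts[of _ _ "\<iota> k"] x(2)[OF that] p_def q_def ..
  moreover have "linear (\<lambda>w. p w - q w)" by (rule linear_compose_sub[OF pq])
  ultimately show ?thesis
    by (intro exI[of _ "\<lambda>w. p w - q w"]) auto
qed

text \<open>A seed cone that contains a relative interior point \<open>p\<close> of \<open>C\<close>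
  contains \<open>C\<close>: each y-variable has constant sign on \<open>C\<close>, and
  \<open>p\<close> decides which.\<close>

lemma linearity_cone_subset:
  assumes "linearity_cone \<iota> Bt C"
  shows "\<exists>ks. C \<subseteq> seed_cone ks"
proof -
  have C: "convex C" "C \<noteq> {}" using assms by (auto simp: linearity_cone_def convex_cone_def)
  obtain p where p: "p \<in> rel_interior C" using rel_interior_eq_empty[OF C(1)] C(2) by blast
  obtain ks where ks: "p \<in> seed_cone ks" using cone_cover by blast
  have pC: "p \<in> C" using p rel_interior_subset by blast
  have "ty ks w k \<le> 0" if w: "w \<in> C" for w k
  proof -
    obtain l where l: "linear l" "\<And>w. w \<in> C \<Longrightarrow> ty ks w k = l w" "(\<forall>w\<in>C. l w \<ge> 0) \<or> (\<forall>w\<in>C. l w \<le> 0)"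
      using linearity_cone_ty[OF assms, of ks k] by blast
    have lp: "l p \<le> 0" using ks unfolding l(2)[OF pC, symmetric] seed_cone_def by blast
    show ?thesis
    proof (cases "\<forall>w\<in>C. l w \<le> 0")
      case True
      then show ?thesis using l(2)[OF w] w by simp
    next
      case False
      \<comment> \<open>A linear form that is nonnegative on \<open>C\<close> and zero at a relative
        interior point vanishes on \<open>C\<close>: prolong the segment from \<open>w\<close>
        beyond \<open>p\<close>.\<close>
      then have pos: "\<forall>w\<in>C. l w \<ge> 0" using l(3) by blast
      then have "l p = 0" using lp pC by force
      obtain e where e: "e > 1" "(1 - e) *\<^sub>R w + e *\<^sub>R p \<in> C"
        using convex_rel_interior_iff[OF C, of p] p w by blast
      have "l ((1 - e) *\<^sub>R w + e *\<^sub>R p) = (1 - e) * l w"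
        using \<open>l p = 0\<close> by (simp add: linear_add[OF l(1)] linear_scale[OF l(1)])
      then have "(1 - e) * l w \<ge> 0" using pos e(2) by metis
      then show ?thesis using e(1) l(2)[OF w] by (simp add: zero_le_mult_iff)
    qed
  qed
  then show ?thesis unfolding seed_cone_def by blast
qed

text \<open>A point of the cone with all y-variables \<open>- 1\<close> at \<open>ks\<close> decides
  their constant signs on any larger domain of linearity.\<close>

lemma seed_cone_maximal:
  assumes "linearity_cone \<iota> Bt C" "seed_cone ks \<subseteq> C"
  shows "C = seed_cone ks"
proof (rule subset_antisym)
  obtain w1 where w1: "\<forall>k. ty ks w1 k = - 1" using ty_onto[of ks "\<lambda>_. - 1"] by blast
  then have "w1 \<in> C" using assms(2) by (auto simp: seed_cone_def)
  have "ty ks w k \<le> 0" if w: "w \<in> C" for w k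
  proof -
    obtain l where l: "\<And>w. w \<in> C \<Longrightarrow> ty ks w k = l w" "(\<forall>w\<in>C. l w \<ge> 0) \<or> (\<forall>w\<in>C. l w \<le> 0)"
      using linearity_cone_ty[OF assms(1), of ks k] by blast
    have "l w1 = - 1" using l(1)[OF \<open>w1 \<in> C\<close>] w1 by simp
    then have "\<not> (\<forall>w\<in>C. l w \<ge> 0)" using \<open>w1 \<in> C\<close> by force
    then show ?thesis using l w by auto
  qed
  then show "C \<subseteq> seed_cone ks" unfolding seed_cone_def by blast
qed (rule assms(2))

lemma linearity_fan_eq: "linearity_fan \<iota> Bt = {F. F \<noteq> {} \<and> (\<exists>ks. F face_of seed_cone ks)}"
proof -
  have eq: "(linearity_cone \<iota> Bt C \<and> (\<forall>C'. linearity_cone \<iota> Bt C' \<and> C \<subseteq> C' \<longrightarrow> C' = C)) \<longleftrightarrow> (\<exists>ks. C = seed_cone ks)" for C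
  proof
    assume C: "linearity_cone \<iota> Bt C \<and> (\<forall>C'. linearity_cone \<iota> Bt C' \<and> C \<subseteq> C' \<longrightarrow> C' = C)"
    then obtain ks where "C \<subseteq> seed_cone ks" using linearity_cone_subset by blast
    then have "seed_cone ks = C" using C linearity_seed_cone[of ks] by blast
    then show "\<exists>ks. C = seed_cone ks" by blast
  next
    assume "\<exists>ks. C = seed_cone ks"
    then obtain ks where C: "C = seed_cone ks" ..
    show "linearity_cone \<iota> Bt C \<and> (\<forall>C'. linearity_cone \<iota> Bt C' \<and> C \<subseteq> C' \<longrightarrow> C' = C)"
      unfolding C using linearity_seed_cone seed_cone_maximal by blast
  qed
  have "(\<exists>C. linearity_cone \<iota> Bt C \<and> (\<forall>C'. linearity_cone \<iota> Bt C' \<and> C \<subseteq> C' \<longrightarrow> C' = C) \<and> F face_of C)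
      \<longleftrightarrow> (\<exists>ks. F face_of seed_cone ks)" for F
    unfolding conj_assoc[symmetric] eq[unfolded conj_assoc[symmetric]] by metis
  then show ?thesis unfolding linearity_fan_def by (simp only:)
qed

section \<open>Lineality space and faces of the seed cones\<close>

definition lin_space :: "(real, 'v) vec set" where
  "lin_space = {w. \<forall>k. ty [] w k = 0}"

lemma subspace_lin_space: "subspace lin_space"
  unfolding lin_space_def by (rule subspaceI) (simp_all add: yv_linear, simp add: yv_def)

text \<open>The y-variables evolve among themselves, so equal initial values stay equal at every
  seed. With the converse \<open>ty_determines\<close> this gives \<open>lin_space\<close> the same
  description at each seed.\<close>

lemma ty_translate:
  assumes "w - w' \<in> lin_space"
  shows "ty ks w k = ty ks w' k"
proof (rule core.Y_cong[OF range_words])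
  show "core.Y [] (($) w) j = core.Y [] (($) w') j" if "j \<in> range \<iota>" for j
  proof -
    obtain k where "j = \<iota> k" using \<open>j \<in> range \<iota>\<close> by blast
    moreover have "w = w' + (w - w')" by simp
    ultimately show ?thesis
      using assms yv_linear(1)[of \<beta> w' "w - w'" "\<iota> k"] by (auto simp: lin_space_def)
  qed
qed simp

lemma ty_determines:
  assumes "\<And>k. ty ks w k = ty ks w' k"
  shows "w - w' \<in> lin_space"
proof -
  define W where "W = map \<iota> ks"
  have W: "set W \<subseteq> range \<iota>" unfolding W_def by (rule range_words)
  interpret base: trop_cluster dv "range \<iota>" "bw \<beta> W" by (rule core.base_change[OF W])
  have "base.Y (rev W) (tx ks w) (\<iota> k) = base.Y (rev W) (tx ks w') (\<iota> k)" for k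
    by (rule base.Y_cong) (use W assms in \<open>auto simp: W_def\<close>)
  then have "ty [] w k = ty [] w' k" for k
    unfolding W_def xw_rev[OF skew_\<beta> dv_pos] bw_rev[OF skew_\<beta> dv_pos] by simp
  moreover have "ty [] w k = ty [] w' k + ty [] (w - w') k" for k
    using yv_linear(1)[of \<beta> w' "w - w'" "\<iota> k"] by simp
  ultimately show ?thesis unfolding lin_space_def by simp
qed

text \<open>\<open>J\<close> lists the y-variables that may be nonzero, so that \<open>T\<close>
  will send the face to the cone of the g-vectors with index in \<open>J\<close>.\<close>

definition face :: "'n list \<Rightarrow> 'n set \<Rightarrow> (real, 'v) vec set" where
  "face ks J = {w \<in> seed_cone ks. \<forall>k. k \<notin> J \<longrightarrow> ty ks w k = 0}"

lemma face_translate: "w' \<in> face ks J \<Longrightarrow> w - w' \<in> lin_space \<Longrightarrow> w \<in> face ks J"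
  using ty_translate[of w w' ks] by (simp add: face_def seed_cone_def)

lemma ty_linear_form:
  "\<exists>l. (\<forall>k. linear (l k)) \<and> (\<forall>w k. w \<in> seed_cone ks \<longrightarrow> ty ks w k = l k w)"
  using ty_linear_on_cone[of ks ks] by metis

lemma convex_cone_face: "convex_cone (face ks J)"
proof -
  obtain l where l: "\<And>k. linear (l k)" "\<And>w k. w \<in> seed_cone ks \<Longrightarrow> ty ks w k = l k w"
    using ty_linear_form[of ks] by blast
  have eq: "face ks J = {w \<in> seed_cone ks. \<forall>k. k \<notin> J \<longrightarrow> l k w = 0}" using l(2) by (auto simp: face_def)
  show ?thesis
    using convex_cone_seed_cone[of ks] unfolding eq convex_cone_iff
    by (simp add: linear_add[OF l(1)] linear_scale[OF l(1)] linear_0[OF l(1)])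
qed

lemma face_face_of: "face ks J face_of seed_cone ks"
  unfolding face_of_def
proof (intro conjI ballI impI)
  show "face ks J \<subseteq> seed_cone ks" by (auto simp: face_def)
  show "convex (face ks J)" using convex_cone_face by (simp add: convex_cone_def)
  fix a b x assume a: "a \<in> seed_cone ks" and b: "b \<in> seed_cone ks" and x: "x \<in> face ks J" and seg: "x \<in> open_segment a b"
  obtain l where l: "\<And>k. linear (l k)" "\<And>w k. w \<in> seed_cone ks \<Longrightarrow> ty ks w k = l k w"
    using ty_linear_form[of ks] by blast
  obtain t where t: "0 < t" "t < 1" "x = (1 - t) *\<^sub>R a + t *\<^sub>R b" using seg by (auto simp: in_segment)
  have "ty ks a k = 0 \<and> ty ks b k = 0" if "k \<notin> J" for k
  proof -
    have "l k a \<le> 0" "l k b \<le> 0" using seed_coneD[OF a, of k] seed_coneD[OF b, of k] l(2)[OF a, of k] l(2)[OF b, of k] by linarith+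
    moreover have "(1 - t) * l k a + t * l k b = 0"
      using x l(2)[of x k] that t(3) by (simp add: face_def linear_add[OF l(1)] linear_scale[OF l(1)])
    moreover have "(1 - t) * l k a \<le> 0" "t * l k b \<le> 0"
      using calculation t by (auto intro: mult_nonneg_nonpos)
    ultimately have "(1 - t) * l k a = 0" "t * l k b = 0" by linarith+
    then show ?thesis using t l(2)[OF a] l(2)[OF b] by simp
  qed
  then show "a \<in> face ks J" "b \<in> face ks J" using a b by (auto simp: face_def)
qed

text \<open>\<open>J\<close> collects the y-variables not identically zero on \<open>F\<close>;
  averaging yields a point \<open>f\<close> of \<open>F\<close> at which all of them are negative. A
  point \<open>w\<close> of \<open>face ks J\<close> either equals \<open>f\<close> or is an end of
  a segment in the seed cone with \<open>f\<close> in its interior, hence lies in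
  \<open>F\<close>.\<close>

lemma face_of_seed_cone:
  assumes F: "F face_of seed_cone ks" "F \<noteq> {}"
  shows "\<exists>J. F = face ks J"
proof -
  obtain l where l: "\<And>k. linear (l k)" "\<And>w k. w \<in> seed_cone ks \<Longrightarrow> ty ks w k = l k w"
    using ty_linear_form[of ks] by blast
  define J where "J = {k. \<exists>w\<in>F. l k w \<noteq> 0}"
  have sub: "F \<subseteq> seed_cone ks" and conv: "convex F" using F(1) by (auto simp: face_of_def)
  have neg: "l k w \<le> 0" if "w \<in> seed_cone ks" for k w using l(2)[OF that, of k] seed_coneD[OF that, of k] by linarith
  have ex: "\<exists>f\<in>F. \<forall>k\<in>I. l k f < 0" if "finite I" "I \<subseteq> J" for I
    using that
  proof (induction I rule: finite_induct)
    case empty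
    then show ?case using F(2) by auto
  next
    case (insert k I)
    then have "I \<subseteq> J" "k \<in> J" by auto
    then obtain f where f: "f \<in> F" "\<forall>k\<in>I. l k f < 0" using insert.IH by blast
    obtain f' where f'0: "f' \<in> F" "l k f' \<noteq> 0" using \<open>k \<in> J\<close> unfolding J_def by blast
    have f': "f' \<in> F" "l k f' < 0" using f'0 neg[OF subsetD[OF sub f'0(1)], of k] by auto
    define h where "h = (1/2) *\<^sub>R f + (1/2) *\<^sub>R f'"
    have "h \<in> F" unfolding h_def by (rule convexD[OF conv f(1) f'(1)]) auto
    moreover have eqh: "l j h = (l j f + l j f') / 2" for j
      by (simp add: h_def linear_add[OF l(1)] linear_scale[OF l(1)] add_divide_distrib)
    moreover have le: "l j f \<le> 0" "l j f' \<le> 0" for j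
      using neg[OF subsetD[OF sub f(1)]] neg[OF subsetD[OF sub f'(1)]] by blast+
    have "l j h < 0" if "j \<in> insert k I" for j
      unfolding eqh using that f(2) f'(2) le[of j] by (cases "j = k") (auto intro: add_neg_nonpos add_nonpos_neg)
    ultimately show ?case by blast
  qed
  obtain f where f: "f \<in> F" "\<And>k. k \<in> J \<Longrightarrow> l k f < 0" using ex[of J] by (metis finite subset_refl)
  have "F = face ks J"
  proof (rule subset_antisym)
    show "F \<subseteq> face ks J"
    proof
      fix w assume w: "w \<in> F"
      then have "l k w = 0" if "k \<notin> J" for k using that unfolding J_def by blast
      then show "w \<in> face ks J" using l(2)[OF subsetD[OF sub w]] subsetD[OF sub w] by (simp add: face_def)
    qed
    show "face ks J \<subseteq> F"
    proof
      fix w assume w: "w \<in> face ks J"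
      then have wC: "w \<in> seed_cone ks" by (simp add: face_def)
      have w0: "l k w = 0" if "k \<notin> J" for k using w that l(2)[OF wC, of k] by (simp add: face_def)
      define c where "c = (\<Sum>k\<in>J. l k w / l k f)"
      have c0: "c \<ge> 0" unfolding c_def
        using neg[OF wC] f(2) by (intro sum_nonneg divide_nonpos_neg) auto
      \<comment> \<open>\<open>c\<close> bounds the ratios of the forms at \<open>w\<close> and at
        \<open>f\<close>, so \<open>t\<close> times any form at \<open>w\<close> stays above its
        value at \<open>f\<close>; the summand 2 keeps \<open>t\<close> below 1 even if
        \<open>c\<close> is 0.\<close>
      define t where "t = 1 / (c + 2)"
      have t: "0 < t" "t < 1" using c0 by (auto simp: t_def)
      have le: "l k f \<le> t * l k w" for k
      proof (cases "k \<in> J")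
        case True
        have "l k w / l k f \<le> c" unfolding c_def
          using neg[OF wC] f(2) True by (intro member_le_sum divide_nonpos_neg) auto
        then have "l k w \<ge> c * l k f" using f(2)[OF True] by (simp add: neg_divide_le_eq)
        moreover have "c * l k f \<ge> (c + 2) * l k f" using f(2)[OF True] by (simp add: algebra_simps)
        ultimately show ?thesis using c0 by (simp add: t_def field_simps)
      next
        case False
        have "f \<in> seed_cone ks" using f(1) sub by blast
        from neg[OF this, of k] show ?thesis using w0[OF False] by simp
      qed
      \<comment> \<open>Linearity of the y-variables is known on the cone only, so
        \<open>f - t *\<^sub>R w\<close> cannot be tested directly. A point \<open>a'\<close> with
        the expected y-variables does lie in the cone, and it differs from
        \<open>f - t *\<^sub>R w\<close> by an element of \<open>lin_space\<close>.\<close>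
      obtain a' where a': "\<forall>k. ty ks a' k = l k f - t * l k w" using ty_onto[of ks "\<lambda>k. l k f - t * l k w"] by blast
      have a'C: "a' \<in> seed_cone ks" using a' le by (simp add: seed_cone_def)
      have fC: "f \<in> seed_cone ks" using f(1) sub by blast
      have tw: "t *\<^sub>R w \<in> seed_cone ks" using convex_cone_scaleR[OF convex_cone_seed_cone _ wC] t by simp
      have sumC: "a' + t *\<^sub>R w \<in> seed_cone ks" using convex_cone_add[OF convex_cone_seed_cone a'C tw] .
      have "ty ks f k = ty ks (a' + t *\<^sub>R w) k" for k
      proof -
        have "ty ks (a' + t *\<^sub>R w) k = l k a' + t * l k w"
          using l(2)[OF sumC, of k] by (simp add: linear_add[OF l(1)] linear_scale[OF l(1)])
        then show ?thesis using a' l(2)[OF a'C, of k] l(2)[OF fC, of k] by simp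
      qed
      then have "(f - t *\<^sub>R w) - a' \<in> lin_space" using ty_determines[of ks f "a' + t *\<^sub>R w"] by (simp add: algebra_simps)
      then have "f - t *\<^sub>R w \<in> seed_cone ks"
        using face_translate[of a' ks UNIV "f - t *\<^sub>R w"] a'C by (simp add: face_def)
      then have aC: "(1 / (1 - t)) *\<^sub>R (f - t *\<^sub>R w) \<in> seed_cone ks"
        using convex_cone_scaleR[OF convex_cone_seed_cone, of "1 / (1 - t)"] t by simp
      define a where "a = (1 / (1 - t)) *\<^sub>R (f - t *\<^sub>R w)"
      have fa: "f = (1 - t) *\<^sub>R a + t *\<^sub>R w" using t by (simp add: a_def)
      show "w \<in> F"
      proof (cases "a = w")
        case True
        then have "f = w" unfolding fa by (simp add: algebra_simps)
        then show ?thesis using f(1) by simp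
      next
        case False
        then have "f \<in> open_segment a w" using fa t by (auto simp: in_segment)
        then show ?thesis using face_ofD[OF F(1) _ aC[folded a_def] wC f(1)] by blast
      qed
    qed
  qed
  then show ?thesis ..
qed

lemma linearity_fan_faces: "linearity_fan \<iota> Bt = {face ks J | ks J. True}"
proof -
  have "face ks J \<noteq> {}" for ks J using convex_cone_face by (rule convex_cone_nonempty)
  then show ?thesis unfolding linearity_fan_eq using face_of_seed_cone face_face_of by blast
qed

end

section \<open>Degrees and g-vectors\<close>

lemma seed_subtraction_free:
  assumes "s \<in> seeds \<iota> Bt"
  shows "\<exists>g. subtraction_free (fst s i) g"
  using assms
proof (induction arbitrary: i)
  case initial
  then show ?case using subtraction_free_var by auto
next
  case (mutation s k)
  then obtain g where "\<And>i. subtraction_free (fst s i) (g i)" by metis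
  then have "subtraction_free (exchange \<iota> k s)
      (\<lambda>w. min (\<Sum>i | snd s $ i $ k > 0. real (nat (snd s $ i $ k)) * g i w)
        (\<Sum>i | snd s $ i $ k < 0. real (nat (- (snd s $ i $ k))) * g i w) - g (\<iota> k) w)"
    unfolding exchange_def
    by (intro subtraction_free_divide subtraction_free_add subtraction_free_prod subtraction_free_power) auto
  then have "\<exists>h. subtraction_free (exchange \<iota> k s) h" by blast
  then show ?case using mutation.IH[of i] by (auto simp: mutate_def)
qed

text \<open>A subtraction-free function has a positive value at the point with all coordinates
  1.\<close>

lemma subtraction_free_nonzero:
  assumes "subtraction_free f g"
  shows "f \<noteq> 0"
proof
  assume "f = 0"
  obtain e where e: "sf_eval e = f" using assms by (auto simp: subtraction_free_def)
  obtain z where z: "z \<in> pos_puiseux" "rat_eval (\<lambda>_. 1) f z"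
    using sf_eval_pos[of "\<lambda>_. 1" e] pos_puiseux_1 e by blast
  have "rat_eval (\<lambda>_. 1) 0 0"
    unfolding rat_eval_def Zero_fract_def by (intro exI[of _ 0] exI[of _ 1]) simp
  then show False using z rat_eval_unique pos_puiseux_nonzero \<open>f = 0\<close> by blast
qed

context
  fixes B :: "('n::{finite,linorder}, 'n) int_matrix"
begin

definition mon_degree :: "('n + 'n \<Rightarrow>\<^sub>0 nat) \<Rightarrow> (int, 'n) vec" where
  "mon_degree a = (\<Sum>v\<in>UNIV. int (Poly_Mapping.lookup a v) *s var_degree B v)"

lemma homogeneous_poly_iff: "homogeneous_poly B p d \<longleftrightarrow> (\<forall>a\<in>Poly_Mapping.keys p. mon_degree a = d)"
  by (simp add: homogeneous_poly_def mon_degree_def)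

lemma mon_degree_add: "mon_degree (a + c) = mon_degree a + mon_degree c"
  by (simp add: mon_degree_def lookup_add sum.distrib vec_eq_iff distrib_right)

lemma homogeneous_mult:
  assumes "homogeneous_poly B p d" "homogeneous_poly B q e"
  shows "homogeneous_poly B (p * q) (d + e)"
proof -
  have "mon_degree m = d + e" if "m \<in> Poly_Mapping.keys (p * q)" for m
  proof -
    obtain a c where "m = a + c" "a \<in> Poly_Mapping.keys p" "c \<in> Poly_Mapping.keys q"
      using subsetD[OF keys_mult \<open>m \<in> Poly_Mapping.keys (p * q)\<close>] by blast
    then show ?thesis using assms by (simp add: homogeneous_poly_iff mon_degree_add)
  qed
  then show ?thesis by (simp add: homogeneous_poly_iff)
qed

lemma homogeneous_add:
  assumes "homogeneous_poly B p d" "homogeneous_poly B q d"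
  shows "homogeneous_poly B (p + q) d"
  using assms keys_add[of p q] unfolding homogeneous_poly_iff by blast

lemma homogeneous_unique:
  assumes "homogeneous_poly B p d" "homogeneous_poly B p e" "p \<noteq> 0"
  shows "d = e"
  using assms unfolding homogeneous_poly_iff by (metis all_not_in_conv keys_eq_empty)

lemma homogeneous_1: "homogeneous_poly B 1 0"
  unfolding homogeneous_poly_iff by (simp add: mon_degree_def)

text \<open>Cross-multiplication reduces to one nonzero polynomial with two degrees. Zero is
  excluded because the zero polynomial is homogeneous of every degree.\<close>

lemma has_degree_unique:
  assumes "has_degree B f d" "has_degree B f e" "f \<noteq> 0"
  shows "d = e"
proof -
  obtain p q a c where 1: "q \<noteq> 0" "f = Fract p q" "homogeneous_poly B p a" "homogeneous_poly B q c" "d = a - c"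
    using assms(1) unfolding has_degree_def by blast
  obtain p' q' a' c' where 2: "q' \<noteq> 0" "f = Fract p' q'" "homogeneous_poly B p' a'" "homogeneous_poly B q' c'" "e = a' - c'"
    using assms(2) unfolding has_degree_def by blast
  have eq: "p * q' = p' * q" using 1(1,2) 2(1,2) eq_fract(1) by metis
  have "p \<noteq> 0" using 1(2) assms(3) by (metis eq_fract(3) fract_collapse(1) mult_zero_left rat_number_collapse)
  then have "p * q' \<noteq> 0" using 2(1) by simp
  moreover have "homogeneous_poly B (p * q') (a + c')" using homogeneous_mult[OF 1(3) 2(4)] .
  moreover have "homogeneous_poly B (p * q') (a' + c)" unfolding eq using homogeneous_mult[OF 2(3) 1(4)] .
  ultimately have "a + c' = a' + c" using homogeneous_unique by blast
  then show ?thesis unfolding 1(5) 2(5) by (simp add: algebra_simps)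
qed

lemma has_degree_mult:
  assumes "has_degree B f d" "has_degree B g e"
  shows "has_degree B (f * g) (d + e)"
proof -
  obtain p q a c where 1: "q \<noteq> 0" "f = Fract p q" "homogeneous_poly B p a" "homogeneous_poly B q c" "d = a - c"
    using assms(1) unfolding has_degree_def by blast
  obtain p' q' a' c' where 2: "q' \<noteq> 0" "g = Fract p' q'" "homogeneous_poly B p' a'" "homogeneous_poly B q' c'" "e = a' - c'"
    using assms(2) unfolding has_degree_def by blast
  show ?thesis
    unfolding has_degree_def
    by (intro exI[of _ "p * p'"] exI[of _ "q * q'"] exI[of _ "a + a'"] exI[of _ "c + c'"] conjI homogeneous_mult)
       (use 1 2 in \<open>auto simp: algebra_simps\<close>)
qed

lemma has_degree_add:
  assumes "has_degree B f d" "has_degree B g d"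
  shows "has_degree B (f + g) d"
proof -
  obtain p q a c where 1: "q \<noteq> 0" "f = Fract p q" "homogeneous_poly B p a" "homogeneous_poly B q c" "d = a - c"
    using assms(1) unfolding has_degree_def by blast
  obtain p' q' a' c' where 2: "q' \<noteq> 0" "g = Fract p' q'" "homogeneous_poly B p' a'" "homogeneous_poly B q' c'" "d = a' - c'"
    using assms(2) unfolding has_degree_def by blast
  have e: "a' + c = a + c'" using 1(5) 2(5) by (metis add.commute add_diff_eq diff_add_cancel diff_diff_eq2)
  have "homogeneous_poly B (p * q' + p' * q) (a + c')"
    by (rule homogeneous_add[OF homogeneous_mult[OF 1(3) 2(4)]], subst e[symmetric], rule homogeneous_mult[OF 2(3) 1(4)])
  moreover have "d = (a + c') - (c + c')" unfolding 1(5) by simp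
  ultimately show ?thesis
    unfolding has_degree_def using homogeneous_mult[OF 1(4) 2(4)] 1(1,2) 2(1,2)
    by (intro exI[of _ "p * q' + p' * q"] exI[of _ "q * q'"] exI[of _ "a + c'"] exI[of _ "c + c'"]) auto
qed

lemma has_degree_inverse:
  assumes "has_degree B f d" "f \<noteq> 0"
  shows "has_degree B (inverse f) (- d)"
proof -
  obtain p q a c where 1: "q \<noteq> 0" "f = Fract p q" "homogeneous_poly B p a" "homogeneous_poly B q c" "d = a - c"
    using assms(1) unfolding has_degree_def by blast
  have "p \<noteq> 0" using 1(2) assms(2) by (metis eq_fract(3) fract_collapse(1) mult_zero_left rat_number_collapse)
  then show ?thesis
    unfolding has_degree_def using 1
    by (intro exI[of _ q] exI[of _ p] exI[of _ c] exI[of _ a]) auto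
qed

lemma has_degree_1: "has_degree B 1 0"
  unfolding has_degree_def One_fract_def using homogeneous_1
  by (intro exI[of _ 1] exI[of _ 0]) auto

lemma has_degree_power: "has_degree B f d \<Longrightarrow> has_degree B (f ^ n) (int n *s d)"
proof (induction n)
  case (Suc n)
  then show ?case using has_degree_mult[of f d "f ^ n" "int n *s d"] by (simp add: vec_eq_iff distrib_right)
qed (simp add: has_degree_1)

lemma has_degree_prod:
  assumes "finite I" "\<And>i. i \<in> I \<Longrightarrow> has_degree B (f i) (d i)"
  shows "has_degree B (prod f I) (\<Sum>i\<in>I. d i)"
  using assms by (induction I rule: finite_induct) (simp_all add: has_degree_1 has_degree_mult)

lemma has_degree_var: "has_degree B (rf_var v) (var_degree B v)"
proof -
  have "mon_degree (Poly_Mapping.single v 1) = (\<Sum>u\<in>UNIV. if u = v then var_degree B v else 0)"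
    unfolding mon_degree_def by (rule sum.cong) (auto simp: lookup_single when_def)
  then have "mon_degree (Poly_Mapping.single v 1) = var_degree B v" by simp
  then have "homogeneous_poly B (Poly_Mapping.single (Poly_Mapping.single v 1) 1) (var_degree B v)"
    by (simp add: homogeneous_poly_iff)
  then show ?thesis
    unfolding has_degree_def rf_var_def using homogeneous_1
    by (intro exI[of _ "Poly_Mapping.single (Poly_Mapping.single v 1) 1"] exI[of _ 1] exI[of _ "var_degree B v"] exI[of _ 0]) auto
qed

lemma g_vector_eq:
  assumes "has_degree B f d" "f \<noteq> 0"
  shows "g_vector B f = (\<chi> i. real_of_int (d $ i))"
proof -
  have "(THE d. has_degree B f d) = d" using assms has_degree_unique by blast
  then show ?thesis by (simp add: g_vector_def)
qed

lemma int_pos_part_sum: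
  fixes c :: "'a::finite \<Rightarrow> int" and D :: "'a \<Rightarrow> int^'m"
  shows "(\<Sum>i | c i > 0. int (nat (c i)) *s D i) = (\<Sum>i\<in>UNIV. max 0 (c i) *s D i)"
  by (rule sum.mono_neutral_cong_left) auto

text \<open>By \<open>hom\<close> the positive and the negative exchange monomial have the same
  degree, so their sum is homogeneous.\<close>

lemma has_degree_exchange:
  assumes deg: "\<And>v. has_degree B (fst s v) (D v)" and nz: "fst s (Inl k) \<noteq> 0"
    and hom: "(\<Sum>v\<in>UNIV. snd s $ v $ k *s D v) = 0"
  shows "has_degree B (exchange Inl k s) (- D (Inl k) + (\<Sum>v\<in>UNIV. max 0 (snd s $ v $ k) *s D v))"
proof -
  let ?b = "\<lambda>v. snd s $ v $ k"
  have P: "has_degree B (\<Prod>i | ?b i > 0. fst s i ^ nat (?b i)) (\<Sum>v\<in>UNIV. max 0 (?b v) *s D v)"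
    unfolding int_pos_part_sum[symmetric] by (intro has_degree_prod has_degree_power deg) auto
  have "has_degree B (\<Prod>i | ?b i < 0. fst s i ^ nat (- ?b i)) (\<Sum>i | ?b i < 0. int (nat (- ?b i)) *s D i)"
    by (intro has_degree_prod has_degree_power deg) auto
  then have "has_degree B (\<Prod>i | ?b i < 0. fst s i ^ nat (- ?b i)) (\<Sum>v\<in>UNIV. max 0 (- ?b v) *s D v)"
    unfolding int_pos_part_sum[of "\<lambda>i. - ?b i" D, symmetric] neg_0_less_iff_less .
  moreover have "(\<Sum>v\<in>UNIV. max 0 (- ?b v) *s D v) = (\<Sum>v\<in>UNIV. max 0 (?b v) *s D v)"
  proof -
    have "(\<Sum>v\<in>UNIV. max 0 (?b v) *s D v) - (\<Sum>v\<in>UNIV. max 0 (- ?b v) *s D v) = (\<Sum>v\<in>UNIV. ?b v *s D v)"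
      unfolding sum_subtractf[symmetric]
      by (rule sum.cong) (auto simp: vec_eq_iff max_def)
    then show ?thesis using hom by simp
  qed
  ultimately have Q: "has_degree B (\<Prod>i | ?b i < 0. fst s i ^ nat (- ?b i)) (\<Sum>v\<in>UNIV. max 0 (?b v) *s D v)"
    by (simp only:)
  show ?thesis
    unfolding exchange_def divide_inverse
    using has_degree_mult[OF has_degree_add[OF P Q] has_degree_inverse[OF deg nz]] by (simp add: add.commute)
qed

text \<open>The degrees of a seed are a point of its chart at which all tropical y-variables vanish, so this
  property is preserved by mutation.\<close>

lemma balanced_mutate:
  assumes hom: "\<And>l. (\<Sum>v\<in>UNIV. b $ v $ l *s D v) = 0" and b0: "b $ Inl k $ k = 0"
  shows "(\<Sum>v\<in>UNIV. mutate_matrix Inl k b $ v $ l *s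
    (D(Inl k := - D (Inl k) + (\<Sum>v\<in>UNIV. max 0 (b $ v $ k) *s D v))) v) = (0 :: int^'m)"
proof -
  define P where "P = (\<Sum>v\<in>UNIV. max 0 (b $ v $ k) *s D v)"
  have N: "(\<Sum>v\<in>UNIV. max 0 (- (b $ v $ k)) *s D v) = P"
  proof -
    have "P - (\<Sum>v\<in>UNIV. max 0 (- (b $ v $ k)) *s D v) = (\<Sum>v\<in>UNIV. b $ v $ k *s D v)"
      unfolding P_def sum_subtractf[symmetric]
      by (rule sum.cong) (auto simp: vec_eq_iff max_def)
    then show ?thesis using hom by simp
  qed
  define D' where "D' = D(Inl k := - D (Inl k) + P)"
  show ?thesis
  proof (cases "l = k")
    case True
    have "(\<Sum>v\<in>UNIV. mutate_matrix Inl k b $ v $ l *s D' v) = (\<Sum>v\<in>UNIV. - (b $ v $ k *s D v))"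
      by (rule sum.cong) (auto simp: True mutate_matrix_def D'_def b0 vec_eq_iff)
    then show ?thesis using hom[of k] by (simp add: sum_negf D'_def P_def)
  next
    case False
    let ?c = "b $ Inl k $ l"
    have form: "sgn x * max 0 (x * c) = x * max 0 c + max 0 (- x) * c" for x c :: int
      by (cases "x > 0"; cases "x = 0"; cases "c \<ge> 0") (auto simp: max_def mult_le_0_iff zero_le_mult_iff)
    have "(\<Sum>v\<in>UNIV. mutate_matrix Inl k b $ v $ l *s D' v)
        = (\<Sum>v\<in>UNIV. b $ v $ l *s D v + max 0 ?c *s (b $ v $ k *s D v) + ?c *s (max 0 (- (b $ v $ k)) *s D v)
            + (if v = Inl k then - ?c *s P else 0))"
    proof (rule sum.cong)
      fix v
      show "mutate_matrix Inl k b $ v $ l *s D' v = b $ v $ l *s D v + max 0 ?c *s (b $ v $ k *s D v)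
          + ?c *s (max 0 (- (b $ v $ k)) *s D v) + (if v = Inl k then - ?c *s P else 0)"
      proof (cases "v = Inl k")
        case True
        then show ?thesis
          using b0 by (simp add: mutate_matrix_def D'_def vec_eq_iff algebra_simps)
      next
        case v: False
        then show ?thesis
          using False form[of "b $ v $ k" ?c] by (simp add: mutate_matrix_def D'_def vec_eq_iff algebra_simps)
      qed
    qed simp
    also have "\<dots> = (\<Sum>v\<in>UNIV. b $ v $ l *s D v) + max 0 ?c *s (\<Sum>v\<in>UNIV. b $ v $ k *s D v)
        + ?c *s (\<Sum>v\<in>UNIV. max 0 (- (b $ v $ k)) *s D v) - ?c *s P"
      by (simp add: sum.distrib vec_eq_iff sum_distrib_left mult.assoc)
    also have "\<dots> = 0" unfolding hom N by simp
    finally show ?thesis unfolding D'_def P_def .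
  qed
qed

end

context cluster_setting
begin

section \<open>Principal coefficients\<close>

abbreviation "B \<equiv> principal_part \<iota> Bt"

definition pseed :: "'n list \<Rightarrow> ('n, 'n + 'n) seed" where
  "pseed ks = foldl (\<lambda>s k. mutate Inl k s) (rf_var, principal_ext B) ks"

lemma pseed_simps: "pseed [] = (rf_var, principal_ext B)" "pseed (ks @ [k]) = mutate Inl k (pseed ks)"
  by (simp_all add: pseed_def)

lemma principal_seeds_eq: "seeds Inl (principal_ext B) = range pseed"
proof (intro subset_antisym subsetI)
  fix s assume "s \<in> seeds Inl (principal_ext B)"
  then show "s \<in> range pseed"
  proof induction
    case initial
    show ?case unfolding pseed_simps(1)[symmetric] by (rule rangeI)
  next
    case (mutation s k)
    then obtain ks where s: "s = pseed ks" by blast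
    show ?case unfolding s pseed_simps(2)[symmetric] by (rule rangeI)
  qed
next
  fix s assume "s \<in> range pseed"
  then obtain ks where s: "s = pseed ks" by blast
  show "s \<in> seeds Inl (principal_ext B)"
    unfolding s by (induction ks rule: rev_induct) (auto simp: pseed_simps intro: seeds.intros)
qed

abbreviation "bp ks \<equiv> snd (pseed ks)"

lemma bp_Inl: "bp ks $ Inl i $ k = bs ks $ \<iota> i $ k"
proof (induction ks arbitrary: i k rule: rev_induct)
  case Nil
  then show ?case by (simp add: pseed_simps seedw_simps principal_ext_def principal_part_def)
next
  case (snoc l ks)
  have "\<iota> i = \<iota> l \<longleftrightarrow> i = l" using inj by (metis injD)
  then show ?case by (simp add: pseed_simps seedw_simps mutate_def mutate_matrix_def snoc.IH)
qed

lemma bp_diag: "bp ks $ Inl k $ k = 0"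
  using core.diag_M[of "map \<iota> ks" "\<iota> k"] unfolding bp_Inl bw_\<beta> by simp

lemma ty_snoc: "ty (ks @ [k]) w l = (if l = k then - ty ks w k else ty ks w l
    + max 0 (real_of_int (bs ks $ \<iota> k $ l)) * ty ks w k - real_of_int (bs ks $ \<iota> k $ l) * min 0 (ty ks w k))"
proof -
  have "\<iota> l = \<iota> k \<longleftrightarrow> l = k" using inj by (metis injD)
  then show ?thesis
    using fun_cong[OF core.Y_snoc[of "map \<iota> ks" "\<iota> k" "($) w"], of "\<iota> l"] by (simp add: ym_def bw_\<beta>)
qed

text \<open>A frozen row of the principal coefficient matrix obeys the recursion of y-variables,
  here started from a unit vector. The c-vector of \<open>k\<close> collects these values over all
  \<open>j\<close>; since such points \<open>u\<close> lie in \<open>pos_cone\<close>, its sign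
  coherence follows from that of points.\<close>

lemma bp_Inr:
  assumes "\<And>l. ty [] u l = (if l = j then 1 else 0)"
  shows "real_of_int (bp ks $ Inr j $ k) = ty ks u k"
proof (induction ks arbitrary: k rule: rev_induct)
  case Nil
  then show ?case using assms by (auto simp: pseed_simps principal_ext_def)
next
  case (snoc l ks)
  have form: "sgn x * max 0 (x * c) = max 0 c * x - c * min 0 x" for x c :: real
    by (cases "x > 0"; cases "x = 0"; cases "c \<ge> 0")
       (auto simp: max_def min_def sgn_if mult_le_0_iff zero_le_mult_iff)
  have of: "real_of_int (sgn x * max 0 y) = sgn (real_of_int x) * max 0 (real_of_int y)" for x y
    by (simp add: sgn_if max_def)
  show ?case
  proof (cases "k = l")
    case True
    then show ?thesis using snoc.IH[of l] by (simp add: pseed_simps mutate_def mutate_matrix_def ty_snoc del: map_append)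
  next
    case False
    have "real_of_int (bp (ks @ [l]) $ Inr j $ k) = real_of_int (bp ks $ Inr j $ k)
        + real_of_int (sgn (bp ks $ Inr j $ l) * max 0 (bp ks $ Inr j $ l * bp ks $ Inl l $ k))"
      using False by (simp add: pseed_simps mutate_def mutate_matrix_def)
    also have "\<dots> = ty (ks @ [l]) u k"
      unfolding of unfolding of_int_mult form bp_Inl snoc.IH ty_snoc using False by simp
    finally show ?thesis .
  qed
qed

definition pos_cone :: "(real, 'v) vec set" where
  "pos_cone = {u. \<forall>k. ty [] u k \<ge> 0}"

lemma pos_cone_sign:
  assumes "u \<in> pos_cone" "w \<in> pos_cone" "ty ks u k > 0"
  shows "ty ks w k \<ge> 0"
  by (rule core.sign_coherence_pos[of "($) u" "($) w" "map \<iota> ks" "\<iota> k"]) (use assms in \<open>auto simp: pos_cone_def\<close>)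

lemma sum_Plus: "(\<Sum>v\<in>UNIV. f v) = (\<Sum>i\<in>UNIV. f (Inl i)) + (\<Sum>j\<in>UNIV. f (Inr j))"
  for f :: "'n + 'n \<Rightarrow> 'b::comm_monoid_add"
  unfolding UNIV_Plus_UNIV[symmetric] by (subst sum.Plus) simp_all

lemma sum_mutable:
  fixes f :: "'v \<Rightarrow> real"
  assumes "\<And>v. v \<notin> range \<iota> \<Longrightarrow> f v = 0"
  shows "(\<Sum>v\<in>UNIV. f v) = (\<Sum>i\<in>UNIV. f (\<iota> i))"
proof -
  have "(\<Sum>v\<in>UNIV. f v) = (\<Sum>v\<in>range \<iota>. f v)" by (rule sum.mono_neutral_right) (use assms in auto)
  also have "\<dots> = (\<Sum>i\<in>UNIV. f (\<iota> i))" using inj by (simp add: sum.reindex)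
  finally show ?thesis .
qed

lemma degree_of_seed:
  "\<exists>D. (\<forall>v. has_degree B (fst (pseed ks) v) (D v)) \<and> (\<forall>l. (\<Sum>v\<in>UNIV. bp ks $ v $ l *s D v) = 0) \<and>
    (\<forall>j. D (Inr j) = var_degree B (Inr j)) \<and>
    (\<exists>a. (\<forall>u\<in>pos_cone. \<forall>v. tx ks u v = (\<Sum>j\<in>UNIV. a v j * u $ j)) \<and>
      (\<forall>v. v \<notin> range \<iota> \<longrightarrow> (\<forall>j. a v j = (if j = v then 1 else 0))) \<and>
      (\<forall>k i. a (\<iota> k) (\<iota> i) = real_of_int (D (Inl k) $ i)))"
proof (induction ks rule: rev_induct)
  case Nil
  show ?case
  proof (intro exI[of _ "var_degree B"] conjI allI exI[of _ "\<lambda>v j. if j = v then 1 else 0"] ballI impI)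
    fix v show "has_degree B (fst (pseed []) v) (var_degree B v)" by (simp add: pseed_simps has_degree_var)
  next
    fix l
    have "(\<Sum>i\<in>UNIV. B $ i $ l *s axis i 1) + (\<Sum>j\<in>UNIV. (if j = l then 1 else 0) *s - (B *v axis j 1)) = (0 :: (int, 'n) vec)"
    proof -
      have "(\<Sum>j\<in>UNIV. (if j = l then 1 else 0) *s - (B *v axis j 1)) = (\<Sum>j\<in>UNIV. if j = l then - (B *v axis l 1) else 0)"
        by (rule sum.cong) auto
      then have 1: "(\<Sum>j\<in>UNIV. (if j = l then 1 else 0) *s - (B *v axis j 1)) = - (B *v axis l 1)" by simp
      have "(\<Sum>i\<in>UNIV. B $ i $ l *s axis i 1) $ m = (B *v axis l 1) $ m" for m
      proof -
        have "(\<Sum>i\<in>UNIV. B $ i $ l * (axis i 1 :: (int, 'n) vec) $ m) = (\<Sum>i\<in>UNIV. if i = m then B $ m $ l else 0)"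
          by (rule sum.cong) (auto simp: axis_def)
        moreover have "(\<Sum>i\<in>UNIV. B $ m $ i * (axis l 1 :: (int, 'n) vec) $ i) = (\<Sum>i\<in>UNIV. if i = l then B $ m $ l else 0)"
          by (rule sum.cong) (auto simp: axis_def)
        ultimately show ?thesis by (simp add: matrix_vector_mult_def)
      qed
      then show ?thesis unfolding 1 by (simp add: vec_eq_iff)
    qed
    then show "(\<Sum>v\<in>UNIV. bp [] $ v $ l *s var_degree B v) = 0"
      unfolding sum_Plus by (simp add: pseed_simps principal_ext_def var_degree_def)
  next
    fix u v show "tx [] u v = (\<Sum>j\<in>UNIV. (if j = v then 1 else 0) * u $ j)"
      by (simp add: if_distrib[of "\<lambda>x. x * _"] cong: if_cong)
  next
    fix k i
    have "\<iota> i = \<iota> k \<longleftrightarrow> i = k" using inj by (metis injD)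
    then show "(if \<iota> i = \<iota> k then 1 else 0) = real_of_int (var_degree B (Inl k) $ i)"
      by (auto simp: var_degree_def axis_def)
  qed auto
next
  case (snoc k ks)
  then obtain D a where D: "\<And>v. has_degree B (fst (pseed ks) v) (D v)"
    and hom: "\<And>l. (\<Sum>v\<in>UNIV. bp ks $ v $ l *s D v) = 0"
    and Dr: "\<And>j. D (Inr j) = var_degree B (Inr j)"
    and a: "\<And>u v. u \<in> pos_cone \<Longrightarrow> tx ks u v = (\<Sum>j\<in>UNIV. a v j * u $ j)"
    and af: "\<And>v j. v \<notin> range \<iota> \<Longrightarrow> a v j = (if j = v then 1 else 0)"
    and aD: "\<And>k i. a (\<iota> k) (\<iota> i) = real_of_int (D (Inl k) $ i)"
    by blast
  define D' where "D' = D(Inl k := - D (Inl k) + (\<Sum>v\<in>UNIV. max 0 (bp ks $ v $ k) *s D v))"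
  define e :: real where "e = (if \<exists>u\<in>pos_cone. ty ks u k > 0 then 1 else - 1)"
  define a' where "a' = lin_step e (\<iota> k) (bw \<beta> (map \<iota> ks)) a"
  have e_ty: "e = 1 \<and> ty ks u k \<ge> 0 \<or> e = - 1 \<and> ty ks u k \<le> 0" if "u \<in> pos_cone" for u
    using pos_cone_sign[OF _ that, of _ ks k] that by (auto simp: e_def not_less)
  have c: "e = 1 \<and> bp ks $ Inr j $ k \<ge> 0 \<or> e = - 1 \<and> bp ks $ Inr j $ k \<le> 0" for j
  proof -
    obtain u where u: "\<forall>l. ty [] u l = (if l = j then 1 else 0)"
      using ty_onto[of "[]" "\<lambda>l. if l = j then 1 else 0"] by blast
    then have "u \<in> pos_cone" by (simp add: pos_cone_def)
    have "real_of_int (bp ks $ Inr j $ k) = ty ks u k" using bp_Inr[of u j ks k] u by blast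
    then show ?thesis using e_ty[OF \<open>u \<in> pos_cone\<close>] by auto
  qed
  have nz: "fst (pseed ks) (Inl k) \<noteq> 0"
    using seed_subtraction_free[of "pseed ks" Inl "principal_ext B"] principal_seeds_eq subtraction_free_nonzero by blast
  have deg': "has_degree B (fst (pseed (ks @ [k])) v) (D' v)" for v
    using D has_degree_exchange[of B "pseed ks" D k, OF D nz hom] by (simp add: D'_def pseed_simps mutate_def)
  have hom': "(\<Sum>v\<in>UNIV. bp (ks @ [k]) $ v $ l *s D' v) = 0" for l
    unfolding D'_def pseed_simps mutate_def snd_conv by (rule balanced_mutate[OF hom bp_diag])
  have tx': "tx (ks @ [k]) u v = (\<Sum>j\<in>UNIV. a' v j * u $ j)" if u: "u \<in> pos_cone" for u v
  proof -
    have "tx (ks @ [k]) u = xl e (\<iota> k) (bw \<beta> (map \<iota> ks)) (tx ks u)"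
      unfolding map_append xw_append using xm_eq_xl[OF e_ty[OF u]] by simp
    then show ?thesis using xl_lin_step[of "tx ks u" a "($) u", OF a[OF u]] by (simp add: a'_def)
  qed
  have af': "a' v j = (if j = v then 1 else 0)" if "v \<notin> range \<iota>" for v j
    using af[OF that, of j] that by (auto simp: a'_def lin_step_def)
  have aD': "a' (\<iota> l) (\<iota> i) = real_of_int (D' (Inl l) $ i)" for l i
  proof (cases "l = k")
    case False
    then have "\<iota> l \<noteq> \<iota> k" using inj by (metis injD)
    then show ?thesis using False aD by (simp add: a'_def lin_step_def D'_def)
  next
    case True
    let ?c = "\<lambda>v. bp ks $ v $ k"
    have zero: "a v (\<iota> i) = 0" if "v \<notin> range \<iota>" for v using af[OF that] that by auto
    have "(\<Sum>v\<in>UNIV. max 0 (- (e * bw \<beta> (map \<iota> ks) v (\<iota> k))) * a v (\<iota> i))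
        = (\<Sum>m\<in>UNIV. max 0 (- (e * real_of_int (?c (Inl m)))) * real_of_int (D (Inl m) $ i))"
      by (subst sum_mutable) (simp_all add: zero bw_\<beta> aD bp_Inl)
    also have "\<dots> = real_of_int ((\<Sum>v\<in>UNIV. max 0 (?c v) *s D v) $ i)"
    proof (cases "e = 1")
      case True
      then have "?c (Inr j) \<ge> 0" for j using c[of j] by auto
      \<comment> \<open>Replace \<open>max 0 x\<close> by \<open>x + max 0 (- x)\<close>: the
        balanced sum is 0, and the nonnegative frozen entries have no negative part.\<close>
      then have "(\<Sum>v\<in>UNIV. max 0 (?c v) *s D v) = (\<Sum>v\<in>UNIV. ?c v *s D v) + (\<Sum>m\<in>UNIV. max 0 (- ?c (Inl m)) *s D (Inl m))"
        unfolding sum_Plus by (simp add: sum.distrib[symmetric] add.commute add.left_commute)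
           (rule sum.cong, auto simp: max_def vec_eq_iff)
      then show ?thesis using True unfolding hom by (simp add: of_int_max)
    next
      case False
      then have "e = - 1" "\<And>j. ?c (Inr j) \<le> 0" using c by auto
      then have "(\<Sum>j\<in>UNIV. max 0 (?c (Inr j)) *s D (Inr j)) = 0"
        by (intro sum.neutral) (simp add: max_absorb1)
      then show ?thesis unfolding sum_Plus using \<open>e = - 1\<close> by (simp add: of_int_max)
    qed
    finally show ?thesis using aD[of k i] by (simp add: True a'_def lin_step_def D'_def)
  qed
  show ?case
    using deg' hom' tx' af' aD' Dr by (intro exI[of _ D'] conjI exI[of _ a'] allI ballI impI) (auto simp: D'_def)
qed

section \<open>The linear map onto the cluster fan\<close>

definition gvec :: "'n list \<Rightarrow> 'n \<Rightarrow> (real, 'n) vec" where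
  "gvec ks k = g_vector B (fst (pseed ks) (Inl k))"

definition T :: "(real, 'v) vec \<Rightarrow> (real, 'n) vec" where
  "T w = (\<chi> i. - ty [] w i / real_of_int (dn i))"

lemma linear_T: "linear T"
  by (rule linearI) (simp_all add: T_def yv_linear vec_eq_iff add_divide_distrib diff_divide_distrib)

lemma T_on_seed_cone:
  assumes w: "w \<in> seed_cone ks"
  shows "T w = (\<Sum>k\<in>UNIV. (- ty ks w k / real_of_int (dn k)) *\<^sub>R gvec ks k)"
proof -
  obtain D a where D: "\<And>v. has_degree B (fst (pseed ks) v) (D v)"
    and a: "\<And>u v. u \<in> pos_cone \<Longrightarrow> tx ks u v = (\<Sum>j\<in>UNIV. a v j * u $ j)"
    and af: "\<And>v j. v \<notin> range \<iota> \<Longrightarrow> a v j = (if j = v then 1 else 0)"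
    and aD: "\<And>k i. a (\<iota> k) (\<iota> i) = real_of_int (D (Inl k) $ i)"
    using degree_of_seed[of ks] by blast
  have nz: "fst (pseed ks) v \<noteq> 0" for v
    using seed_subtraction_free[of "pseed ks" Inl "principal_ext B"] principal_seeds_eq subtraction_free_nonzero by blast
  have g: "gvec ks k $ i = a (\<iota> k) (\<iota> i)" for k i
    unfolding gvec_def g_vector_eq[OF D nz] aD by simp
  define \<eta> where "\<eta> l = yv (bw \<beta> (map \<iota> ks)) (tx ks w) l / dv l" for l
  define \<eta>0 where "\<eta>0 l = yv \<beta> (($) w) l / dv l" for l
  \<comment> \<open>The difference of the two sides of the duality, as a linear form in
    \<open>u\<close>; the aim is that its coefficients vanish.\<close>
  define \<phi> where "\<phi> u = (\<Sum>j\<in>UNIV. u $ j * ((\<Sum>l\<in>UNIV. a l j * \<eta> l) - \<eta>0 j))" for u :: "(real, 'v) vec"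
  have \<phi>_pos: "\<phi> u = 0" if u: "u \<in> pos_cone" for u
  proof -
    have "core.F (map \<iota> ks) (($) u) (($) w) = core.F [] (($) u) (($) w)"
      by (rule core.duality) (use u w in \<open>auto simp: pos_cone_def seed_cone_def core.sink_def\<close>)
    then have "(\<Sum>l\<in>UNIV. tx ks u l * \<eta> l) = (\<Sum>l\<in>UNIV. u $ l * \<eta>0 l)"
      by (simp add: Phi_def \<eta>_def \<eta>0_def)
    moreover have "(\<Sum>l\<in>UNIV. tx ks u l * \<eta> l) = (\<Sum>l\<in>UNIV. \<Sum>j\<in>UNIV. u $ j * (a l j * \<eta> l))"
      by (simp add: a[OF u] sum_distrib_left sum_distrib_right mult_ac)
    moreover have "\<dots> = (\<Sum>j\<in>UNIV. u $ j * (\<Sum>l\<in>UNIV. a l j * \<eta> l))"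
      by (subst sum.swap) (simp add: sum_distrib_left)
    ultimately show ?thesis by (simp add: \<phi>_def right_diff_distrib sum_subtractf)
  qed
  have lin: "\<phi> (x + y) = \<phi> x + \<phi> y" "\<phi> (s *\<^sub>R x) = s * \<phi> x" for x y s
    by (simp_all add: \<phi>_def distrib_right sum.distrib sum_distrib_left mult_ac)
  have \<phi>0: "\<phi> u = 0" for u
  proof -
    obtain p where p: "\<forall>k. ty [] p k = 1" using ty_onto[of "[]" "\<lambda>_. 1"] by blast
    \<comment> \<open>\<open>pos_cone\<close> spans the space: adding a large multiple of
      \<open>p\<close>, whose y-variables are all 1, moves any \<open>u\<close> into it.\<close>
    define c where "c = (\<Sum>k\<in>UNIV. \<bar>ty [] u k\<bar>)"
    have c: "- ty [] u k \<le> c" for k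
    proof -
      have "\<bar>ty [] u k\<bar> \<le> c" unfolding c_def by (rule member_le_sum) auto
      then show ?thesis by simp
    qed
    have "c \<ge> 0" unfolding c_def by (rule sum_nonneg) simp
    have y: "ty [] (c *\<^sub>R p) k = c" "ty [] (u + c *\<^sub>R p) k = ty [] u k + c" for k
      using p yv_linear[of \<beta>] by simp_all
    have "ty [] u k + c \<ge> 0" for k using c[of k] by simp
    then have "c *\<^sub>R p \<in> pos_cone" "u + c *\<^sub>R p \<in> pos_cone"
      unfolding pos_cone_def mem_Collect_eq y using \<open>c \<ge> 0\<close> by blast+
    then show ?thesis using \<phi>_pos lin(1)[of u "c *\<^sub>R p"] by simp
  qed
  have "T w $ i = (\<Sum>k\<in>UNIV. (- ty ks w k / real_of_int (dn k)) * a (\<iota> k) (\<iota> i))" for i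
  proof -
    have "\<phi> (axis (\<iota> i) 1) = (\<Sum>j\<in>UNIV. if j = \<iota> i then (\<Sum>l\<in>UNIV. a l j * \<eta> l) - \<eta>0 j else 0)"
      unfolding \<phi>_def by (rule sum.cong) (auto simp: axis_def)
    then have "(\<Sum>l\<in>UNIV. a l (\<iota> i) * \<eta> l) = \<eta>0 (\<iota> i)" using \<phi>0 by simp
    moreover have "(\<Sum>l\<in>UNIV. a l (\<iota> i) * \<eta> l) = (\<Sum>k\<in>UNIV. a (\<iota> k) (\<iota> i) * \<eta> (\<iota> k))"
      by (rule sum_mutable) (use af in auto)
    ultimately show ?thesis
      by (simp add: T_def \<eta>_def \<eta>0_def dv_def sum_negf mult.commute)
  qed
  then show ?thesis by (simp add: vec_eq_iff g)
qed

lemma T_eq_iff: "T w = T w' \<longleftrightarrow> w - w' \<in> lin_space"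
proof -
  have "dn i \<noteq> 0" for i using dn_pos[of i] by simp
  then have "T w = T w' \<longleftrightarrow> (\<forall>k. ty [] w k = ty [] w' k)"
    by (simp add: T_def vec_eq_iff)
  also have "\<dots> \<longleftrightarrow> w - w' \<in> lin_space"
    using ty_translate[of w w' "[]"] ty_determines[of "[]" w w'] by blast
  finally show ?thesis .
qed

lemma T_face: "T ` face ks J = convex_cone hull (gvec ks ` J)"
proof (rule subset_antisym)
  show "T ` face ks J \<subseteq> convex_cone hull (gvec ks ` J)"
  proof
    fix z assume "z \<in> T ` face ks J"
    then obtain w where w: "w \<in> face ks J" "z = T w" by blast
    have C: "w \<in> seed_cone ks" using w(1) by (simp add: face_def)
    let ?c = "\<lambda>k. - ty ks w k / real_of_int (dn k)"
    have "z = (\<Sum>k\<in>UNIV. ?c k *\<^sub>R gvec ks k)" unfolding w(2) by (rule T_on_seed_cone[OF C])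
    also have "\<dots> = (\<Sum>k\<in>J. ?c k *\<^sub>R gvec ks k)"
      by (rule sum.mono_neutral_right) (use w(1) in \<open>auto simp: face_def\<close>)
    also have "\<dots> \<in> convex_cone hull (gvec ks ` J)"
    proof -
      have "(\<Sum>k\<in>I. ?c k *\<^sub>R gvec ks k) \<in> convex_cone hull (gvec ks ` J)" if "I \<subseteq> J" for I
        using finite[of I] that
      proof (induction I rule: finite_induct)
        case empty
        then show ?case by (simp add: convex_cone_hull_contains_0)
      next
        case (insert k I)
        have "?c k \<ge> 0" using seed_coneD[OF C, of k] dn_pos[of k] by (simp add: divide_nonpos_pos)
        moreover have "gvec ks k \<in> convex_cone hull (gvec ks ` J)" using insert.prems by (intro hull_inc) auto
        ultimately have "?c k *\<^sub>R gvec ks k \<in> convex_cone hull (gvec ks ` J)" by (intro convex_cone_hull_mul)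
        then show ?case
          unfolding sum.insert[OF insert.hyps] using insert.IH insert.prems by (intro convex_cone_hull_add) auto
      qed
      then show ?thesis by blast
    qed
    finally show "z \<in> convex_cone hull (gvec ks ` J)" .
  qed
  show "convex_cone hull (gvec ks ` J) \<subseteq> T ` face ks J"
  proof (rule hull_minimal)
    show "convex_cone (T ` face ks J)" using convex_cone_face linear_T by (intro convex_cone_linear_image) blast
    show "gvec ks ` J \<subseteq> T ` face ks J"
    proof
      fix z assume "z \<in> gvec ks ` J"
      then obtain k where k: "k \<in> J" "z = gvec ks k" by blast
      \<comment> \<open>The value \<open>- dn k\<close> gives \<open>gvec ks k\<close> the
        coefficient 1 in \<open>T_on_seed_cone\<close>.\<close>
      obtain w where w: "\<forall>l. ty ks w l = (if l = k then - real_of_int (dn k) else 0)"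
        using ty_onto[of ks "\<lambda>l. if l = k then - real_of_int (dn k) else 0"] by blast
      have C: "w \<in> seed_cone ks" using w dn_pos[of k] by (auto simp: seed_cone_def)
      have "(- ty ks w l / real_of_int (dn l)) *\<^sub>R gvec ks l = (if l = k then gvec ks k else 0)" for l
        using w dn_pos[of k] by auto
      then have "T w = gvec ks k" unfolding T_on_seed_cone[OF C] by simp
      moreover have "w \<in> face ks J" using C w k(1) by (auto simp: face_def)
      ultimately show "z \<in> T ` face ks J" using k(2) by (intro image_eqI[of _ _ w]) simp_all
    qed
  qed
qed

lemma cluster_fan_eq: "cluster_fan B = (`) T ` linearity_fan \<iota> Bt"
proof -
  have "cluster_fan B = {convex_cone hull (gvec ks ` J) | ks J. True}"
  proof (intro subset_antisym subsetI)
    fix C assume "C \<in> cluster_fan B"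
    then obtain S ks where S: "S \<subseteq> cluster Inl (pseed ks)" "C = convex_cone hull (g_vector B ` S)"
      unfolding cluster_fan_def principal_seeds_eq by blast
    then obtain J where "S = (\<lambda>k. fst (pseed ks) (Inl k)) ` J"
      unfolding cluster_def image_image subset_image_iff by blast
    then have "g_vector B ` S = gvec ks ` J" by (simp add: image_image gvec_def)
    then show "C \<in> {convex_cone hull (gvec ks ` J) | ks J. True}" using S(2) by auto
  next
    fix C assume "C \<in> {convex_cone hull (gvec ks ` J) | ks J. True}"
    then obtain ks J where C: "C = convex_cone hull (gvec ks ` J)" by blast
    let ?S = "(\<lambda>k. fst (pseed ks) (Inl k)) ` J"
    have "gvec ks ` J = g_vector B ` ?S" by (simp add: image_image gvec_def)
    moreover have "?S \<subseteq> cluster Inl (pseed ks)" by (auto simp: cluster_def)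
    moreover have "pseed ks \<in> seeds Inl (principal_ext B)" unfolding principal_seeds_eq by blast
    ultimately show "C \<in> cluster_fan B" unfolding cluster_fan_def C by auto
  qed
  also have "\<dots> = (`) T ` linearity_fan \<iota> Bt"
    unfolding linearity_fan_faces T_face[symmetric] by blast
  finally show ?thesis .
qed

text \<open>Each cone of the fan is a union of cosets of \<open>lin_space\<close>, and these cosets
  are the fibres of \<open>T\<close>.\<close>

lemma face_subset_iff:
  assumes "C \<in> linearity_fan \<iota> Bt" "C' \<in> linearity_fan \<iota> Bt"
  shows "T ` C \<subseteq> T ` C' \<longleftrightarrow> C \<subseteq> C'"
proof
  assume sub: "T ` C \<subseteq> T ` C'"
  obtain ks J where C': "C' = face ks J" using assms(2) unfolding linearity_fan_faces by blast
  show "C \<subseteq> C'"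
  proof
    fix w assume "w \<in> C"
    then obtain w' where "w' \<in> C'" "T w = T w'" using sub by blast
    then show "w \<in> C'" unfolding C' T_eq_iff by (rule face_translate)
  qed
qed blast

end

section \<open>The quotient fan\<close>

context cluster_setting
begin

lemma Trop_pos_fan_eq: "Trop_pos_fan \<iota> Bt = (`) graph_map ` linearity_fan \<iota> Bt"
proof -
  have "{w \<in> Trop_pos \<iota> Bt. initial_projection w \<in> C} = graph_map ` C" for C
    unfolding Trop_pos_eq using initial_projection_graph_map by auto
  then show ?thesis unfolding Trop_pos_fan_def by simp
qed

text \<open>The smallest face is the same for all seeds and is itself a cone of the fan, so a
  subspace contained in all cones can be no larger.\<close>

lemma face_empty: "face ks {} = lin_space"
proof -
  have "ty ks 0 k = 0" for k
  proof -
    obtain l where l: "\<And>k. linear (l k)" "\<And>w k. w \<in> seed_cone ks \<Longrightarrow> ty ks w k = l k w"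
      using ty_linear_form[of ks] by blast
    show ?thesis
      using l(2)[OF convex_cone_contains_0[OF convex_cone_seed_cone]] linear_0[OF l(1)] by simp
  qed
  then have "w \<in> face ks {} \<longleftrightarrow> (\<forall>k. ty ks w k = ty ks 0 k)" for w
    by (auto simp: face_def seed_cone_def)
  also have "(\<forall>k. ty ks w k = ty ks 0 k) \<longleftrightarrow> w - 0 \<in> lin_space" for w
    using ty_translate[of w 0 ks] ty_determines[of ks w 0] by blast
  finally show ?thesis by auto
qed

lemma lin_space_in_fan: "lin_space \<in> linearity_fan \<iota> Bt"
  unfolding linearity_fan_faces using face_empty by blast

lemma fan_translate:
  assumes "C \<in> linearity_fan \<iota> Bt" "w \<in> C" "l \<in> lin_space"
  shows "w + l \<in> C"
proof -
  obtain ks J where C: "C = face ks J" using assms(1) unfolding linearity_fan_faces by blast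
  show ?thesis unfolding C by (rule face_translate[of w]) (use assms C in auto)
qed

lemma lin_space_subset:
  assumes "C \<in> linearity_fan \<iota> Bt"
  shows "lin_space \<subseteq> C"
proof
  fix l assume "l \<in> lin_space"
  moreover have "0 \<in> C"
    using assms convex_cone_contains_0[OF convex_cone_face] unfolding linearity_fan_faces by blast
  ultimately show "l \<in> C" using fan_translate[OF assms, of 0 l] by simp
qed

text \<open>\<open>graph_map\<close> is only piecewise linear, but \<open>lin_space\<close> lies in
  every seed cone, so linearity on a single one is enough to translate along it.\<close>

lemma graph_map_linear_on_seed_cone:
  assumes "u \<in> seed_cone ks" "w \<in> seed_cone ks"
  shows "graph_map (u + w) = graph_map u + graph_map w"
    and "c *\<^sub>R u \<in> seed_cone ks \<Longrightarrow> graph_map (c *\<^sub>R u) = c *\<^sub>R graph_map u"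
proof -
  have lin: "\<exists>l. linear l \<and> (\<forall>w\<in>seed_cone ks. tropicalization f w = l w)" if "f \<in> coordinates \<iota> Bt" for f
  proof -
    obtain ls i where "f = xs ls i" using \<open>f \<in> coordinates \<iota> Bt\<close> unfolding coordinates_eq by blast
    then show ?thesis using tx_linear_on_cone[of ks ls i] by (simp add: tropicalization_xs)
  qed
  have sum: "u + w \<in> seed_cone ks" using convex_cone_add[OF convex_cone_seed_cone assms] .
  show "graph_map (u + w) = graph_map u + graph_map w"
  proof
    fix f
    show "graph_map (u + w) f = (graph_map u + graph_map w) f"
      using lin[of f] assms sum by (auto simp: graph_map_def plus_fun_def linear_add)
  qed
  show "graph_map (c *\<^sub>R u) = c *\<^sub>R graph_map u" if "c *\<^sub>R u \<in> seed_cone ks"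
  proof
    fix f
    show "graph_map (c *\<^sub>R u) f = (c *\<^sub>R graph_map u) f"
      using lin[of f] assms that by (auto simp: graph_map_def scaleR_fun_def linear_scale)
  qed
qed

lemma lin_space_seed_cone: "l \<in> lin_space \<Longrightarrow> l \<in> seed_cone ks"
  using lin_space_subset[of "seed_cone ks"] face_empty[of ks] by (auto simp: face_def)

lemma graph_map_translate:
  assumes "C \<in> linearity_fan \<iota> Bt" "w \<in> C" "l \<in> lin_space"
  shows "graph_map (w + l) = graph_map w + graph_map l"
proof -
  obtain ks J where "C = face ks J" using assms(1) unfolding linearity_fan_faces by blast
  then have "w \<in> seed_cone ks" using assms(2) by (simp add: face_def)
  then show ?thesis using graph_map_linear_on_seed_cone(1) lin_space_seed_cone[OF assms(3)] by blast
qed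

lemma subspace_graph_map_lin_space: "subspace (graph_map ` lin_space)"
proof (rule subspaceI)
  note L = subspace_lin_space
  show "0 \<in> graph_map ` lin_space"
  proof -
    have "graph_map (0 *\<^sub>R 0) = 0 *\<^sub>R graph_map 0"
      by (rule graph_map_linear_on_seed_cone(2)[of _ "[]"]) (use lin_space_seed_cone subspace_0[OF L] in auto)
    then show ?thesis using subspace_0[OF L] by (intro image_eqI[of _ _ 0]) simp_all
  qed
  fix x y assume "x \<in> graph_map ` lin_space" "y \<in> graph_map ` lin_space"
  then obtain u w where uw: "u \<in> lin_space" "w \<in> lin_space" "x = graph_map u" "y = graph_map w" by blast
  show "x + y \<in> graph_map ` lin_space"
    unfolding uw(3,4) graph_map_translate[OF lin_space_in_fan uw(1,2), symmetric]
    using subspace_add[OF L uw(1,2)] by blast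
next
  note L = subspace_lin_space
  fix c x assume "x \<in> graph_map ` lin_space"
  then obtain u where u: "u \<in> lin_space" "x = graph_map u" by blast
  have "graph_map (c *\<^sub>R u) = c *\<^sub>R graph_map u"
    by (rule graph_map_linear_on_seed_cone(2)[of _ "[]"]) (use lin_space_seed_cone subspace_scale[OF L u(1)] u(1) in auto)
  then show "c *\<^sub>R x \<in> graph_map ` lin_space"
    using subspace_scale[OF L u(1), of c] unfolding u(2) by (intro image_eqI[of _ _ "c *\<^sub>R u"]) simp_all
qed

lemma lineality_space_eq: "lineality_space (Trop_pos_fan \<iota> Bt) = graph_map ` lin_space"
  unfolding lineality_space_def
proof (rule Greatest_equality)
  show "subspace (graph_map ` lin_space) \<and> (\<forall>C\<in>Trop_pos_fan \<iota> Bt. graph_map ` lin_space \<subseteq> C)"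
    unfolding Trop_pos_fan_eq using subspace_graph_map_lin_space lin_space_subset by blast
  fix L assume "subspace L \<and> (\<forall>C\<in>Trop_pos_fan \<iota> Bt. L \<subseteq> C)"
  then show "L \<le> graph_map ` lin_space"
    unfolding Trop_pos_fan_eq using lin_space_in_fan by blast
qed

definition cosets :: "(real, 'v) vec set \<Rightarrow> ('v rat_fun \<Rightarrow> real) set set" where
  "cosets C = (\<lambda>w. (+) w ` graph_map ` lin_space) ` graph_map ` C"

lemma quotient_fan_eq:
  "quotient_fan (Trop_pos_fan \<iota> Bt) (lineality_space (Trop_pos_fan \<iota> Bt)) = cosets ` linearity_fan \<iota> Bt"
  unfolding quotient_fan_def lineality_space_eq unfolding Trop_pos_fan_eq cosets_def
  by (simp only: image_image)

text \<open>A coset determines its point of the initial space up to \<open>lin_space\<close>,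
  because \<open>initial_projection\<close> inverts \<open>graph_map\<close>, and the cones are
  stable under \<open>lin_space\<close>.\<close>

lemma cosets_subset_iff:
  assumes "C \<in> linearity_fan \<iota> Bt" "C' \<in> linearity_fan \<iota> Bt"
  shows "cosets C \<subseteq> cosets C' \<longleftrightarrow> C \<subseteq> C'"
proof
  assume sub: "cosets C \<subseteq> cosets C'"
  show "C \<subseteq> C'"
  proof
    fix w assume "w \<in> C"
    then have "(+) (graph_map w) ` graph_map ` lin_space \<in> cosets C'" using sub unfolding cosets_def by blast
    then obtain w' where w': "w' \<in> C'" "(+) (graph_map w) ` graph_map ` lin_space = (+) (graph_map w') ` graph_map ` lin_space"
      unfolding cosets_def by blast
    have "graph_map w + 0 \<in> (+) (graph_map w) ` graph_map ` lin_space"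
      using subspace_0[OF subspace_graph_map_lin_space] by (rule imageI)
    then have "graph_map w + 0 \<in> (+) (graph_map w') ` graph_map ` lin_space"
      by (simp only: w'(2))
    then obtain l where l: "l \<in> lin_space" "graph_map w + 0 = graph_map w' + graph_map l"
      by (elim imageE) blast
    have "graph_map w = graph_map (w' + l)"
      unfolding graph_map_translate[OF assms(2) w'(1) l(1)] using l(2) by (simp only: add_0_right)
    then have "initial_projection (graph_map w) = initial_projection (graph_map (w' + l))" by (rule arg_cong)
    then have "w = w' + l" by (simp only: initial_projection_graph_map)
    then show "w \<in> C'" using fan_translate[OF assms(2) w'(1) l(1)] by (simp only:)
  qed
qed (unfold cosets_def, rule image_mono, rule image_mono)

end

text \<open>Quotient fan and cluster fan are both images of \<open>linearity_fan\<close> under maps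
  that preserve and reflect inclusion; one map composed with the inverse of the other is the
  isomorphism.\<close>

lemma combinatorially_isomorphic_images:
  assumes f: "\<And>C D. C \<in> \<F> \<Longrightarrow> D \<in> \<F> \<Longrightarrow> f C \<subseteq> f D \<longleftrightarrow> C \<subseteq> D"
    and g: "\<And>C D. C \<in> \<F> \<Longrightarrow> D \<in> \<F> \<Longrightarrow> g C \<subseteq> g D \<longleftrightarrow> C \<subseteq> D"
  shows "combinatorially_isomorphic (f ` \<F>) (g ` \<F>)"
proof -
  have inj: "inj_on f \<F>"
    by (rule inj_onI, rule subset_antisym) (simp_all flip: f)
  have inj': "inj_on g \<F>"
    by (rule inj_onI, rule subset_antisym) (simp_all flip: g)
  have "bij_betw (g \<circ> inv_into \<F> f) (f ` \<F>) (g ` \<F>)"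
    using inj inj' by (intro bij_betw_trans[OF bij_betw_inv_into]) (auto simp: bij_betw_def)
  then show ?thesis
    unfolding combinatorially_isomorphic_def
    by (intro exI[of _ "g \<circ> inv_into \<F> f"]) (use f g inj in \<open>auto simp: inv_into_f_f\<close>)
qed

theorem corollary9p4:
  fixes A :: "('n::{finite,linorder}, 'n) int_matrix"
    and arrow :: "'n \<Rightarrow> 'n \<Rightarrow> bool"
    and B :: "('n, 'n) int_matrix"
    and \<iota> :: "'n \<Rightarrow> 'v::{finite,linorder}"
    and Bt :: "('n, 'v) int_matrix"
  assumes "connected_dynkin A"
    and "dynkin_orientation A arrow"
    and "B = exchange_matrix A arrow"
    and "inj \<iota>"
    and "principal_part \<iota> Bt = B"
    and "full_rank Bt"
    and "cluster_finite_type \<iota> Bt"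
  shows "combinatorially_isomorphic
    (quotient_fan (Trop_pos_fan \<iota> Bt) (lineality_space (Trop_pos_fan \<iota> Bt)))
    (cluster_fan B)"
proof -
  have "\<exists>dn :: 'n \<Rightarrow> int. (\<forall>i. dn i > 0) \<and> (\<forall>i j. dn i * A $ i $ j = dn j * A $ j $ i)"
    using assms(1) unfolding connected_dynkin_def by (elim conjE exE, intro exI conjI) assumption+
  then obtain dn :: "'n \<Rightarrow> int" where dn: "\<forall>i. dn i > 0" "\<forall>i j. dn i * A $ i $ j = dn j * A $ j $ i"
    by (elim exE conjE)
  have Bt: "Bt $ \<iota> i $ j = exchange_matrix A arrow $ i $ j" for i j
  proof -
    have "Bt $ \<iota> i $ j = principal_part \<iota> Bt $ i $ j" by (simp add: principal_part_def)
    then show ?thesis by (simp only: assms(3,5))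
  qed
  have arrow: "\<not> (arrow i j \<and> arrow j i)" for i j
    using assms(2) by (simp add: dynkin_orientation_def)
  \<comment> \<open>The symmetrizer of the Cartan matrix also serves for \<open>B\<close>:
    \<open>i\<close> and \<open>j\<close> see their edge with opposite orientations, hence with
    opposite signs.\<close>
  have skew: "dn i * Bt $ \<iota> i $ j = - (dn j * Bt $ \<iota> j $ i)" for i j
    unfolding Bt using arrow[of i j] dn(2)[rule_format, of i j] by (auto simp: exchange_matrix_def)
  interpret cluster_setting \<iota> Bt dn
    using assms(4) dn(1)[rule_format] skew assms(6,7) by (rule cluster_setting.intro)
  show ?thesis
    unfolding quotient_fan_eq assms(5)[symmetric] cluster_fan_eq
    by (rule combinatorially_isomorphic_images) (fact cosets_subset_iff face_subset_iff)+
qed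

end
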